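(* Let $(W,S)$ be an irreducible Coxeter system with $S$ finite, and assume that the Coxeter group $W$ is neither finite nor affine. Then $W$ (viewed as a discrete group) is C$^*$-simple.
   Context: For a Coxeter system $(W,S)$ with $S$ finite, let $E=\mathbf R^S$ be the real vector space with basis $S$, let $B$ be the Tits form on $E$ (the symmetric bilinear form with $B(e_s,e_t)=-\cos(\pi/m_{s,t})$, where $m_{s,t}$ is the order of $st$, and $B(e_s,e_t)=-1$ if $m_{s,t}=\infty$), and let $E_0=\{v\in E\mid B(v,w)=0\text{ for all }w\in E\}$. For irreducible $(W,S)$, $W$ is finite if and only if $B$ is positive definite; $W$ is infinite and contains a free abelian subgroup of finite index if and only if $B$ is positive semidefinite and $\dim_{\mathbf R}E_0\ge 1$, and in this last case $W$ is said to be affine. A unitary representation of a discrete group $\Gamma$ in a nonzero complex Hilbert space $\mathcal H$ is a homomorphism $\rho:\Gamma\to\mathcal U(\mathcal H)$; its diagonal matrix coefficients are the functions $\gamma\mapsto\langle\xi\mid\rho(\gamma)\xi\rangle$ for $\xi\in\mathcal H$. Given two unitary representations $\rho,\sigma$ of $\Gamma$, write $\rho\prec\sigma$ ($\rho$ is weakly contained in $\sigma$) if every diagonal matrix coefficient of $\rho$ is a limit of (finite) sums of diagonal matrix coefficients of $\sigma$, uniformly on finite subsets of $\Gamma$; write $\rho\sim\sigma$ if $\rho\prec\sigma$ and $\sigma\prec\rho$. Let $\lambda_\Gamma$ denote the left-regular representation on $\ell^2(\Gamma)$, $(\lambda_\Gamma(\gamma)\xi)(\gamma')=\xi(\gamma^{-1}\gamma')$.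 The group $\Gamma$ is C$^*$-simple if, for every unitary representation $\rho$ of $\Gamma$, the conditions $\rho\prec\lambda_\Gamma$ and $\rho\sim\lambda_\Gamma$ are equivalent. *)

theory Defs
  imports
    "HOL-Analysis.Analysis"
    "HOL-Library.Function_Algebras"
    "HOL-Algebra.Bij"
    "HOL-Algebra.Generated_Groups"
    "HOL-Algebra.Module"
    "HOL-Algebra.Multiplicative_Group"
begin

section \<open>Group presentations\<close>

text \<open>
  A word in \<open>S\<close> and its formal inverses is a list of signed letters; \<open>(s, True)\<close> stands for \<open>s\<close>
  and \<open>(s, False)\<close> for the inverse of \<open>s\<close>.
\<close>

type_synonym 'a word = "('a \<times> bool) list"

definition words_over :: "'a set \<Rightarrow> 'a word set"
  where "words_over S = {w. fst ` set w \<subseteq> S}"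

fun eval_word :: "('a, 'm) monoid_scheme \<Rightarrow> 'a word \<Rightarrow> 'a"
  where
    "eval_word G [] = \<one>\<^bsub>G\<^esub>"
  | "eval_word G ((s, b) # w) = (if b then s else inv\<^bsub>G\<^esub> s) \<otimes>\<^bsub>G\<^esub> eval_word G w"

text \<open>
  Two words are related iff they represent the same element of the group with generators \<open>S\<close> and
  relators \<open>R\<close>, that is, of the free group on \<open>S\<close> modulo the normal closure of \<open>R\<close>.
\<close>

inductive presentation_eq :: "'a set \<Rightarrow> 'a word set \<Rightarrow> 'a word \<Rightarrow> 'a word \<Rightarrow> bool"
  for S R
  where
    refl: "w \<in> words_over S \<Longrightarrow> presentation_eq S R w w"
  | sym: "presentation_eq S R v w \<Longrightarrow> presentation_eq S R w v"
  | trans: "presentation_eq S R u v \<Longrightarrow> presentation_eq S R v w \<Longrightarrow> presentation_eq S R u w"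
  | cancel: "u \<in> words_over S \<Longrightarrow> v \<in> words_over S \<Longrightarrow> s \<in> S \<Longrightarrow>
      presentation_eq S R (u @ [(s, b), (s, \<not> b)] @ v) (u @ v)"
  | relator: "u \<in> words_over S \<Longrightarrow> v \<in> words_over S \<Longrightarrow> r \<in> R \<Longrightarrow>
      presentation_eq S R (u @ r @ v) (u @ v)"

definition has_presentation :: "('a, 'm) monoid_scheme \<Rightarrow> 'a set \<Rightarrow> 'a word set \<Rightarrow> bool"
  where "has_presentation G S R \<longleftrightarrow>
    S \<subseteq> carrier G \<and> R \<subseteq> words_over S \<and> generate G S = carrier G \<and>
    (\<forall>w \<in> words_over S. eval_word G w = \<one>\<^bsub>G\<^esub> \<longleftrightarrow> presentation_eq S R w [])"


section \<open>Coxeter systems\<close>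

text \<open>\<^const>\<open>group.ord\<close> is \<open>0\<close> on elements of infinite order, so \<open>0\<close> encodes the label \<open>\<infinity>\<close>.\<close>

definition coxeter_label :: "('a, 'm) monoid_scheme \<Rightarrow> 'a \<Rightarrow> 'a \<Rightarrow> nat"
  where "coxeter_label W s t = group.ord W (s \<otimes>\<^bsub>W\<^esub> t)"

definition coxeter_relators :: "('a, 'm) monoid_scheme \<Rightarrow> 'a set \<Rightarrow> 'a word set"
  where "coxeter_relators W S =
    {concat (replicate (coxeter_label W s t) [(s, True), (t, True)]) | s t.
      s \<in> S \<and> t \<in> S \<and> coxeter_label W s t \<noteq> 0}"

locale coxeter_system = group W
  for W :: "('a, 'm) monoid_scheme" (structure) and S :: "'a set" +
  assumes generators_order: "s \<in> S \<Longrightarrow> ord s = 2"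
    and presentation: "has_presentation W S (coxeter_relators W S)"

text \<open>
  Irreducibility says that the Coxeter graph, in which distinct \<open>s\<close> and \<open>t\<close> are adjacent iff their
  label is not \<open>2\<close>, is nonempty and connected.
\<close>

definition irreducible_coxeter :: "('a, 'm) monoid_scheme \<Rightarrow> 'a set \<Rightarrow> bool"
  where "irreducible_coxeter W S \<longleftrightarrow>
    S \<noteq> {} \<and>
    (\<forall>T. T \<subset> S \<and> T \<noteq> {} \<longrightarrow> (\<exists>s\<in>T. \<exists>t\<in>S - T. coxeter_label W s t \<noteq> 2))"

text \<open>\<open>\<real>\<^sup>S\<close> is realised as the space of real functions vanishing outside \<open>S\<close>.\<close>

definition tits_space :: "'a set \<Rightarrow> ('a \<Rightarrow> real) set"
  where "tits_space S = {v. \<forall>s. s \<notin> S \<longrightarrow> v s = 0}"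

definition tits_coeff :: "('a, 'm) monoid_scheme \<Rightarrow> 'a \<Rightarrow> 'a \<Rightarrow> real"
  where "tits_coeff W s t =
    (if coxeter_label W s t = 0 then - 1 else - cos (pi / real (coxeter_label W s t)))"

definition tits_form ::
    "('a, 'm) monoid_scheme \<Rightarrow> 'a set \<Rightarrow> ('a \<Rightarrow> real) \<Rightarrow> ('a \<Rightarrow> real) \<Rightarrow> real"
  where "tits_form W S v w = (\<Sum>s\<in>S. \<Sum>t\<in>S. v s * w t * tits_coeff W s t)"

definition tits_radical :: "('a, 'm) monoid_scheme \<Rightarrow> 'a set \<Rightarrow> ('a \<Rightarrow> real) set"
  where "tits_radical W S = {v \<in> tits_space S. \<forall>w \<in> tits_space S. tits_form W S v w = 0}"

interpretation fun_space: vector_space "\<lambda>(c :: real) (v :: 'a \<Rightarrow> real) s. c * v s"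
  by unfold_locales (auto simp: fun_eq_iff algebra_simps)

definition affine_coxeter :: "('a, 'm) monoid_scheme \<Rightarrow> 'a set \<Rightarrow> bool"
  where "affine_coxeter W S \<longleftrightarrow>
    (\<forall>v \<in> tits_space S. tits_form W S v v \<ge> 0) \<and>
    fun_space.dim (tits_radical W S) \<ge> 1"


section \<open>Complex Hilbert spaces and unitary representations\<close>

definition complex_ring :: "complex ring"
  where "complex_ring = \<lparr>carrier = UNIV, mult = (*), one = 1, ring.zero = 0, add = (+)\<rparr>"

text \<open>
  The ring multiplication and unit of a \<^typ>\<open>(complex, 'h) Module.module\<close> record play no role. Inner
  products are antilinear in the first argument and linear in the second.
\<close>

record 'h inner_space = "(complex, 'h) Module.module" +
  hinner :: "'h \<Rightarrow> 'h \<Rightarrow> complex"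

definition hnorm :: "('h, 'n) inner_space_scheme \<Rightarrow> 'h \<Rightarrow> real"
  where "hnorm H x = sqrt (Re (hinner H x x))"

locale complex_hilbert_space = Module.module complex_ring H
  for H :: "('h, 'n) inner_space_scheme" (structure) +
  assumes hinner_add_right: "\<lbrakk>x \<in> carrier H; y \<in> carrier H; z \<in> carrier H\<rbrakk> \<Longrightarrow>
      hinner H x (y \<oplus> z) = hinner H x y + hinner H x z"
    and hinner_smult_right: "\<lbrakk>x \<in> carrier H; y \<in> carrier H\<rbrakk> \<Longrightarrow>
      hinner H x (c \<odot> y) = c * hinner H x y"
    and hinner_commute: "\<lbrakk>x \<in> carrier H; y \<in> carrier H\<rbrakk> \<Longrightarrow>
      hinner H y x = cnj (hinner H x y)"
    and hinner_pos: "\<lbrakk>x \<in> carrier H; x \<noteq> \<zero>\<rbrakk> \<Longrightarrow> Re (hinner H x x) > 0"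
    and complete: "\<lbrakk>\<And>n. \<sigma> n \<in> carrier H;
        \<forall>e>0. \<exists>N::nat. \<forall>m\<ge>N. \<forall>n\<ge>N. hnorm H (\<sigma> m \<ominus> \<sigma> n) < e\<rbrakk> \<Longrightarrow>
      \<exists>x \<in> carrier H. (\<lambda>n. hnorm H (\<sigma> n \<ominus> x)) \<longlonglongrightarrow> 0"

definition unitary_operators :: "('h, 'n) inner_space_scheme \<Rightarrow> ('h \<Rightarrow> 'h) set"
  where "unitary_operators H = {U \<in> Bij (carrier H).
    (\<forall>x\<in>carrier H. \<forall>y\<in>carrier H. U (x \<oplus>\<^bsub>H\<^esub> y) = U x \<oplus>\<^bsub>H\<^esub> U y) \<and>
    (\<forall>c. \<forall>x\<in>carrier H. U (c \<odot>\<^bsub>H\<^esub> x) = c \<odot>\<^bsub>H\<^esub> U x) \<and>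
    (\<forall>x\<in>carrier H. \<forall>y\<in>carrier H. hinner H (U x) (U y) = hinner H x y)}"

definition unitary_group :: "('h, 'n) inner_space_scheme \<Rightarrow> ('h \<Rightarrow> 'h) monoid"
  where "unitary_group H = BijGroup (carrier H) \<lparr>carrier := unitary_operators H\<rparr>"

definition unitary_rep ::
    "('g, 'm) monoid_scheme \<Rightarrow> ('h, 'n) inner_space_scheme \<Rightarrow> ('g \<Rightarrow> 'h \<Rightarrow> 'h) \<Rightarrow> bool"
  where "unitary_rep G H \<rho> \<longleftrightarrow>
    complex_hilbert_space H \<and> carrier H \<noteq> {\<zero>\<^bsub>H\<^esub>} \<and> \<rho> \<in> hom G (unitary_group H)"

definition diag_coeff ::
    "('h, 'n) inner_space_scheme \<Rightarrow> ('g \<Rightarrow> 'h \<Rightarrow> 'h) \<Rightarrow> 'h \<Rightarrow> 'g \<Rightarrow> complex"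
  where "diag_coeff H \<rho> \<xi> = (\<lambda>g. hinner H \<xi> (\<rho> g \<xi>))"

definition weakly_contained ::
    "('g, 'm) monoid_scheme \<Rightarrow> ('h, 'n) inner_space_scheme \<Rightarrow> ('g \<Rightarrow> 'h \<Rightarrow> 'h) \<Rightarrow>
      ('k, 'p) inner_space_scheme \<Rightarrow> ('g \<Rightarrow> 'k \<Rightarrow> 'k) \<Rightarrow> bool"
  where "weakly_contained G H \<rho> K \<sigma> \<longleftrightarrow>
    (\<forall>\<xi> \<in> carrier H. \<forall>F. finite F \<and> F \<subseteq> carrier G \<longrightarrow> (\<forall>e>0. \<exists>\<eta>s. set \<eta>s \<subseteq> carrier K \<and>
      (\<forall>g\<in>F. cmod (diag_coeff H \<rho> \<xi> g - (\<Sum>\<eta>\<leftarrow>\<eta>s. diag_coeff K \<sigma> \<eta> g)) < e)))"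

definition weakly_equivalent ::
    "('g, 'm) monoid_scheme \<Rightarrow> ('h, 'n) inner_space_scheme \<Rightarrow> ('g \<Rightarrow> 'h \<Rightarrow> 'h) \<Rightarrow>
      ('k, 'p) inner_space_scheme \<Rightarrow> ('g \<Rightarrow> 'k \<Rightarrow> 'k) \<Rightarrow> bool"
  where "weakly_equivalent G H \<rho> K \<sigma> \<longleftrightarrow>
    weakly_contained G H \<rho> K \<sigma> \<and> weakly_contained G K \<sigma> H \<rho>"


section \<open>The regular representation and C*-simplicity\<close>

text \<open>Square-summable functions on the group, extended by zero outside the carrier.\<close>

definition ell2_carrier :: "('g, 'm) monoid_scheme \<Rightarrow> ('g \<Rightarrow> complex) set"
  where "ell2_carrier G = {f. (\<forall>x. x \<notin> carrier G \<longrightarrow> f x = 0) \<and>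
    (\<lambda>x. (cmod (f x))\<^sup>2) summable_on carrier G}"

definition ell2 :: "('g, 'm) monoid_scheme \<Rightarrow> ('g \<Rightarrow> complex) inner_space"
  where "ell2 G =
    \<lparr>carrier = ell2_carrier G,
     mult = (\<lambda>f h x. f x * h x),
     one = (\<lambda>x. 1),
     ring.zero = (\<lambda>x. 0),
     add = (\<lambda>f h x. f x + h x),
     smult = (\<lambda>c f x. c * f x),
     hinner = (\<lambda>f h. \<Sum>\<^sub>\<infinity>x\<in>carrier G. cnj (f x) * h x)\<rparr>"

definition left_regular ::
    "('g, 'm) monoid_scheme \<Rightarrow> 'g \<Rightarrow> ('g \<Rightarrow> complex) \<Rightarrow> ('g \<Rightarrow> complex)"
  where "left_regular G g = (\<lambda>f \<in> ell2_carrier G.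
    (\<lambda>x. if x \<in> carrier G then f (inv\<^bsub>G\<^esub> g \<otimes>\<^bsub>G\<^esub> x) else 0))"

text \<open>
  A HOL definition cannot quantify over types, so the type whose subsets carry the representation
  spaces is a parameter; C*-simplicity is the statement for arbitrary \<open>'h\<close>.
\<close>

definition cstar_simple :: "'h itself \<Rightarrow> ('g, 'm) monoid_scheme \<Rightarrow> bool"
  where "cstar_simple (_ :: 'h itself) G \<longleftrightarrow>
    (\<forall>(H :: 'h inner_space) \<rho>. unitary_rep G H \<rho> \<longrightarrow>
      (weakly_contained G H \<rho> (ell2 G) (left_regular G) \<longleftrightarrow>
       weakly_equivalent G H \<rho> (ell2 G) (left_regular G)))"

end

theory Submission
  imports Defs
begin

text \<open>
  By Gordan's alternative, non-affineness gives a vector \<open>v\<close> with \<open>B v (\<alpha> s) < 0\<close> for all simple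
  roots. As \<open>W\<close> is infinite, some roots satisfy \<open>B \<delta> \<eta> < - 1\<close>; the product of the two reflections has
  an isotropic eigenvector \<open>x\<close>, a limit of rescaled roots, and \<open>B (g x) (h x) \<le> 0\<close> for all \<open>g, h\<close>. Along powers
  of such products, matrix coefficients are Laurent polynomials in \<open>\<sigma>\<^sup>n\<close>, so finitely many of them that do not
  vanish identically have a common non-zero. For \<open>f \<noteq> 1\<close> the function \<open>w \<mapsto> B (w x) (f w x)\<close> does not
  vanish identically: otherwise \<open>f + f\<^sup>-\<^sup>1\<close> would be a scalar on the span of the roots. Hence for every finite
  \<open>F \<subseteq> W - {1}\<close> there is a root whose half-space \<open>C\<close> is disjoint from \<open>f C\<close> for all \<open>f \<in> F\<close>. Since a
  reflection exchanges \<open>C\<close> with its complement, Powers' averaging argument applies and shows that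
  any representation weakly contained in the regular one has sums of coefficients converging to
  \<open>\<delta>\<^sub>1\<close>, and so weakly contains the regular representation.
\<close>

section \<open>The geometric representation\<close>

text \<open>The isotropic vector \<open>x\<close> bounds no half-space; the averaging needs a root
  \<open>y\<close> with \<open>B y (f y) < - 1\<close> for all \<open>f\<close> in \<open>F\<close>
  at once. Working with \<open>x\<close> first reduces this inequality to
  \<open>B (w x) (f w x) \<noteq> 0\<close>, because the sign is forced: positive heights along the
  whole orbit of \<open>x\<close> make all these values nonpositive, and the approximating roots
  magnify a nonzero value beyond - 1. A non-vanishing condition can be met for finitely many
  \<open>f\<close> simultaneously once the group is irreducible for the Zariski topology.
  \<open>W\<close> is not, since its determinant takes both signs; hence the subgroup
  \<open>Wt\<close> generated by the products of two reflections in roots with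
  \<open>B < - 1\<close>, which still contains every product of two generators. The scalar case is
  excluded through its value \<open>K\<close>: for \<open>K \<le> 2\<close> the heights along powers
  of \<open>f\<close> form concave sequences, which cannot decrease and stay positive; for
  \<open>K > 2\<close> each half-space is mapped into itself by \<open>f\<close> or its inverse,
  which three disjoint half-spaces do not allow.\<close>

context coxeter_system
begin

lemma S_carrier: "s \<in> S \<Longrightarrow> s \<in> carrier W"
  using presentation by (auto simp: has_presentation_def)

lemma S_sq: "s \<in> S \<Longrightarrow> s \<otimes> s = \<one>"
  using pow_ord_eq_1[of s] generators_order[of s] S_carrier[of s]
  by (simp add: numeral_2_eq_2)

lemma S_inv: "s \<in> S \<Longrightarrow> inv s = s"
  using S_sq S_carrier inv_equality by blast

lemma label_commute: "s \<in> S \<Longrightarrow> t \<in> S \<Longrightarrow> coxeter_label W s t = coxeter_label W t s"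
proof -
  assume st: "s \<in> S" "t \<in> S"
  have "inv (s \<otimes> t) = t \<otimes> s"
    using st S_carrier S_inv by (simp add: inv_mult_group)
  then show ?thesis
    unfolding coxeter_label_def using ord_inv[of "s \<otimes> t"] st S_carrier by (metis m_closed)
qed

lemma label_refl: "s \<in> S \<Longrightarrow> coxeter_label W s s = 1"
  by (simp add: coxeter_label_def S_sq)

lemma label_ge_2:
  assumes "s \<in> S" "t \<in> S" "s \<noteq> t" "coxeter_label W s t \<noteq> 0"
  shows "coxeter_label W s t \<ge> 2"
proof -
  have "s \<otimes> t \<noteq> \<one>"
    using assms S_carrier S_inv by (metis inv_equality inv_inv)
  then have "coxeter_label W s t \<noteq> 1"
    unfolding coxeter_label_def using assms S_carrier ord_eq_1 by auto
  then show ?thesis using assms(4) by linarith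
qed

lemma coeff_commute: "s \<in> S \<Longrightarrow> t \<in> S \<Longrightarrow> tits_coeff W s t = tits_coeff W t s"
  by (simp add: tits_coeff_def label_commute)

lemma coeff_refl: "s \<in> S \<Longrightarrow> tits_coeff W s s = 1"
  by (simp add: tits_coeff_def label_refl)

lemma coeff_bounds:
  assumes "s \<in> S" "t \<in> S" "s \<noteq> t"
  shows "- 1 \<le> tits_coeff W s t" "tits_coeff W s t \<le> 0"
proof -
  have "0 \<le> cos (pi / real m)" if "m \<ge> 2" for m :: nat
  proof (rule cos_ge_zero)
    show "- (pi / 2) \<le> pi / real m"
      by (rule order_trans[of _ 0]) simp_all
    show "pi / real m \<le> pi / 2"
      using that by (intro divide_left_mono) simp_all
  qed
  then show "tits_coeff W s t \<le> 0"
    using label_ge_2[OF assms] by (auto simp: tits_coeff_def)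
qed (simp add: tits_coeff_def)

lemma coeff_neg:
  assumes "s \<in> S" "t \<in> S" "s \<noteq> t" "coxeter_label W s t \<noteq> 2"
  shows "tits_coeff W s t < 0"
proof -
  have "0 < cos (pi / real m)" if "m \<ge> 3" for m :: nat
  proof (rule cos_gt_zero_pi)
    show "- (pi / 2) < pi / real m"
      by (rule less_le_trans[of _ 0]) simp_all
    show "pi / real m < pi / 2"
      using that by (intro divide_strict_left_mono) simp_all
  qed
  moreover have "coxeter_label W s t = 0 \<or> coxeter_label W s t \<ge> 3"
    using label_ge_2[OF assms(1-3)] assms(4) by linarith
  ultimately show ?thesis
    by (auto simp: tits_coeff_def)
qed

end

lemma scaleR_double: "(x * 2) *\<^sub>R a = x *\<^sub>R a + x *\<^sub>R a" "(2 * x) *\<^sub>R a = x *\<^sub>R a + x *\<^sub>R a"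
  for a :: "'v::real_vector"
  by (simp_all add: scaleR_add_left[symmetric])

text \<open>
  An abstract version of the geometric representation, with coordinate functionals \<open>crd s\<close> dual to
  the simple roots \<open>\<alpha> s\<close>. It spares the proofs the pointwise structure of function spaces.
\<close>

locale coxeter_geometry = coxeter_system W S for W :: "('a, 'm) monoid_scheme" (structure) and S +
  fixes B :: "'v::real_vector \<Rightarrow> 'v \<Rightarrow> real" and \<alpha> :: "'a \<Rightarrow> 'v" and crd :: "'a \<Rightarrow> 'v \<Rightarrow> real"
  assumes finite_S: "finite S"
    and B_add_left: "B (x + y) z = B x z + B y z"
    and B_scale_left: "B (c *\<^sub>R x) z = c * B x z"
    and B_commute: "B x y = B y x"
    and B_simple: "s \<in> S \<Longrightarrow> t \<in> S \<Longrightarrow> B (\<alpha> s) (\<alpha> t) = tits_coeff W s t"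
    and crd_add: "crd s (x + y) = crd s x + crd s y"
    and crd_scale: "crd s (c *\<^sub>R x) = c * crd s x"
    and crd_simple: "s \<in> S \<Longrightarrow> t \<in> S \<Longrightarrow> crd s (\<alpha> t) = (if s = t then 1 else 0)"
begin

definition reflect :: "'v \<Rightarrow> 'v \<Rightarrow> 'v"
  where "reflect a y = y - (2 * B y a) *\<^sub>R a"

lemma B_add_right: "B z (x + y) = B z x + B z y"
  using B_add_left by (metis B_commute)

lemma B_scale_right: "B z (c *\<^sub>R x) = c * B z x"
  using B_scale_left by (metis B_commute)

lemma B_zero [simp]: "B 0 z = 0" "B z 0 = 0"
  using B_scale_left[of 0 0 z] B_scale_right[of z 0 0] by simp_all

lemma B_minus_left: "B (- x) z = - B x z"
  using B_scale_left[of "-1" x z] by simp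

lemma B_minus_right: "B z (- x) = - B z x"
  using B_scale_right[of z "-1" x] by simp

lemma B_diff_left: "B (x - y) z = B x z - B y z"
  using B_add_left[of x "- y" z] by (simp add: B_minus_left)

lemma B_diff_right: "B z (x - y) = B z x - B z y"
  using B_add_right[of z x "- y"] by (simp add: B_minus_right)

lemmas B_linear = B_add_left B_add_right B_scale_left B_scale_right
  B_minus_left B_minus_right B_diff_left B_diff_right

lemma B_simple_self: "s \<in> S \<Longrightarrow> B (\<alpha> s) (\<alpha> s) = 1"
  by (simp add: B_simple coeff_refl)

lemma reflect_add: "reflect a (x + y) = reflect a x + reflect a y"
  by (simp add: reflect_def B_linear algebra_simps)

lemma reflect_scale: "reflect a (c *\<^sub>R x) = c *\<^sub>R reflect a x"
  by (simp add: reflect_def B_linear algebra_simps)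

lemma reflect_isometry: "B a a = 1 \<Longrightarrow> B (reflect a x) (reflect a y) = B x y"
  by (simp add: reflect_def B_linear B_commute[of a x] B_commute[of a y] algebra_simps)

lemma reflect_refl:
  assumes "B a a = 1"
  shows "reflect a (reflect a x) = x"
proof -
  have "B (reflect a x) a = - B x a"
    using assms by (simp add: reflect_def B_diff_left B_scale_left)
  then show ?thesis
    unfolding reflect_def[of a "reflect a x"] by (simp add: reflect_def)
qed

text \<open>On the plane of \<open>a\<close> and \<open>b\<close> the product of the two reflections
  is the rotation by twice \<theta>. Iterating it leads to the three-term recursion of sines, solved
  by these quotients with initial vector \<open>a\<close>.\<close>

lemma reflect_rotation:
  fixes \<theta> :: real
  assumes a: "B a a = 1" and b: "B b b = 1" and ab: "B a b = - cos \<theta>" and \<theta>: "sin \<theta> \<noteq> 0"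
  shows "((\<lambda>y. reflect a (reflect b y)) ^^ n) a =
      (sin ((2 * real n + 1) * \<theta>) / sin \<theta>) *\<^sub>R a + (sin (2 * real n * \<theta>) / sin \<theta>) *\<^sub>R b"
proof (induction n)
  case 0
  show ?case using \<theta> by simp
next
  case (Suc n)
  have step: "reflect a (reflect b (p *\<^sub>R a + q *\<^sub>R b)) =
      (2 * cos \<theta> * (2 * cos \<theta> * p - q) - p) *\<^sub>R a + (2 * cos \<theta> * p - q) *\<^sub>R b" for p q
    by (simp add: reflect_def B_linear a b ab B_commute[of b a] algebra_simps scaleR_double)
  have rec: "2 * cos \<theta> * sin ((x + 1) * \<theta>) = sin ((x + 2) * \<theta>) + sin (x * \<theta>)" for x :: real
  proof -
    have "sin ((x + 2) * \<theta>) = sin ((x + 1) * \<theta> + \<theta>)" "sin (x * \<theta>) = sin ((x + 1) * \<theta> - \<theta>)"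
      by (simp_all add: algebra_simps)
    then show ?thesis by (simp add: sin_add sin_diff)
  qed
  have q: "2 * cos \<theta> * (sin ((2 * real n + 1) * \<theta>) / sin \<theta>) - sin (2 * real n * \<theta>) / sin \<theta>
      = sin ((2 * real n + 2) * \<theta>) / sin \<theta>"
    using rec[of "2 * real n"] \<theta> by (simp add: field_simps)
  have p: "2 * cos \<theta> * (sin ((2 * real n + 2) * \<theta>) / sin \<theta>) - sin ((2 * real n + 1) * \<theta>) / sin \<theta>
      = sin ((2 * real n + 3) * \<theta>) / sin \<theta>"
    using rec[of "2 * real n + 1"] \<theta> by (simp add: field_simps)
  have e3: "2 * real (Suc n) + 1 = 2 * real n + 3" "2 * real (Suc n) = 2 * real n + 2"
    by simp_all
  show ?case
    unfolding funpow.simps o_apply Suc.IH step q p e3 by (simp add: add.assoc)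
qed

lemma reflect_funpow_combination:
  "((\<lambda>y. reflect a (reflect b y)) ^^ n) (x + c *\<^sub>R y) =
    ((\<lambda>y. reflect a (reflect b y)) ^^ n) x + c *\<^sub>R ((\<lambda>y. reflect a (reflect b y)) ^^ n) y"
  by (induction n) (simp_all add: reflect_add reflect_scale)

text \<open>The Gram determinant of \<open>a\<close> and \<open>b\<close> is the square of sin
  \<theta>, hence nonzero. So \<open>y\<close> splits into a vector orthogonal to both, which is
  fixed, and a combination of \<open>a\<close> and \<open>b\<close>, on which \<open>m\<close>
  rotations by 2 pi / m compose to the identity.\<close>

lemma reflect_rotation_order:
  assumes a: "B a a = 1" and b: "B b b = 1" and m: "m \<ge> 2" and ab: "B a b = - cos (pi / real m)"
  shows "((\<lambda>y. reflect a (reflect b y)) ^^ m) y = y"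
proof -
  define \<theta> where "\<theta> = pi / real m"
  let ?R = "\<lambda>y. reflect a (reflect b y)"
  have "0 < \<theta>" "\<theta> < pi" using m by (auto simp: \<theta>_def field_simps)
  then have sin: "sin \<theta> > 0" by (rule sin_gt_zero)
  have ab': "B a b = - cos \<theta>" by (simp add: ab \<theta>_def)
  have mt: "real m * \<theta> = pi" using m by (simp add: \<theta>_def)
  have "(2 * real m + 1) * \<theta> = 2 * pi + \<theta>" "2 * real m * \<theta> = 2 * pi"
    using mt by (simp_all add: algebra_simps)
  then have "sin ((2 * real m + 1) * \<theta>) = sin \<theta>" "sin (2 * real m * \<theta>) = 0"
    unfolding \<open>(2 * real m + 1) * \<theta> = 2 * pi + \<theta>\<close> \<open>2 * real m * \<theta> = 2 * pi\<close>
    by (simp_all add: sin_add)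
  then have Ra: "(?R ^^ m) a = a"
    using reflect_rotation[OF a b ab', of m] sin by simp
  have bR: "?R a = (4 * cos \<theta> ^ 2 - 1) *\<^sub>R a + (2 * cos \<theta>) *\<^sub>R b" "?R b = (- 2 * cos \<theta>) *\<^sub>R a - b"
    by (simp_all add: reflect_def B_linear a b ab' B_commute[of b a] algebra_simps scaleR_double scaleR_2 power2_eq_square)
  have Rb: "(?R ^^ m) b = b"
  \<comment> \<open>After division by 2 cos \<theta>, \<open>b\<close> is a combination of
    \<open>a\<close> and \<open>?R a\<close>, both fixed by the \<open>m\<close>-th power. The
    division fails only for \<open>m = 2\<close>, where \<open>?R b = - b\<close>.\<close>
  proof (cases "cos \<theta> = 0")
    case True
    have "?R b = - b" "?R (- b) = b"
      using True ab' by (simp_all add: reflect_def B_linear b B_commute[of b a] scaleR_2)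
    then have "(?R ^^ n) b = (if even n then b else - b)" for n
      by (induction n) auto
    moreover have "even m"
    proof -
      have "\<theta> = pi / 2" using True \<open>0 < \<theta>\<close> \<open>\<theta> < pi\<close>
        using arccos_cos[of \<theta>] by simp
      with mt have "real m * (pi / 2) = 2 * (pi / 2)" by simp
      then have "real m = 2" by (subst (asm) mult_cancel_right) simp
      then have "m = 2" by linarith
      then show ?thesis by simp
    qed
    ultimately show ?thesis by simp
  next
    case False
    let ?F = "?R ^^ m" and ?c = "2 * cos \<theta>"
    have F: "?F (x + c *\<^sub>R z) = ?F x + c *\<^sub>R ?F z" for x z c
      by (rule reflect_funpow_combination)
    have F0: "?F 0 = 0" using F[of 0 1 0] by simp
    have cb: "?c *\<^sub>R b = ?R a + (- (4 * cos \<theta> ^ 2 - 1)) *\<^sub>R a"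
      unfolding bR by (simp add: algebra_simps)
    have FR: "?F (?R a) = ?R a"
      using Ra by (metis funpow_swap1)
    have "?c *\<^sub>R ?F b = ?F (?c *\<^sub>R b)" using F[of 0 ?c b] F0 by simp
    also have "\<dots> = ?c *\<^sub>R b" unfolding cb F FR Ra ..
    finally show ?thesis using False by simp
  qed
  \<comment> \<open>\<open>p\<close> and \<open>q\<close> solve the two linear equations that make
    \<open>y0\<close> orthogonal to \<open>a\<close> and \<open>b\<close>.\<close>
  define p where "p = (B y a + cos \<theta> * B y b) / (sin \<theta>)\<^sup>2"
  define q where "q = (B y b + cos \<theta> * B y a) / (sin \<theta>)\<^sup>2"
  define y0 where "y0 = y - p *\<^sub>R a - q *\<^sub>R b"
  have s2: "(sin \<theta>)\<^sup>2 = 1 - cos \<theta> * cos \<theta>"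
    by (metis sin_squared_eq power2_eq_square)
  have ne: "1 - cos \<theta> * cos \<theta> \<noteq> 0" using sin s2 by auto
  have solve: "(u + cos \<theta> * w) / (1 - cos \<theta> * cos \<theta>) - cos \<theta> * ((w + cos \<theta> * u) / (1 - cos \<theta> * cos \<theta>)) = u"
    for u w
  proof -
    have "(u + cos \<theta> * w) - cos \<theta> * (w + cos \<theta> * u) = u * (1 - cos \<theta> * cos \<theta>)"
      by (simp add: algebra_simps)
    then show ?thesis
      using ne by (simp add: divide_eq_eq flip: diff_divide_distrib)
  qed
  have "B y0 a = 0"
    using solve[of "B y a" "B y b"]
    by (simp add: y0_def p_def q_def s2 B_diff_left B_scale_left a ab' B_commute[of b a] mult.commute)
  moreover have "B y0 b = 0"
    using solve[of "B y b" "B y a"]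
    by (simp add: y0_def p_def q_def s2 B_diff_left B_scale_left b ab' mult.commute)
  ultimately have "?R y0 = y0" unfolding reflect_def by simp
  then have R0: "(?R ^^ n) y0 = y0" for n by (induction n) auto
  have "y = (y0 + p *\<^sub>R a) + q *\<^sub>R b" by (simp add: y0_def)
  then show ?thesis
    using reflect_funpow_combination[of m a b y0 p a] reflect_funpow_combination[of m a b "y0 + p *\<^sub>R a" q b]
      R0 Ra Rb by simp
qed

section \<open>Action of words and of the group on the vector space\<close>

abbreviation prodw :: "'a list \<Rightarrow> 'a"
  where "prodw ws \<equiv> foldr (\<otimes>) ws \<one>"

abbreviation actw :: "'a list \<Rightarrow> 'v \<Rightarrow> 'v"
  where "actw ws \<equiv> foldr (\<lambda>s. reflect (\<alpha> s)) ws"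

lemma prodw_closed: "set ws \<subseteq> S \<Longrightarrow> prodw ws \<in> carrier W"
  by (induction ws) (auto simp: S_carrier)

lemma prodw_append: "set vs \<subseteq> S \<Longrightarrow> set ws \<subseteq> S \<Longrightarrow> prodw (vs @ ws) = prodw vs \<otimes> prodw ws"
  by (induction vs) (auto simp: S_carrier prodw_closed m_assoc)

lemma prodw_rev: "set ws \<subseteq> S \<Longrightarrow> prodw (rev ws) = inv (prodw ws)"
proof (induction ws)
  case (Cons s ws)
  then show ?case
    using prodw_append[of "rev ws" "[s]"] prodw_closed[of ws]
    by (simp add: S_carrier S_inv inv_mult_group)
qed simp

lemma eval_word_prodw: "w \<in> words_over S \<Longrightarrow> eval_word W w = prodw (map fst w)"
  by (induction w) (auto simp: words_over_def S_inv)

lemma prodw_surj: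
  assumes "g \<in> carrier W"
  obtains ws where "set ws \<subseteq> S" "prodw ws = g"
proof -
  have "g \<in> generate W S"
    using assms presentation by (simp add: has_presentation_def)
  then have "\<exists>ws. set ws \<subseteq> S \<and> prodw ws = g"
  proof induction
    case one
    show ?case by (rule exI[of _ "[]"]) simp
  next
    case (incl s)
    then show ?case by (intro exI[of _ "[s]"]) (simp add: S_carrier)
  next
    case (inv s)
    then show ?case by (intro exI[of _ "[s]"]) (simp add: S_carrier S_inv)
  next
    case (eng g h)
    then obtain vs ws where "set vs \<subseteq> S" "prodw vs = g" "set ws \<subseteq> S" "prodw ws = h" by blast
    then show ?case by (intro exI[of _ "vs @ ws"]) (simp only: prodw_append set_append Un_least)
  qed
  then show ?thesis using that by blast
qed

lemma actw_relator:
  assumes "s \<in> S" "t \<in> S" and m: "m = coxeter_label W s t" "m \<noteq> 0"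
  shows "actw (concat (replicate m [s, t])) y = y"
proof -
  have *: "actw (concat (replicate n [s, t])) z = ((\<lambda>y. reflect (\<alpha> s) (reflect (\<alpha> t) y)) ^^ n) z" for n z
    by (induction n) auto
  show ?thesis
  proof (cases "s = t")
    case True
    then show ?thesis
      using m assms(1) by (simp add: label_refl reflect_refl B_simple_self)
  next
    case False
    show ?thesis
      unfolding * using False assms label_ge_2[OF assms(1,2) False]
      by (intro reflect_rotation_order) (auto simp: B_simple coeff_refl, simp add: tits_coeff_def)
  qed
qed

lemma actw_presentation_eq:
  "presentation_eq S (coxeter_relators W S) v w \<Longrightarrow> actw (map fst v) = actw (map fst w)"
proof (induction rule: presentation_eq.induct)
  case (cancel u v s b)
  then show ?case by (simp add: reflect_refl B_simple_self fun_eq_iff)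
next
  case (relator u v r)
  then obtain s t where r: "r = concat (replicate (coxeter_label W s t) [(s, True), (t, True)])"
    "s \<in> S" "t \<in> S" "coxeter_label W s t \<noteq> 0"
    by (auto simp: coxeter_relators_def)
  have "map fst r = concat (replicate (coxeter_label W s t) [s, t])"
    unfolding r(1) by (simp add: map_concat)
  then show ?case
    using actw_relator[OF r(2,3) HOL.refl r(4)] by (simp add: fun_eq_iff)
qed auto

lemma actw_append: "actw (vs @ ws) y = actw vs (actw ws y)"
  by simp

lemma actw_rev: "set ws \<subseteq> S \<Longrightarrow> actw (rev ws) (actw ws y) = y"
  by (induction ws arbitrary: y) (auto simp: reflect_refl B_simple_self)

text \<open>Generators are involutions, so \<open>rev w @ v\<close> with positive letters only is a
  word for the identity. The presentation reduces it to the empty word, and each reduction step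
  preserves the action.\<close>

lemma actw_eqI:
  assumes v: "set v \<subseteq> S" and w: "set w \<subseteq> S" and eq: "prodw v = prodw w"
  shows "actw v = actw w"
proof -
  let ?u = "map (\<lambda>s. (s, True)) (rev w @ v)"
  have u: "map fst ?u = rev w @ v"
    by (simp add: comp_def)
  have uS: "?u \<in> words_over S"
    using v w by (auto simp: words_over_def)
  have "eval_word W ?u = prodw (rev w @ v)"
    unfolding eval_word_prodw[OF uS] u ..
  also have "\<dots> = \<one>"
    using prodw_append[of "rev w" v] prodw_rev[OF w] prodw_closed[OF w] v w eq by simp
  finally have "presentation_eq S (coxeter_relators W S) ?u []"
    using presentation uS by (auto simp: has_presentation_def)
  then have "actw (rev w @ v) = id"
    using actw_presentation_eq[of ?u "[]"] unfolding u by (simp add: id_def)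
  then have *: "actw (rev w) (actw v y) = y" for y
    by (metis actw_append id_apply)
  show ?thesis
  proof
    fix y
    have "actw w (actw (rev w) z) = z" for z
      using actw_rev[of "rev w" z] w by simp
    then show "actw v y = actw w y"
      using *[of y] by metis
  qed
qed

text \<open>The choice of the word is immaterial by \<open>actw_eqI\<close>. Outside the carrier no
  word exists and the value is arbitrary.\<close>

definition act :: "'a \<Rightarrow> 'v \<Rightarrow> 'v"
  where "act g = actw (SOME ws. set ws \<subseteq> S \<and> prodw ws = g)"

lemma act_prodw:
  assumes "set ws \<subseteq> S"
  shows "act (prodw ws) = actw ws"
proof -
  let ?v = "SOME v. set v \<subseteq> S \<and> prodw v = prodw ws"
  have "set ?v \<subseteq> S \<and> prodw ?v = prodw ws"
    by (rule someI[of _ ws]) (use assms in simp)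
  then show ?thesis
    unfolding act_def using actw_eqI assms by blast
qed

lemma act_mult:
  assumes "g \<in> carrier W" "h \<in> carrier W"
  shows "act (g \<otimes> h) y = act g (act h y)"
proof -
  obtain v w where "set v \<subseteq> S" "prodw v = g" "set w \<subseteq> S" "prodw w = h"
    using prodw_surj assms by metis
  then show ?thesis
    using act_prodw[of v] act_prodw[of w] act_prodw[of "v @ w"] prodw_append[of v w] by auto
qed

lemma act_one [simp]: "act \<one> y = y"
  using act_prodw[of "[]"] by simp

lemma act_S: "s \<in> S \<Longrightarrow> act s y = reflect (\<alpha> s) y"
  using act_prodw[of "[s]"] by (simp add: S_carrier)

lemma act_inv [simp]:
  assumes "g \<in> carrier W"
  shows "act (inv g) (act g y) = y" "act g (act (inv g) y) = y"
  using assms act_mult[of "inv g" g y] act_mult[of g "inv g" y] by auto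

lemma act_induct [consumes 1, case_names one step]:
  assumes "g \<in> carrier W" and "P \<one>" and "\<And>s g. s \<in> S \<Longrightarrow> g \<in> carrier W \<Longrightarrow> P g \<Longrightarrow> P (s \<otimes> g)"
  shows "P g"
proof -
  obtain ws where ws: "set ws \<subseteq> S" "prodw ws = g" using prodw_surj assms(1) by metis
  from ws(1) have "P (prodw ws)"
    by (induction ws) (auto intro: assms prodw_closed)
  then show ?thesis using ws by simp
qed

lemma act_add: "g \<in> carrier W \<Longrightarrow> act g (x + y) = act g x + act g y"
  by (induction rule: act_induct) (auto simp: act_mult S_carrier act_S reflect_add)

lemma act_scale: "g \<in> carrier W \<Longrightarrow> act g (c *\<^sub>R y) = c *\<^sub>R act g y"
  by (induction rule: act_induct) (auto simp: act_mult S_carrier act_S reflect_scale)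

lemma act_zero [simp]: "g \<in> carrier W \<Longrightarrow> act g 0 = 0"
  using act_scale[of g 0 0] by simp

lemma act_minus: "g \<in> carrier W \<Longrightarrow> act g (- y) = - act g y"
  using act_scale[of g "-1" y] by simp

lemma act_diff: "g \<in> carrier W \<Longrightarrow> act g (x - y) = act g x - act g y"
  using act_add[of g x "- y"] by (simp add: act_minus)

lemmas act_linear = act_add act_scale act_minus act_diff

lemma act_isometry: "g \<in> carrier W \<Longrightarrow> B (act g x) (act g y) = B x y"
  by (induction rule: act_induct) (auto simp: act_mult S_carrier act_S reflect_isometry B_simple_self)

lemma act_adjoint: "g \<in> carrier W \<Longrightarrow> B (act g x) y = B x (act (inv g) y)"
  using act_isometry[of g x "act (inv g) y"] by simp

section \<open>The cone spanned by the simple roots\<close>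

definition nonneg :: "'v \<Rightarrow> bool"
  where "nonneg y \<longleftrightarrow> (\<exists>c. (\<forall>s\<in>S. 0 \<le> c s) \<and> y = (\<Sum>s\<in>S. c s *\<^sub>R \<alpha> s))"

lemma nonneg_add: "nonneg x \<Longrightarrow> nonneg y \<Longrightarrow> nonneg (x + y)"
proof -
  assume "nonneg x" "nonneg y"
  then obtain c d where "\<forall>s\<in>S. 0 \<le> c s" "x = (\<Sum>s\<in>S. c s *\<^sub>R \<alpha> s)" "\<forall>s\<in>S. 0 \<le> d s" "y = (\<Sum>s\<in>S. d s *\<^sub>R \<alpha> s)"
    by (auto simp: nonneg_def)
  then show ?thesis
    unfolding nonneg_def by (intro exI[of _ "\<lambda>s. c s + d s"]) (auto simp: scaleR_add_left sum.distrib)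
qed

lemma nonneg_scale: "0 \<le> a \<Longrightarrow> nonneg x \<Longrightarrow> nonneg (a *\<^sub>R x)"
proof -
  assume "0 \<le> a" "nonneg x"
  then obtain c where "\<forall>s\<in>S. 0 \<le> c s" "x = (\<Sum>s\<in>S. c s *\<^sub>R \<alpha> s)"
    by (auto simp: nonneg_def)
  then show ?thesis
    unfolding nonneg_def using \<open>0 \<le> a\<close> by (intro exI[of _ "\<lambda>s. a * c s"]) (auto simp: scaleR_sum_right)
qed

lemma nonneg_simple: "s \<in> S \<Longrightarrow> nonneg (\<alpha> s)"
  unfolding nonneg_def using finite_S
  by (intro exI[of _ "\<lambda>t. if t = s then 1 else 0"]) (auto simp: if_distrib[of "\<lambda>c. c *\<^sub>R _"] cong: if_cong)

lemma crd_zero [simp]: "crd s 0 = 0"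
  using crd_scale[of s 0 0] by simp

lemma crd_minus: "crd s (- x) = - crd s x"
  using crd_scale[of s "-1" x] by simp

lemma crd_diff: "crd s (x - y) = crd s x - crd s y"
  using crd_add[of s x "- y"] by (simp add: crd_minus)

lemma crd_sum: "crd s (\<Sum>i\<in>I. f i) = (\<Sum>i\<in>I. crd s (f i))"
  by (induction I rule: infinite_finite_induct) (auto simp: crd_add)

lemma crd_combination: "s \<in> S \<Longrightarrow> crd s (\<Sum>t\<in>S. c t *\<^sub>R \<alpha> t) = c s"
  using finite_S by (simp add: crd_sum crd_scale crd_simple if_distrib[of "\<lambda>x. _ * x"] cong: if_cong)

lemma nonneg_crd: "nonneg x \<Longrightarrow> s \<in> S \<Longrightarrow> 0 \<le> crd s x"
  by (auto simp: nonneg_def crd_combination)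

lemma nonneg_expand:
  assumes "nonneg x"
  shows "x = (\<Sum>s\<in>S. crd s x *\<^sub>R \<alpha> s)"
proof -
  obtain c where c: "x = (\<Sum>s\<in>S. c s *\<^sub>R \<alpha> s)" using assms by (auto simp: nonneg_def)
  then have "crd s x = c s" if "s \<in> S" for s using crd_combination that by simp
  then show ?thesis using c by (simp cong: sum.cong)
qed

lemma nonneg_antisym:
  assumes "nonneg x" "nonneg (- x)"
  shows "x = 0"
proof -
  have "crd s x = 0" if "s \<in> S" for s
    using nonneg_crd[OF assms(1) that] nonneg_crd[OF assms(2) that] by (simp add: crd_minus)
  then show ?thesis using nonneg_expand[OF assms(1)] by simp
qed

end

section \<open>Positive and negative roots\<close>

context coxeter_geometry
begin

section \<open>Word length and words in a dihedral subgroup\<close>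

definition len :: "'a \<Rightarrow> nat"
  where "len g = (LEAST n. \<exists>ws. set ws \<subseteq> S \<and> length ws = n \<and> prodw ws = g)"

lemma len_le: "set ws \<subseteq> S \<Longrightarrow> len (prodw ws) \<le> length ws"
  unfolding len_def by (rule Least_le) auto

lemma reduced_word:
  assumes "g \<in> carrier W"
  obtains ws where "set ws \<subseteq> S" "prodw ws = g" "length ws = len g"
proof -
  obtain v where "set v \<subseteq> S" "prodw v = g" using prodw_surj assms by metis
  then have "\<exists>n ws. set ws \<subseteq> S \<and> length ws = n \<and> prodw ws = g" by blast
  from LeastI_ex[OF this] that show ?thesis unfolding len_def by blast
qed

lemma len_mult_word:
  assumes "g \<in> carrier W" "set ws \<subseteq> S"
  shows "len (g \<otimes> prodw ws) \<le> len g + length ws"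
proof -
  obtain v where "set v \<subseteq> S" "prodw v = g" "length v = len g" using reduced_word assms(1) by metis
  then show ?thesis
    using len_le[of "v @ ws"] prodw_append[of v ws] assms(2) by simp
qed

lemma len_eq_0: "g \<in> carrier W \<Longrightarrow> len g = 0 \<Longrightarrow> g = \<one>"
  using reduced_word[of g] by (metis foldr_Nil id_apply length_0_conv)

text \<open>Letters are counted from the right: the last one is always \<open>t\<close>. A final
  segment of an alternating word is therefore again of the form
  \<open>alt_word s t k\<close>.\<close>

primrec alt_word :: "'a \<Rightarrow> 'a \<Rightarrow> nat \<Rightarrow> 'a list"
  where
    "alt_word s t 0 = []"
  | "alt_word s t (Suc k) = (if even k then t else s) # alt_word s t k"

lemma length_alt_word [simp]: "length (alt_word s t k) = k"
  by (induction k) auto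

lemma set_alt_word: "set (alt_word s t k) \<subseteq> {s, t}"
  by (induction k) auto

lemma alt_word_add: "\<exists>v. alt_word s t (j + k) = v @ alt_word s t k \<and> length v = j \<and> set v \<subseteq> {s, t}"
proof (induction j)
  case (Suc j)
  then obtain v where "alt_word s t (j + k) = v @ alt_word s t k" "length v = j" "set v \<subseteq> {s, t}" by blast
  then show ?case by (intro exI[of _ "(if even (j + k) then t else s) # v"]) auto
qed auto

lemma alt_word_twice: "alt_word s t (2 * n) = concat (replicate n [s, t])"
  by (induction n) auto

lemma prodw_alt_word_order:
  assumes st: "s \<in> S" "t \<in> S"
  shows "prodw (alt_word s t (2 * coxeter_label W s t)) = \<one>"
proof -
  have "prodw (concat (replicate n [s, t])) = (s \<otimes> t) [^] n" for n
  proof (induction n)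
    case (Suc n)
    have "(s \<otimes> t) [^] Suc n = (s \<otimes> t) \<otimes> (s \<otimes> t) [^] n"
      by (rule nat_pow_Suc2) (use st S_carrier in simp)
    then show ?case using Suc st S_carrier by (simp add: m_assoc)
  qed simp
  then show ?thesis
    unfolding alt_word_twice coxeter_label_def using st S_carrier by (simp add: pow_ord_eq_1)
qed

definition alt_minimal :: "'a \<Rightarrow> 'a \<Rightarrow> 'a list \<Rightarrow> bool"
  where "alt_minimal s t d \<longleftrightarrow> (\<forall>d'. set d' \<subseteq> {s, t} \<longrightarrow>
    (prodw d' = prodw d \<or> prodw d' = prodw d \<otimes> s) \<longrightarrow> length d \<le> length d')"

lemma alt_minimal_append:
  assumes st: "s \<in> S" "t \<in> S" and d: "set (c @ d) \<subseteq> {s, t}" and min: "alt_minimal s t (c @ d)"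
  shows "alt_minimal s t d"
  unfolding alt_minimal_def
proof (intro allI impI)
  fix d' assume d': "set d' \<subseteq> {s, t}" "prodw d' = prodw d \<or> prodw d' = prodw d \<otimes> s"
  have S: "set c \<subseteq> S" "set d \<subseteq> S" "set d' \<subseteq> S" using d d' st by auto
  have "prodw (c @ d') = prodw (c @ d) \<or> prodw (c @ d') = prodw (c @ d) \<otimes> s"
    using d'(2) S st by (auto simp only: prodw_append m_assoc prodw_closed S_carrier)
  moreover have "set (c @ d') \<subseteq> {s, t}" using d d' by auto
  ultimately have "length (c @ d) \<le> length (c @ d')"
    using min unfolding alt_minimal_def by blast
  then show "length d \<le> length d'" by simp
qed

text \<open>Two equal neighbours could be cancelled and a final \<open>s\<close> could be dropped;
  either would give a shorter word for the same coset.\<close>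

lemma alt_minimal_alternates:
  assumes st: "s \<in> S" "t \<in> S"
  shows "set d \<subseteq> {s, t} \<Longrightarrow> alt_minimal s t d \<Longrightarrow> d = alt_word s t (length d)"
proof (induction d)
  case (Cons x d)
  have "alt_minimal s t d"
    using alt_minimal_append[OF st, of "[x]" d] Cons.prems by simp
  then have d: "d = alt_word s t (length d)" using Cons by simp
  have xS: "x \<in> S" "set d \<subseteq> S" using Cons.prems st by auto
  have "x = (if even (length d) then t else s)"
  proof (cases d)
    case Nil
    have "x \<noteq> s"
    proof
      assume "x = s"
      then have "prodw [] = prodw (x # d) \<otimes> s" using Nil st S_sq S_carrier by simp
      moreover have "set [] \<subseteq> {s, t}" by simp
      ultimately show False
        using Cons.prems(2) unfolding alt_minimal_def by (metis length_Cons length_0_conv le_zero_eq nat.distinct(1) list.size(3))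
    qed
    then show ?thesis using Cons.prems Nil by auto
  next
    case (Cons y r)
    have y: "y = (if even (length r) then t else s)"
      using d unfolding Cons by simp
    have "x \<noteq> y"
    proof
      assume "x = y"
      then have "prodw r = prodw (x # d)"
        using xS Cons S_sq[of x] S_carrier[of x] prodw_closed[of r] by (simp add: m_assoc[symmetric])
      moreover have "set r \<subseteq> {s, t}" using Cons.prems Cons by auto
      ultimately have "length (x # d) \<le> length r"
        using Cons.prems(2) unfolding alt_minimal_def by blast
      then show False using Cons by simp
    qed
    then show ?thesis using y Cons Cons.prems(1) by auto
  qed
  then show ?case using d by (metis alt_word.simps(2) length_Cons)
qed simp

text \<open>By the relation of length \<open>2 * m\<close>, the alternating word of length
  \<open>m\<close> followed by \<open>s\<close> equals a word with only \<open>m - 1\<close>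
  letters, which contradicts minimality of any alternating word with at least \<open>m\<close>
  letters.\<close>

lemma alt_minimal_length:
  assumes st: "s \<in> S" "t \<in> S" and min: "alt_minimal s t (alt_word s t k)"
    and m: "coxeter_label W s t \<noteq> 0"
  shows "k < coxeter_label W s t"
proof (rule ccontr)
  let ?m = "coxeter_label W s t"
  assume "\<not> k < ?m"
  then obtain c where c: "alt_word s t k = c @ alt_word s t ?m" "set c \<subseteq> {s, t}"
    using alt_word_add[of s t "k - ?m" ?m] by auto
  have min': "alt_minimal s t (alt_word s t ?m)"
    using alt_minimal_append[OF st, of c "alt_word s t ?m"] min c set_alt_word[of s t ?m] by simp
  obtain v where v: "alt_word s t (?m - 1 + ?m) = v @ alt_word s t ?m" "length v = ?m - 1" "set v \<subseteq> {s, t}"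
    using alt_word_add by blast
  have S: "set v \<subseteq> S" "set (alt_word s t ?m) \<subseteq> S" "set (rev v) \<subseteq> S"
    using v(3) set_alt_word[of s t ?m] st by auto
  have "alt_word s t (Suc (?m - 1 + ?m)) = s # (v @ alt_word s t ?m)"
    using m unfolding alt_word.simps v(1) by simp
  moreover have "Suc (?m - 1 + ?m) = 2 * ?m" using m by simp
  ultimately have "alt_word s t (2 * ?m) = s # (v @ alt_word s t ?m)" by metis
  then have sq: "s \<otimes> (prodw v \<otimes> prodw (alt_word s t ?m)) = \<one>"
    using prodw_alt_word_order[OF st] prodw_append[OF S(1,2)] by simp
  have cl: "prodw v \<in> carrier W" "prodw (alt_word s t ?m) \<in> carrier W" "s \<in> carrier W"
    using S st prodw_closed S_carrier by auto
  have "s \<otimes> (s \<otimes> (prodw v \<otimes> prodw (alt_word s t ?m))) = prodw v \<otimes> prodw (alt_word s t ?m)"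
    using cl S_sq[OF st(1)] by (simp add: m_assoc[symmetric])
  then have "prodw v \<otimes> prodw (alt_word s t ?m) = s"
    unfolding sq using cl by simp
  then have "prodw v \<otimes> (prodw (alt_word s t ?m) \<otimes> s) = \<one>"
    using cl S_sq[OF st(1)] by (simp add: m_assoc[symmetric])
  then have "inv (prodw v) = prodw (alt_word s t ?m) \<otimes> s"
    using cl by (intro inv_equality inv_comm[of "prodw v"]) auto
  then have "prodw (rev v) = prodw (alt_word s t ?m) \<otimes> s"
    using prodw_rev[OF S(1)] by simp
  moreover have "set (rev v) \<subseteq> {s, t}" using v by simp
  ultimately have "length (alt_word s t ?m) \<le> length (rev v)"
    using min' unfolding alt_minimal_def by blast
  then show False using v m by simp
qed

text \<open>The coefficients are consecutive values of \<open>V\<close>, which satisfies the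
  recursion of a dihedral reflection product. With a finite label \<open>m\<close> they are
  nonnegative up to index \<open>m\<close>, because there the sine is taken in the interval from 0
  to pi; the index needed is \<open>k + 1\<close>, hence \<open>k < m\<close>.\<close>

lemma act_alt_word_simple:
  assumes st: "s \<in> S" "t \<in> S" "s \<noteq> t" and k: "coxeter_label W s t = 0 \<or> k < coxeter_label W s t"
  shows "\<exists>p\<ge>0. \<exists>q\<ge>0. actw (alt_word s t k) (\<alpha> s) = p *\<^sub>R \<alpha> s + q *\<^sub>R \<alpha> t"
proof -
  let ?m = "coxeter_label W s t"
  define \<theta> where "\<theta> = pi / real ?m"
  \<comment> \<open>For the label infinity the form has the value - 1 and the quotient of sines
    degenerates to its limit \<open>k\<close>.\<close>
  define V where "V k = (if ?m = 0 then real k else sin (real k * \<theta>) / sin \<theta>)" for k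
  have sin: "sin \<theta> > 0" if "?m \<noteq> 0"
    unfolding \<theta>_def using label_ge_2[OF st that] by (intro sin_gt_zero) (auto simp: field_simps)
  have rec: "V (Suc (Suc k)) = - 2 * B (\<alpha> s) (\<alpha> t) * V (Suc k) - V k" for k
  proof (cases "?m = 0")
    case False
    have plus: "real (Suc (Suc k)) * \<theta> = real (Suc k) * \<theta> + \<theta>"
      and minus: "real k * \<theta> = real (Suc k) * \<theta> - \<theta>"
      by (simp_all add: algebra_simps)
    have "sin (real (Suc (Suc k)) * \<theta>) + sin (real k * \<theta>) = 2 * cos \<theta> * sin (real (Suc k) * \<theta>)"
      unfolding plus minus sin_add sin_diff by simp
    then have "sin (real (Suc (Suc k)) * \<theta>) = 2 * cos \<theta> * sin (real (Suc k) * \<theta>) - sin (real k * \<theta>)"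
      by linarith
    then show ?thesis
      using False st by (simp add: V_def B_simple tits_coeff_def \<theta>_def[symmetric] diff_divide_distrib)
  qed (use st in \<open>simp add: V_def B_simple tits_coeff_def\<close>)
  have act: "actw (alt_word s t k) (\<alpha> s) =
    V (Suc k) *\<^sub>R (if even k then \<alpha> s else \<alpha> t) + V k *\<^sub>R (if even k then \<alpha> t else \<alpha> s)" for k
  proof (induction k)
    case 0
    show ?case using sin by (cases "?m = 0") (auto simp: V_def)
  next
    case (Suc k)
    have "reflect b (y *\<^sub>R b + x *\<^sub>R a) = x *\<^sub>R a + (- 2 * B a b * x - y) *\<^sub>R b" if "B b b = 1" for a b x y
      using that by (simp add: reflect_def B_linear algebra_simps scaleR_double)
    then show ?case
      using Suc st B_commute[of "\<alpha> t" "\<alpha> s"] by (simp add: rec B_simple_self add.commute)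
  qed
  have V: "0 \<le> V j" if "j \<le> Suc k" for j
  proof (cases "?m = 0")
    case False
    then have "real j \<le> real ?m" using that k by linarith
    then have "real j * \<theta> \<le> real ?m * \<theta>" by (intro mult_right_mono) (simp_all add: \<theta>_def)
    also have "real ?m * \<theta> = pi" using False by (simp add: \<theta>_def)
    finally have "0 \<le> sin (real j * \<theta>)" by (intro sin_ge_zero) (simp_all add: \<theta>_def)
    then show ?thesis using False sin by (simp add: V_def)
  qed (simp add: V_def)
  show ?thesis
  proof (cases "even k")
    case True
    then show ?thesis using act[of k] V[of k] V[of "Suc k"] by auto
  next
    case False
    then have "actw (alt_word s t k) (\<alpha> s) = V k *\<^sub>R \<alpha> s + V (Suc k) *\<^sub>R \<alpha> t"
      using act[of k] by simp
    then show ?thesis using V[of k] V[of "Suc k"] by auto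
  qed
qed

text \<open>Tits' argument: split a longest possible word in \<open>s\<close> and in the last letter \<open>t\<close> of a reduced word
  off \<open>g\<close> on the right; what remains maps \<open>\<alpha> s\<close> and \<open>\<alpha> t\<close> to positive vectors by induction.\<close>

theorem act_simple_nonneg:
  assumes "g \<in> carrier W" "s \<in> S" "len g \<le> len (g \<otimes> s)"
  shows "nonneg (act g (\<alpha> s))"
  using assms
proof (induction "len g" arbitrary: g s rule: less_induct)
  case less
  note g = less.prems(1) and s = less.prems(2) and len_gs = less.prems(3)
  show ?case
  proof (cases "len g = 0")
    case True
    then have "g = \<one>" using g len_eq_0 by blast
    then show ?thesis using s nonneg_simple by simp
  next
    case False
    obtain w where w: "set w \<subseteq> S" "prodw w = g" "length w = len g" using reduced_word g by metis
    then obtain r t where "w = r @ [t]" using False by (metis length_0_conv rev_exhaust)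
    with w have r: "set r \<subseteq> S" and t: "t \<in> S" and g_eq: "g = prodw r \<otimes> t" and len_r: "Suc (length r) = len g"
      using prodw_append[of r "[t]"] S_carrier by auto
    have rc: "prodw r \<in> carrier W" using prodw_closed r by simp
    have "g \<otimes> t = prodw r" using g_eq rc t S_carrier S_sq by (simp add: m_assoc)
    then have "len (g \<otimes> t) < len g" using len_le[OF r] len_r by simp
    then have "s \<noteq> t" using len_gs by auto
    \<comment> \<open>Factorisations of \<open>g\<close> with additive length and right factor in
      the dihedral subgroup of \<open>s\<close> and \<open>t\<close>; one with the shortest left
      factor is taken.\<close>
    define D where "D u d \<longleftrightarrow> u \<in> carrier W \<and> set d \<subseteq> {s, t} \<and> g = u \<otimes> prodw d \<and> len u + length d = len g" for u d
    have "D (prodw r) [t]"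
      using rc len_le[OF r] len_r g_eq len_mult_word[OF rc, of "[t]"] t S_carrier by (simp add: D_def)
    then have ex: "\<exists>n u d. D u d \<and> len u = n" by blast
    define n where "n = (LEAST n. \<exists>u d. D u d \<and> len u = n)"
    obtain u d where ud: "D u d" "len u = n" using LeastI_ex[OF ex] unfolding n_def by blast
    have n_le: "n \<le> len u'" if "D u' d'" for u' d' unfolding n_def by (rule Least_le) (use that in blast)
    have "len u < len g"
      using n_le[OF \<open>D (prodw r) [t]\<close>] ud len_le[OF r] len_r by simp
    have u: "u \<in> carrier W" and d: "set d \<subseteq> {s, t}" "set d \<subseteq> S" and g_ud: "g = u \<otimes> prodw d"
      and len_ud: "len u + length d = len g"
      using ud s t by (auto simp: D_def)
    \<comment> \<open>A letter that shortened \<open>u\<close> could be moved over to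
      \<open>d\<close>, which would give a factorisation with a shorter left factor.\<close>
    have len_ux: "len u \<le> len (u \<otimes> x)" if x: "x \<in> {s, t}" for x
    proof (rule ccontr)
      assume lt: "\<not> len u \<le> len (u \<otimes> x)"
      have xS: "x \<in> S" "x \<in> carrier W" using x s t S_carrier by auto
      have "x \<otimes> (x \<otimes> z) = z" if "z \<in> carrier W" for z
        using xS S_sq that by (simp add: m_assoc[symmetric])
      then have eq: "g = (u \<otimes> x) \<otimes> prodw (x # d)"
        using g_ud u d xS prodw_closed by (simp add: m_assoc)
      have "len g \<le> len (u \<otimes> x) + length (x # d)"
        unfolding eq using len_mult_word[of "u \<otimes> x" "x # d"] u xS d by auto
      then have "D (u \<otimes> x) (x # d)"
        using eq lt len_ud u xS x d by (auto simp: D_def)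
      then show False using n_le ud lt by fastforce
    qed
    have pos: "nonneg (act u (\<alpha> s))" "nonneg (act u (\<alpha> t))"
      using less.hyps[OF \<open>len u < len g\<close> u] s t len_ux by auto
    \<comment> \<open>A shorter word for the coset of \<open>d\<close> would shorten
      \<open>g\<close> or \<open>g \<otimes> s\<close>, but neither has length below
      \<open>len g\<close>.\<close>
    have "alt_minimal s t d"
      unfolding alt_minimal_def
    proof (intro allI impI)
      fix d' assume d': "set d' \<subseteq> {s, t}" "prodw d' = prodw d \<or> prodw d' = prodw d \<otimes> s"
      have dS: "set d' \<subseteq> S" using d' s t by auto
      have "u \<otimes> prodw d' = g \<or> u \<otimes> prodw d' = g \<otimes> s"
        using d'(2) g_ud u s d S_carrier prodw_closed by (metis m_assoc)
      then have "len g \<le> len (u \<otimes> prodw d')" using len_gs by auto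
      also have "\<dots> \<le> len u + length d'" using len_mult_word u dS by simp
      finally show "length d \<le> length d'" using len_ud by simp
    qed
    then have d_alt: "d = alt_word s t (length d)"
      using alt_minimal_alternates s t d by blast
    then have "coxeter_label W s t = 0 \<or> length d < coxeter_label W s t"
      using alt_minimal_length[OF s t] \<open>alt_minimal s t d\<close> by metis
    then obtain p q where pq: "p \<ge> 0" "q \<ge> 0" "actw d (\<alpha> s) = p *\<^sub>R \<alpha> s + q *\<^sub>R \<alpha> t"
      using act_alt_word_simple[OF s t \<open>s \<noteq> t\<close>] d_alt by metis
    have "act g (\<alpha> s) = p *\<^sub>R act u (\<alpha> s) + q *\<^sub>R act u (\<alpha> t)"
      using g_ud u d pq prodw_closed by (simp add: act_mult act_prodw act_add act_scale)
    then show ?thesis using pos pq by (simp add: nonneg_add nonneg_scale)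
  qed
qed

corollary act_simple_sign:
  assumes g: "g \<in> carrier W" and s: "s \<in> S"
  shows "nonneg (act g (\<alpha> s)) \<or> nonneg (- act g (\<alpha> s))"
proof (cases "len g \<le> len (g \<otimes> s)")
  case False
  have "g \<otimes> s \<in> carrier W" "g \<otimes> s \<otimes> s = g"
    using g s S_carrier S_sq by (simp_all add: m_assoc)
  then have "nonneg (act (g \<otimes> s) (\<alpha> s))"
    using act_simple_nonneg[of "g \<otimes> s" s] s False by simp
  moreover have "act (g \<otimes> s) (\<alpha> s) = - act g (\<alpha> s)"
    using g s S_carrier by (simp add: act_mult act_S reflect_def B_simple_self scaleR_2 act_minus)
  ultimately show ?thesis by simp
qed (use assms act_simple_nonneg in simp)

section \<open>Roots, their reflections and inversions\<close>

definition roots :: "'v set"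
  where "roots = {act g (\<alpha> s) | g s. g \<in> carrier W \<and> s \<in> S}"

lemma root_sign: "x \<in> roots \<Longrightarrow> nonneg x \<or> nonneg (- x)"
  using act_simple_sign by (auto simp: roots_def)

lemma root_norm: "x \<in> roots \<Longrightarrow> B x x = 1"
  by (auto simp: roots_def act_isometry B_simple_self)

lemma root_act: "x \<in> roots \<Longrightarrow> g \<in> carrier W \<Longrightarrow> act g x \<in> roots"
  by (auto simp: roots_def) (metis act_mult m_closed)

lemma simple_root: "s \<in> S \<Longrightarrow> \<alpha> s \<in> roots"
  unfolding roots_def by (metis (mono_tags, lifting) CollectI act_one one_closed)

lemma root_minus: "x \<in> roots \<Longrightarrow> - x \<in> roots"
proof -
  assume "x \<in> roots"
  then obtain g s where "g \<in> carrier W" "s \<in> S" "x = act g (\<alpha> s)" by (auto simp: roots_def)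
  then have "- x = act (g \<otimes> s) (\<alpha> s)" "g \<otimes> s \<in> carrier W"
    using S_carrier by (simp_all add: act_mult act_S reflect_def B_simple_self scaleR_2 act_minus)
  then show ?thesis using \<open>s \<in> S\<close> by (auto simp: roots_def)
qed

lemma root_nonzero: "x \<in> roots \<Longrightarrow> x \<noteq> 0"
  using root_norm by force

lemma reflect_act:
  assumes "g \<in> carrier W"
  shows "act g (reflect a (act (inv g) y)) = reflect (act g a) y"
  using assms act_adjoint[of "inv g" y a] by (simp add: reflect_def act_diff act_scale)

lemma root_reflection:
  assumes "x \<in> roots"
  obtains r where "r \<in> carrier W" "act r = reflect x" "r \<otimes> r = \<one>"
proof -
  obtain g s where gs: "g \<in> carrier W" "s \<in> S" "x = act g (\<alpha> s)" using assms by (auto simp: roots_def)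
  let ?r = "g \<otimes> s \<otimes> inv g"
  have s: "s \<in> carrier W" "s \<otimes> s = \<one>" using gs S_carrier S_sq by auto
  have cancel: "inv g \<otimes> (g \<otimes> z) = z" "s \<otimes> (s \<otimes> z) = z" if "z \<in> carrier W" for z
    using gs s that by (simp_all add: m_assoc[symmetric])
  have "?r \<otimes> ?r = \<one>"
    using gs s by (simp add: m_assoc cancel)
  moreover have "act ?r = reflect x"
    using gs s by (simp add: fun_eq_iff act_mult act_S reflect_act)
  ultimately show ?thesis using that[of ?r] gs s by simp
qed

text \<open>The reflection in \<open>\<alpha> s\<close> changes only the coordinate at
  \<open>s\<close>. All other coordinates of \<open>x\<close> are thus both nonnegative and
  nonpositive, and norm one fixes the remaining one.\<close>

lemma simple_inversion:
  assumes s: "s \<in> S" and x: "x \<in> roots" "nonneg x" "nonneg (- act s x)"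
  shows "x = \<alpha> s"
proof -
  have "crd t x = 0" if t: "t \<in> S" "t \<noteq> s" for t
  proof -
    have "crd t (act s x) = crd t x"
      using s t by (simp add: act_S reflect_def crd_diff crd_scale crd_simple)
    then show ?thesis
      using nonneg_crd[OF x(2) t(1)] nonneg_crd[OF x(3) t(1)] by (simp add: crd_minus)
  qed
  then have eq: "x = crd s x *\<^sub>R \<alpha> s"
    using nonneg_expand[OF x(2)] finite_S s sum.remove[OF finite_S s, of "\<lambda>t. crd t x *\<^sub>R \<alpha> t"] by simp
  then have "(crd s x)\<^sup>2 = 1"
    using root_norm[OF x(1)] B_simple_self[OF s] by (metis B_scale_left B_scale_right mult.right_neutral power2_eq_square)
  then have "crd s x = 1"
    using nonneg_crd[OF x(2) s] by (simp add: power2_eq_1_iff)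
  then show ?thesis using eq by simp
qed

text \<open>Each generator adds at most one inversion: a positive root that becomes negative only at
  the last step was just before it equal to the simple root of that step.\<close>

lemma finite_inversions:
  assumes "g \<in> carrier W"
  shows "finite {x \<in> roots. nonneg x \<and> nonneg (- act g x)}"
proof -
  show ?thesis
    using assms
  proof (induction rule: act_induct)
    case one
    have "{x \<in> roots. nonneg x \<and> nonneg (- act \<one> x)} = {}"
      using nonneg_antisym root_nonzero by auto
    then show ?case by (simp only: finite.emptyI)
  next
    case (step s g)
    have "{x \<in> roots. nonneg x \<and> nonneg (- act (s \<otimes> g) x)} \<subseteq>
      {x \<in> roots. nonneg x \<and> nonneg (- act g x)} \<union> {act (inv g) (\<alpha> s)}"
    proof
      fix x assume x: "x \<in> {x \<in> roots. nonneg x \<and> nonneg (- act (s \<otimes> g) x)}"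
      then have gx: "act g x \<in> roots" using step root_act by simp
      show "x \<in> {x \<in> roots. nonneg x \<and> nonneg (- act g x)} \<union> {act (inv g) (\<alpha> s)}"
      proof (cases "nonneg (- act g x)")
        case False
        then have "act g x = \<alpha> s"
          using x step gx root_sign[OF gx] by (intro simple_inversion) (auto simp: act_mult S_carrier)
        then have "x = act (inv g) (\<alpha> s)"
          using step act_inv(1)[of g x] by simp
        then show ?thesis by blast
      qed (use x in auto)
    qed
    then show ?case by (rule finite_subset) (use step.IH in simp)
  qed
qed

lemma finite_separating:
  assumes "g \<in> carrier W" "h \<in> carrier W"
  shows "finite {x \<in> roots. nonneg (act g x) \<and> nonneg (- act h x)}"
proof -
  have "{x \<in> roots. nonneg (act g x) \<and> nonneg (- act h x)} \<subseteq>
    act (inv g) ` {x \<in> roots. nonneg x \<and> nonneg (- act (h \<otimes> inv g) x)}"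
    (is "?L \<subseteq> _ ` ?R")
  proof
    fix x assume "x \<in> ?L"
    then have "act g x \<in> ?R" "x = act (inv g) (act g x)"
      using assms root_act by (auto simp: act_mult)
    then show "x \<in> act (inv g) ` ?R" by blast
  qed
  then show ?thesis
    using finite_inversions assms by (meson finite_imageI finite_subset inv_closed m_closed)
qed

end

section \<open>Hyperbolic pairs of roots\<close>

text \<open>The value \<open>B \<delta> \<eta>\<close> is minus the hyperbolic cosine of log \<tau>.
  This parameter keeps all formulas rational: the product of the two reflections has the eigenvalues
  \<open>\<tau>\<^sup>2\<close> and its inverse on the plane of the pair.\<close>

locale hyperbolic_pair = coxeter_geometry W S B \<alpha> crd
  for W :: "('a, 'm) monoid_scheme" (structure) and S
    and B :: "'v::real_vector \<Rightarrow> 'v \<Rightarrow> real" and \<alpha> :: "'a \<Rightarrow> 'v" and crd :: "'a \<Rightarrow> 'v \<Rightarrow> real" +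
  fixes \<delta> \<eta> :: 'v and \<tau> :: real
  assumes unit: "B \<delta> \<delta> = 1" "B \<eta> \<eta> = 1" and \<tau>: "\<tau> > 1" and B_pair: "B \<delta> \<eta> = - (\<tau>\<^sup>2 + 1) / (2 * \<tau>)"
begin

definition \<sigma> :: real where "\<sigma> = \<tau>\<^sup>2"
definition rot :: "'v \<Rightarrow> 'v" where "rot y = reflect \<delta> (reflect \<eta> y)"
definition x_plus :: 'v where "x_plus = \<tau> *\<^sub>R \<delta> + \<eta>"
definition x_minus :: 'v where "x_minus = \<delta> + \<tau> *\<^sub>R \<eta>"
definition bpm :: real where "bpm = B x_plus x_minus"

lemma \<sigma>_gt_1: "\<sigma> > 1"
  using \<tau> by (simp add: \<sigma>_def)

lemma B_pair': "B \<eta> \<delta> = - (\<tau>\<^sup>2 + 1) / (2 * \<tau>)"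
  using B_pair B_commute by metis

lemma isotropic: "B x_plus x_plus = 0" "B x_minus x_minus = 0"
  using \<tau> by (simp_all add: x_plus_def x_minus_def B_linear unit B_pair B_pair' field_simps power2_eq_square)

lemma bpm_eq: "bpm = - ((\<tau>\<^sup>2 - 1)\<^sup>2 / (2 * \<tau>))"
  using \<tau> by (simp add: bpm_def x_plus_def x_minus_def B_linear unit B_pair B_pair' field_simps power2_eq_square)

lemma bpm_neg: "bpm < 0"
proof -
  have "\<tau>\<^sup>2 - 1 \<noteq> 0" using \<sigma>_gt_1 by (simp add: \<sigma>_def)
  then have "(\<tau>\<^sup>2 - 1)\<^sup>2 > 0" by simp
  then show ?thesis unfolding bpm_eq using \<tau> by (simp add: divide_pos_pos)
qed

lemma reflect_combination:
  "B a a = 1 \<Longrightarrow> reflect a (p *\<^sub>R a + q *\<^sub>R b) = (- p - 2 * q * B b a) *\<^sub>R a + q *\<^sub>R b"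
  by (simp add: reflect_def B_linear algebra_simps scaleR_double)

lemma rot_x_plus: "rot x_plus = \<sigma> *\<^sub>R x_plus"
proof -
  have "reflect \<eta> x_plus = reflect \<eta> (1 *\<^sub>R \<eta> + \<tau> *\<^sub>R \<delta>)"
    by (simp add: x_plus_def add.commute)
  also have "\<dots> = \<sigma> *\<^sub>R \<eta> + \<tau> *\<^sub>R \<delta>"
    unfolding reflect_combination[OF unit(2)] using \<tau> by (simp add: B_pair \<sigma>_def field_simps)
  finally have "rot x_plus = reflect \<delta> (\<tau> *\<^sub>R \<delta> + \<sigma> *\<^sub>R \<eta>)"
    by (simp add: rot_def add.commute)
  also have "\<dots> = (\<sigma> * \<tau>) *\<^sub>R \<delta> + \<sigma> *\<^sub>R \<eta>"
    unfolding reflect_combination[OF unit(1)] using \<tau> by (simp add: B_pair' \<sigma>_def field_simps power2_eq_square)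
  finally show ?thesis by (simp add: x_plus_def scaleR_add_right)
qed

lemma rot_x_minus: "rot x_minus = (1 / \<sigma>) *\<^sub>R x_minus"
proof -
  have "reflect \<eta> x_minus = reflect \<eta> (\<tau> *\<^sub>R \<eta> + 1 *\<^sub>R \<delta>)"
    by (simp add: x_minus_def add.commute)
  also have "\<dots> = (1 / \<tau>) *\<^sub>R \<eta> + 1 *\<^sub>R \<delta>"
    unfolding reflect_combination[OF unit(2)] using \<tau> by (simp add: B_pair field_simps power2_eq_square)
  finally have "rot x_minus = reflect \<delta> (1 *\<^sub>R \<delta> + (1 / \<tau>) *\<^sub>R \<eta>)"
    by (simp add: rot_def add.commute)
  also have "\<dots> = (1 / \<sigma>) *\<^sub>R \<delta> + (1 / \<tau>) *\<^sub>R \<eta>"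
    unfolding reflect_combination[OF unit(1)] using \<tau> by (simp add: B_pair' \<sigma>_def field_simps power2_eq_square)
  also have "\<dots> = (1 / \<sigma>) *\<^sub>R x_minus"
    using \<tau> by (simp add: x_minus_def scaleR_add_right \<sigma>_def power2_eq_square)
  finally show ?thesis .
qed

lemma pair_eq:
  "\<delta> = (\<tau> / (\<sigma> - 1)) *\<^sub>R x_plus - (1 / (\<sigma> - 1)) *\<^sub>R x_minus"
  "\<eta> = (\<tau> / (\<sigma> - 1)) *\<^sub>R x_minus - (1 / (\<sigma> - 1)) *\<^sub>R x_plus"
proof -
  have ne: "\<sigma> - 1 \<noteq> 0" using \<sigma>_gt_1 by simp
  have "(\<sigma> - 1) *\<^sub>R \<delta> = \<tau> *\<^sub>R x_plus - x_minus" "(\<sigma> - 1) *\<^sub>R \<eta> = \<tau> *\<^sub>R x_minus - x_plus"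
    by (simp_all add: x_plus_def x_minus_def \<sigma>_def power2_eq_square algebra_simps)
  then have "(1 / (\<sigma> - 1)) *\<^sub>R ((\<sigma> - 1) *\<^sub>R \<delta>) = (1 / (\<sigma> - 1)) *\<^sub>R (\<tau> *\<^sub>R x_plus - x_minus)"
    "(1 / (\<sigma> - 1)) *\<^sub>R ((\<sigma> - 1) *\<^sub>R \<eta>) = (1 / (\<sigma> - 1)) *\<^sub>R (\<tau> *\<^sub>R x_minus - x_plus)"
    by simp_all
  then show "\<delta> = (\<tau> / (\<sigma> - 1)) *\<^sub>R x_plus - (1 / (\<sigma> - 1)) *\<^sub>R x_minus"
    "\<eta> = (\<tau> / (\<sigma> - 1)) *\<^sub>R x_minus - (1 / (\<sigma> - 1)) *\<^sub>R x_plus"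
    using ne by (simp_all add: scaleR_diff_right)
qed

lemma rot_linear: "rot (x + y) = rot x + rot y" "rot (c *\<^sub>R x) = c *\<^sub>R rot x"
  by (simp_all add: rot_def reflect_add reflect_scale)

lemma rot_fixed: "B y x_plus = 0 \<Longrightarrow> B y x_minus = 0 \<Longrightarrow> rot y = y"
proof -
  assume y: "B y x_plus = 0" "B y x_minus = 0"
  have "B y \<delta> = 0" "B y \<eta> = 0"
    by (subst pair_eq, simp add: B_linear y)+
  then show "rot y = y" by (simp add: rot_def reflect_def)
qed

text \<open>\<open>x_plus\<close> and \<open>x_minus\<close> are isotropic, so the coefficient of
  each is read off by pairing with the other.\<close>

definition coef_plus :: "'v \<Rightarrow> real" where "coef_plus y = B y x_minus / bpm"
definition coef_minus :: "'v \<Rightarrow> real" where "coef_minus y = B y x_plus / bpm"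
definition part_fixed :: "'v \<Rightarrow> 'v"
  where "part_fixed y = y - coef_plus y *\<^sub>R x_plus - coef_minus y *\<^sub>R x_minus"

lemma decompose: "y = part_fixed y + coef_plus y *\<^sub>R x_plus + coef_minus y *\<^sub>R x_minus"
  by (simp add: part_fixed_def)

lemma rot_part_fixed: "rot (part_fixed y) = part_fixed y"
proof (rule rot_fixed)
  have ne: "bpm \<noteq> 0" using bpm_neg by simp
  have bpm': "B x_minus x_plus = bpm" "B x_plus x_minus = bpm"
    using B_commute by (auto simp: bpm_def)
  show "B (part_fixed y) x_plus = 0" "B (part_fixed y) x_minus = 0"
    using ne by (simp_all add: part_fixed_def B_linear isotropic bpm' coef_plus_def coef_minus_def)
qed

lemma rot_funpow:
  "(rot ^^ n) y = part_fixed y + (\<sigma> ^ n * coef_plus y) *\<^sub>R x_plus + ((1 / \<sigma>) ^ n * coef_minus y) *\<^sub>R x_minus"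
proof (induction n)
  case 0
  show ?case using decompose by simp
next
  case (Suc n)
  then show ?case
    by (simp add: rot_linear rot_part_fixed rot_x_plus rot_x_minus mult_ac)
qed

end

context coxeter_geometry
begin

lemma hyperbolic_pairI:
  assumes "x \<in> roots" "y \<in> roots" "B x y < - 1"
  obtains \<tau> where "hyperbolic_pair W S B \<alpha> crd x y \<tau>"
proof -
  let ?k = "- B x y"
  \<comment> \<open>The larger root of \<open>t\<^sup>2 - 2 * ?k * t + 1\<close>.\<close>
  define \<tau> where "\<tau> = ?k + sqrt (?k\<^sup>2 - 1)"
  have k: "?k > 1" using assms by simp
  then have "1 * 1 < ?k * ?k" by (intro mult_strict_mono) simp_all
  then have k2: "?k\<^sup>2 - 1 > 0" by (simp add: power2_eq_square)
  then have \<tau>: "\<tau> > 1" unfolding \<tau>_def using k real_sqrt_gt_zero[OF k2] by linarith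
  have "(\<tau> - ?k)\<^sup>2 = ?k\<^sup>2 - 1" using k2 by (simp add: \<tau>_def)
  then have "\<tau>\<^sup>2 + 1 = 2 * ?k * \<tau>" by (simp add: power2_eq_square algebra_simps)
  then have Bxy: "B x y = - (\<tau>\<^sup>2 + 1) / (2 * \<tau>)" using \<tau> by (simp add: field_simps)
  then have "hyperbolic_pair W S B \<alpha> crd x y \<tau>"
    using assms(1,2) \<tau> Bxy by unfold_locales (auto simp: root_norm)
  then show ?thesis using that by blast
qed

end

locale coxeter_chamber = coxeter_geometry W S B \<alpha> crd
  for W :: "('a, 'm) monoid_scheme" (structure) and S
    and B :: "'v::real_vector \<Rightarrow> 'v \<Rightarrow> real" and \<alpha> :: "'a \<Rightarrow> 'v" and crd :: "'a \<Rightarrow> 'v \<Rightarrow> real" +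
  fixes v :: 'v
  assumes v_neg: "s \<in> S \<Longrightarrow> B v (\<alpha> s) < 0"
    and v_span: "v = (\<Sum>s\<in>S. crd s v *\<^sub>R \<alpha> s)"
    and infinite_W: "infinite (carrier W)"
    and irreducible: "irreducible_coxeter W S"
begin

section \<open>Heights and the existence of a hyperbolic pair\<close>

definition ht :: "'v \<Rightarrow> real" where "ht y = - B v y"

lemma ht_linear: "ht (x + y) = ht x + ht y" "ht (c *\<^sub>R x) = c * ht x" "ht (- x) = - ht x" "ht (x - y) = ht x - ht y"
  by (simp_all add: ht_def B_linear)

lemma ht_sum: "ht (\<Sum>i\<in>I. f i) = (\<Sum>i\<in>I. ht (f i))"
  by (induction I rule: infinite_finite_induct) (auto simp: ht_linear, simp_all add: ht_def)

definition \<epsilon> :: real where "\<epsilon> = Min ((\<lambda>s. ht (\<alpha> s)) ` S)"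

lemma \<epsilon>: "\<epsilon> > 0" "s \<in> S \<Longrightarrow> \<epsilon> \<le> ht (\<alpha> s)"
  using irreducible v_neg finite_S by (auto simp: \<epsilon>_def irreducible_coxeter_def ht_def)

text \<open>Norm one forces the coordinate sum to be at least 1: all entries of the form on simple
  roots are at most 1, so \<open>B x x\<close> is at most the square of that sum. The bound is
  uniform over all positive roots, which is what excludes height 0 in limits.\<close>

lemma ht_root:
  assumes x: "x \<in> roots" "nonneg x"
  shows "ht x \<ge> \<epsilon>"
proof -
  let ?c = "\<lambda>s. crd s x"
  have c: "0 \<le> ?c s" if "s \<in> S" for s using nonneg_crd x that by simp
  have B_sum: "B y (\<Sum>s\<in>S. ?c s *\<^sub>R \<alpha> s) = (\<Sum>s\<in>S. ?c s * B y (\<alpha> s))" for y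
    by (induction S rule: infinite_finite_induct) (auto simp: B_linear)
  have bound: "B (\<alpha> s) (\<alpha> t) \<le> 1" if "s \<in> S" "t \<in> S" for s t
    using coeff_bounds[OF that] coeff_refl that by (cases "s = t") (auto simp: B_simple)
  have "1 = B x x" using root_norm x by simp
  also have "\<dots> = B x (\<Sum>s\<in>S. ?c s *\<^sub>R \<alpha> s)" using nonneg_expand[OF x(2)] by simp
  also have "\<dots> = (\<Sum>s\<in>S. ?c s * B (\<alpha> s) x)" unfolding B_sum by (simp add: B_commute)
  also have "\<dots> = (\<Sum>s\<in>S. ?c s * (\<Sum>t\<in>S. ?c t * B (\<alpha> s) (\<alpha> t)))"
    using B_sum nonneg_expand[OF x(2)] by simp
  also have "\<dots> \<le> (\<Sum>s\<in>S. ?c s * (\<Sum>t\<in>S. ?c t * 1))"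
    using c bound by (intro sum_mono mult_left_mono) auto
  also have "\<dots> = (\<Sum>s\<in>S. ?c s)\<^sup>2"
    by (simp add: sum_distrib_right power2_eq_square)
  finally have "1 \<le> (\<Sum>s\<in>S. ?c s)\<^sup>2" .
  then have one: "1 \<le> (\<Sum>s\<in>S. ?c s)"
    using abs_square_less_1[of "\<Sum>s\<in>S. ?c s"] sum_nonneg[of S ?c] c by force
  have "\<epsilon> \<le> \<epsilon> * (\<Sum>s\<in>S. ?c s)" using one \<epsilon>(1) by simp
  also have "\<dots> \<le> (\<Sum>s\<in>S. ?c s * ht (\<alpha> s))"
    unfolding sum_distrib_left using c \<epsilon>(2) by (intro sum_mono) (metis mult.commute mult_left_mono)
  also have "\<dots> = ht (\<Sum>s\<in>S. ?c s *\<^sub>R \<alpha> s)" by (simp add: ht_sum ht_linear)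
  also have "\<dots> = ht x" using nonneg_expand[OF x(2)] by simp
  finally show ?thesis .
qed

lemma ht_root_abs: "x \<in> roots \<Longrightarrow> \<bar>ht x\<bar> \<ge> \<epsilon>"
  using root_sign[of x] ht_root[of x] ht_root[of "- x"] root_minus[of x] by (auto simp: ht_linear)

lemma root_nonneg_iff: "x \<in> roots \<Longrightarrow> nonneg x \<longleftrightarrow> ht x > 0"
  using root_sign[of x] ht_root[of x] ht_root[of "- x"] root_minus[of x] \<epsilon>(1) by (auto simp: ht_linear)

lemma root_nonpos_iff: "x \<in> roots \<Longrightarrow> nonneg (- x) \<longleftrightarrow> ht x < 0"
  using root_nonneg_iff[of "- x"] root_minus[of x] by (simp add: ht_linear)

text \<open>The last letter \<open>s\<close> of a reduced word adds
  \<open>2 * ht (\<alpha> s)\<close> times the image of \<open>\<alpha> s\<close> under the shorter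
  element. That image is a positive root, and both heights involved are at least
  \<open>\<epsilon>\<close>.\<close>

lemma ht_act_v: "g \<in> carrier W \<Longrightarrow> ht v + 2 * \<epsilon>\<^sup>2 * real (len g) \<le> ht (act g v)"
proof (induction "len g" arbitrary: g)
  case 0
  then have "g = \<one>" using len_eq_0 by simp
  then show ?case using 0 by simp
next
  case (Suc n)
  obtain w where w: "set w \<subseteq> S" "prodw w = g" "length w = len g" using reduced_word Suc.prems by metis
  then obtain r s where "w = r @ [s]" using Suc.hyps(2) by (metis length_0_conv nat.distinct(1) rev_exhaust)
  with w have r: "set r \<subseteq> S" and s: "s \<in> S" and g: "g = prodw r \<otimes> s" and lr: "length r = n"
    using prodw_append[of r "[s]"] S_carrier Suc.hyps(2) by auto
  have rc: "prodw r \<in> carrier W" using r prodw_closed by simp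
  have "len g \<le> len (prodw r) + 1"
    using len_mult_word[OF rc, of "[s]"] s S_carrier g by simp
  then have ln: "len (prodw r) = n" using len_le[OF r] lr Suc.hyps(2) by simp
  then have "nonneg (act (prodw r) (\<alpha> s))"
    using act_simple_nonneg[OF rc s] g Suc.hyps(2) by simp
  then have pos: "ht (act (prodw r) (\<alpha> s)) \<ge> \<epsilon>"
    using ht_root root_act simple_root s rc by simp
  have "act g v = act (prodw r) v + (2 * ht (\<alpha> s)) *\<^sub>R act (prodw r) (\<alpha> s)"
    using g rc s S_carrier by (simp add: act_mult act_S reflect_def act_linear ht_def)
  then have "ht (act g v) = ht (act (prodw r) v) + 2 * ht (\<alpha> s) * ht (act (prodw r) (\<alpha> s))"
    by (simp add: ht_linear)
  moreover have "\<epsilon> * \<epsilon> \<le> ht (\<alpha> s) * ht (act (prodw r) (\<alpha> s))"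
    using \<epsilon>(1) \<epsilon>(2)[OF s] pos by (intro mult_mono) linarith+
  moreover have "ht v + 2 * \<epsilon>\<^sup>2 * real n \<le> ht (act (prodw r) v)"
    using Suc.hyps(1)[of "prodw r"] ln rc by simp
  ultimately show ?case
    unfolding Suc.hyps(2)[symmetric] by (simp add: algebra_simps power2_eq_square)
qed

lemma ht_act_v_gt: "g \<in> carrier W \<Longrightarrow> g \<noteq> \<one> \<Longrightarrow> ht v < ht (act g v)"
proof -
  assume g: "g \<in> carrier W" "g \<noteq> \<one>"
  then have "len g > 0" using len_eq_0 by auto
  then have "2 * \<epsilon>\<^sup>2 * real (len g) > 0" using \<epsilon>(1) by simp
  then show ?thesis using ht_act_v[OF g(1)] by linarith
qed

lemma len_unbounded: "\<exists>g\<in>carrier W. len g > n"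
proof (rule ccontr)
  assume "\<not> ?thesis"
  then have le: "len g \<le> n" if "g \<in> carrier W" for g using that by auto
  have "carrier W \<subseteq> prodw ` {ws. set ws \<subseteq> S \<and> length ws \<le> n}"
  proof
    fix g assume g: "g \<in> carrier W"
    then show "g \<in> prodw ` {ws. set ws \<subseteq> S \<and> length ws \<le> n}"
      using reduced_word[OF g] le[OF g] by (metis (mono_tags, lifting) imageI mem_Collect_eq)
  qed
  then show False
    using infinite_W finite_lists_length_le[OF finite_S] by (meson finite_imageI finite_subset)
qed

text \<open>Otherwise the form is bounded by 1 on roots. Expanding both copies of \<open>v\<close>
  in simple roots then bounds the height of \<open>act g v\<close> over the whole group, although it
  grows with the length and the length is unbounded.\<close>

lemma exists_hyperbolic_pair: "\<exists>x\<in>roots. \<exists>y\<in>roots. B x y < - 1"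
proof (rule ccontr)
  assume "\<not> ?thesis"
  then have ge: "B x y \<ge> - 1" if "x \<in> roots" "y \<in> roots" for x y using that by force
  then have abs: "\<bar>B x y\<bar> \<le> 1" if "x \<in> roots" "y \<in> roots" for x y
    using ge[OF that] ge[OF root_minus[OF that(1)] that(2)] by (simp add: B_minus_left abs_le_iff)
  define M where "M = (\<Sum>s\<in>S. \<bar>crd s v\<bar>)"
  have Bv: "B v y = (\<Sum>s\<in>S. crd s v * B (\<alpha> s) y)" for y
  proof -
    have "B (\<Sum>s\<in>I. crd s v *\<^sub>R \<alpha> s) y = (\<Sum>s\<in>I. crd s v * B (\<alpha> s) y)" for I
      by (induction I rule: infinite_finite_induct) (auto simp: B_linear)
    then show ?thesis using v_span by metis
  qed
  have bd: "\<bar>B v x\<bar> \<le> M" if "x \<in> roots" for x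
    unfolding Bv M_def
    by (rule order_trans[OF sum_abs], rule sum_mono)
      (use abs simple_root that in \<open>simp add: abs_mult mult_left_le\<close>)
  have "ht (act g v) \<le> M * M" if g: "g \<in> carrier W" for g
  proof -
    have "ht (act g v) \<le> \<bar>B v (act (inv g) v)\<bar>"
      using act_adjoint[OF g, of v v] B_commute[of v "act g v"] by (simp add: ht_def)
    also have "B v (act (inv g) v) = (\<Sum>s\<in>S. crd s v * B (\<alpha> s) (act (inv g) v))" by (rule Bv)
    also have "\<dots> = (\<Sum>s\<in>S. crd s v * B v (act g (\<alpha> s)))"
      using act_adjoint[OF g] by (intro sum.cong) (simp_all add: B_commute)
    also have "\<bar>\<dots>\<bar> \<le> (\<Sum>s\<in>S. \<bar>crd s v\<bar> * M)"
      by (rule order_trans[OF sum_abs], rule sum_mono)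
        (use bd root_act simple_root g in \<open>simp add: abs_mult mult_left_mono\<close>)
    finally show ?thesis by (simp add: M_def sum_distrib_right)
  qed
  then have *: "ht v + 2 * \<epsilon>\<^sup>2 * real (len g) \<le> M * M" if "g \<in> carrier W" for g
    using ht_act_v[of g] that by force
  obtain n where n: "real n > (M * M - ht v) / (2 * \<epsilon>\<^sup>2)" using reals_Archimedean2 by blast
  obtain g where g: "g \<in> carrier W" "len g > n" using len_unbounded by blast
  have "real (len g) > (M * M - ht v) / (2 * \<epsilon>\<^sup>2)" using n g by linarith
  then have "2 * \<epsilon>\<^sup>2 * real (len g) > M * M - ht v" using \<epsilon>(1) by (simp add: field_simps)
  then show False using *[OF g(1)] by simp
qed

end

section \<open>Regular functions on the group\<close>

lemma filterlim_exp_combination: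
  fixes \<sigma> :: real
  assumes "\<sigma> > 1" "P > 0"
  shows "filterlim (\<lambda>n. P * \<sigma> ^ n + R + Q * (1 / \<sigma>) ^ n) at_top sequentially"
proof -
  have "filterlim (\<lambda>n. \<sigma> ^ n) at_top sequentially"
    unfolding filterlim_at_top
  proof
    fix Z
    obtain N where "Z < \<sigma> ^ N" using real_arch_pow assms(1) by blast
    then have "Z \<le> \<sigma> ^ n" if "N \<le> n" for n
      using power_increasing[OF that, of \<sigma>] assms(1) by linarith
    then show "\<forall>\<^sub>F n in sequentially. Z \<le> \<sigma> ^ n"
      unfolding eventually_sequentially by blast
  qed
  then have "filterlim (\<lambda>n. P * \<sigma> ^ n) at_top sequentially"
    using assms by (intro filterlim_tendsto_pos_mult_at_top[OF tendsto_const])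
  moreover have "(\<lambda>n. R + Q * (1 / \<sigma>) ^ n) \<longlonglongrightarrow> R + Q * 0"
    using assms by (intro tendsto_intros LIMSEQ_power_zero) auto
  ultimately have "filterlim (\<lambda>n. (R + Q * (1 / \<sigma>) ^ n) + P * \<sigma> ^ n) at_top sequentially"
    by (intro filterlim_tendsto_add_at_top)
  then show ?thesis by (simp add: add_ac)
qed

lemma eventually_exp_combination:
  fixes \<sigma> :: real
  assumes "\<sigma> > 1" "P > 0"
  shows "\<forall>\<^sub>F n in sequentially. K < P * \<sigma> ^ n + R + Q * (1 / \<sigma>) ^ n"
  using filterlim_exp_combination[OF assms] by (simp add: filterlim_at_top_dense)

text \<open>Multiplied by \<open>\<sigma>\<^sup>2\<^sup>n\<close>, the sequence below is a polynomial of degree \<open>4\<close> in \<open>\<sigma>\<^sup>n\<close>.\<close>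

lemma laurent_zero_or_cofinite:
  fixes \<sigma> :: real
  assumes \<sigma>: "\<sigma> > 1" and inf: "\<not> (\<forall>\<^sub>F n in sequentially. c0 + c1 * \<sigma> ^ n + c2 * (1 / \<sigma>) ^ n + c3 * (\<sigma> ^ n)\<^sup>2 + c4 * ((1 / \<sigma>) ^ n)\<^sup>2 \<noteq> 0)"
  shows "c0 = 0 \<and> c1 = 0 \<and> c2 = 0 \<and> c3 = 0 \<and> c4 = 0"
proof -
  let ?p = "[:c4, c2, c0, c1, c3:]"
  let ?f = "\<lambda>n. c0 + c1 * \<sigma> ^ n + c2 * (1 / \<sigma>) ^ n + c3 * (\<sigma> ^ n)\<^sup>2 + c4 * ((1 / \<sigma>) ^ n)\<^sup>2"
  have eq: "poly ?p (\<sigma> ^ n) = (\<sigma> ^ n)\<^sup>2 * ?f n" for n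
  proof -
    define t where "t = \<sigma> ^ n"
    have "t \<noteq> 0" using \<sigma> by (simp add: t_def)
    moreover have "(1 / \<sigma>) ^ n = 1 / t" by (simp add: t_def power_one_over)
    ultimately show ?thesis
      by (simp add: t_def[symmetric] field_simps power2_eq_square)
  qed
  have "?p = 0"
  proof (rule ccontr)
    assume "?p \<noteq> 0"
    then have fin: "finite {x. poly ?p x = 0}" by (rule poly_roots_finite)
    have inj: "inj (\<lambda>n::nat. \<sigma> ^ n)"
      using \<sigma> by (intro injI) (simp add: power_inject_exp)
    have "{n. ?f n = 0} \<subseteq> (\<lambda>n. \<sigma> ^ n) -` {x. poly ?p x = 0}"
      using eq by auto
    then have "finite {n. ?f n = 0}"
      using finite_vimageI[OF fin inj] by (rule finite_subset)
    then have "\<forall>\<^sub>F n in sequentially. ?f n \<noteq> 0"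
      by (simp add: cofinite_eq_sequentially[symmetric] eventually_cofinite)
    then show False using inf by simp
  qed
  then show ?thesis by simp
qed

locale hyperbolic_roots = coxeter_chamber W S B \<alpha> crd v + hyperbolic_pair W S B \<alpha> crd \<delta> \<eta> \<tau>
  for W :: "('a, 'm) monoid_scheme" (structure) and S
    and B :: "'v::real_vector \<Rightarrow> 'v \<Rightarrow> real" and \<alpha> :: "'a \<Rightarrow> 'v" and crd :: "'a \<Rightarrow> 'v \<Rightarrow> real"
    and v \<delta> \<eta> \<tau> +
  assumes pair_roots: "\<delta> \<in> roots" "\<eta> \<in> roots"

context coxeter_geometry
begin

section \<open>The subgroup generated by hyperbolic elements\<close>

definition hyperbolics :: "'a set"
  where "hyperbolics = {u \<in> carrier W. \<exists>x\<in>roots. \<exists>y\<in>roots. B x y < - 1 \<and> act u = (\<lambda>z. reflect x (reflect y z))}"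

lemma hyperbolics_carrier: "u \<in> hyperbolics \<Longrightarrow> u \<in> carrier W"
  by (simp add: hyperbolics_def)

lemma hyperbolics_memI:
  "u \<in> carrier W \<Longrightarrow> x \<in> roots \<Longrightarrow> y \<in> roots \<Longrightarrow> B x y < - 1 \<Longrightarrow>
    act u = (\<lambda>z. reflect x (reflect y z)) \<Longrightarrow> u \<in> hyperbolics"
  unfolding hyperbolics_def by blast

lemma reflect_minus: "reflect (- a) y = reflect a y"
  by (simp add: reflect_def B_linear)

lemma hyperbolicI:
  assumes "x \<in> roots" "y \<in> roots" "\<bar>B x y\<bar> > 1" "r \<in> carrier W" "act r = reflect x"
    "r' \<in> carrier W" "act r' = reflect y"
  shows "r \<otimes> r' \<in> hyperbolics"
proof -
  have act: "act (r \<otimes> r') = (\<lambda>z. reflect x (reflect y z))"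
    using assms by (simp add: fun_eq_iff act_mult)
  show ?thesis
  proof (cases "B x y < - 1")
    case True
    then show ?thesis using assms act by (intro hyperbolics_memI[of _ x y]) auto
  next
    case False
    then have "B (- x) y < - 1" using assms(3) by (simp add: B_minus_left)
    moreover have "act (r \<otimes> r') = (\<lambda>z. reflect (- x) (reflect y z))"
      using act by (simp add: reflect_minus)
    ultimately show ?thesis
      using assms root_minus[of x] by (intro hyperbolics_memI[of _ "- x" y]) auto
  qed
qed

lemma hyperbolics_inv:
  assumes "u \<in> hyperbolics"
  shows "inv u \<in> hyperbolics"
proof -
  obtain x y where u: "u \<in> carrier W" "x \<in> roots" "y \<in> roots" "B x y < - 1"
    "act u = (\<lambda>z. reflect x (reflect y z))"
    using assms by (auto simp: hyperbolics_def)
  have "act (inv u) z = reflect y (reflect x z)" for z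
  proof -
    have "z = act u (reflect y (reflect x z))"
      using u by (simp add: reflect_refl root_norm)
    then show ?thesis using u(1) by (metis act_inv(1))
  qed
  then have "act (inv u) = (\<lambda>z. reflect y (reflect x z))" by auto
  then show ?thesis
    using u B_commute[of x y] by (intro hyperbolics_memI[of _ y x]) auto
qed

abbreviation Wt :: "'a set" where "Wt \<equiv> generate W hyperbolics"

lemma Wt_subgroup: "subgroup Wt W"
  using hyperbolics_carrier by (intro generate_is_subgroup) auto

lemma Wt_carrier: "g \<in> Wt \<Longrightarrow> g \<in> carrier W"
  by (rule subgroup.mem_carrier[OF Wt_subgroup])

lemmas Wt_mult = subgroup.m_closed[OF Wt_subgroup]
lemmas Wt_inv = subgroup.m_inv_closed[OF Wt_subgroup]
lemmas Wt_one = subgroup.one_closed[OF Wt_subgroup]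

lemma act_pow: "u \<in> carrier W \<Longrightarrow> act (u [^] (n::nat)) y = (act u ^^ n) y"
  by (induction n arbitrary: y) (auto simp: act_mult funpow_swap1)

text \<open>A discrete substitute for polynomial functions. It keeps just the property that drives
  the irreducibility argument: on each curve \<open>a \<otimes> u [^] n \<otimes> b\<close>, the
  zeros are all of it or only finitely many exponents.\<close>

definition regular :: "('a \<Rightarrow> real) \<Rightarrow> bool"
  where "regular \<phi> \<longleftrightarrow> (\<forall>a\<in>carrier W. \<forall>b\<in>carrier W. \<forall>u\<in>hyperbolics.
    (\<forall>n::nat. \<phi> (a \<otimes> u [^] n \<otimes> b) = 0) \<or> (\<forall>\<^sub>F n in sequentially. \<phi> (a \<otimes> u [^] n \<otimes> b) \<noteq> 0))"

lemma regular_shift: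
  assumes "regular \<phi>" "c \<in> carrier W"
  shows "regular (\<lambda>g. \<phi> (c \<otimes> g))"
  unfolding regular_def
proof (intro ballI)
  fix a b u assume *: "a \<in> carrier W" "b \<in> carrier W" "u \<in> hyperbolics"
  then have "c \<otimes> (a \<otimes> u [^] n \<otimes> b) = (c \<otimes> a) \<otimes> u [^] n \<otimes> b" for n :: nat
    using assms hyperbolics_carrier by (simp add: m_assoc)
  then show "(\<forall>n::nat. \<phi> (c \<otimes> (a \<otimes> u [^] n \<otimes> b)) = 0) \<or>
      (\<forall>\<^sub>F n in sequentially. \<phi> (c \<otimes> (a \<otimes> u [^] n \<otimes> b)) \<noteq> 0)"
    using assms(1)[unfolded regular_def, rule_format, of "c \<otimes> a" b u] assms(2) * by simp
qed

lemma regular_mult: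
  assumes "regular \<phi>" "regular \<psi>"
  shows "regular (\<lambda>g. \<phi> g * \<psi> g)"
  unfolding regular_def
proof (intro ballI)
  fix a b u assume *: "a \<in> carrier W" "b \<in> carrier W" "u \<in> hyperbolics"
  let ?g = "\<lambda>n::nat. a \<otimes> u [^] n \<otimes> b"
  consider "\<forall>n. \<phi> (?g n) = 0" | "\<forall>n. \<psi> (?g n) = 0"
    | "\<forall>\<^sub>F n in sequentially. \<phi> (?g n) \<noteq> 0" "\<forall>\<^sub>F n in sequentially. \<psi> (?g n) \<noteq> 0"
    using assms * unfolding regular_def by blast
  then show "(\<forall>n. \<phi> (?g n) * \<psi> (?g n) = 0) \<or> (\<forall>\<^sub>F n in sequentially. \<phi> (?g n) * \<psi> (?g n) \<noteq> 0)"
  proof cases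
    case 3
    then show ?thesis by (intro disjI2) (auto elim: eventually_elim2)
  qed auto
qed

lemma regular_one: "regular (\<lambda>g. 1)"
  by (simp add: regular_def)

lemma regular_prod: "finite F \<Longrightarrow> (\<And>f. f \<in> F \<Longrightarrow> regular (\<phi> f)) \<Longrightarrow> regular (\<lambda>g. \<Prod>f\<in>F. \<phi> f g)"
  by (induction rule: finite_induct) (auto intro: regular_mult regular_one)

text \<open>This is irreducibility in the sense of the Zariski topology, for the regular functions.\<close>

definition irr :: "'a set \<Rightarrow> bool"
  where "irr X \<longleftrightarrow> (\<forall>\<phi> \<psi>. regular \<phi> \<longrightarrow> regular \<psi> \<longrightarrow> (\<exists>g\<in>X. \<phi> g \<noteq> 0) \<longrightarrow> (\<exists>g\<in>X. \<psi> g \<noteq> 0) \<longrightarrow>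
    (\<exists>g\<in>X. \<phi> g \<noteq> 0 \<and> \<psi> g \<noteq> 0))"

text \<open>A function that is nonzero somewhere on a line is nonzero for almost all exponents, so
  two functions share an exponent \<open>n\<close>. After translation by \<open>u [^] n\<close> the
  irreducibility of \<open>X\<close> yields a common point.\<close>

lemma irr_lines:
  assumes X: "X \<subseteq> carrier W" "irr X" and u: "u \<in> hyperbolics"
  shows "irr {u [^] n \<otimes> g | (n::nat) g. g \<in> X}"
  unfolding irr_def
proof (intro allI impI)
  fix \<phi> \<psi> assume reg: "regular \<phi>" "regular \<psi>"
    and ex: "\<exists>g\<in>{u [^] n \<otimes> g | (n::nat) g. g \<in> X}. \<phi> g \<noteq> 0" "\<exists>g\<in>{u [^] n \<otimes> g | (n::nat) g. g \<in> X}. \<psi> g \<noteq> 0"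
  note uc = hyperbolics_carrier[OF u]
  have ev: "\<forall>\<^sub>F n in sequentially. \<theta> (u [^] n \<otimes> g) \<noteq> 0"
    if "regular \<theta>" "\<theta> (u [^] m \<otimes> g) \<noteq> 0" "g \<in> X" for \<theta> g and m :: nat
  proof -
    have g: "g \<in> carrier W" using that X by auto
    have "\<one> \<otimes> u [^] n \<otimes> g = u [^] n \<otimes> g" for n :: nat using uc g by simp
    then show ?thesis
      using that(1)[unfolded regular_def, rule_format, of \<one> g u] that(2) g u by auto
  qed
  obtain m g where g: "g \<in> X" "\<phi> (u [^] (m::nat) \<otimes> g) \<noteq> 0" using ex(1) by blast
  obtain m' g' where g': "g' \<in> X" "\<psi> (u [^] (m'::nat) \<otimes> g') \<noteq> 0" using ex(2) by blast
  have "\<forall>\<^sub>F n in sequentially. \<phi> (u [^] n \<otimes> g) \<noteq> 0 \<and> \<psi> (u [^] n \<otimes> g') \<noteq> 0"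
    using ev[OF reg(1) g(2,1)] ev[OF reg(2) g'(2,1)] by (rule eventually_conj)
  from eventually_happens'[OF sequentially_bot this]
  obtain n :: nat where n: "\<phi> (u [^] n \<otimes> g) \<noteq> 0" "\<psi> (u [^] n \<otimes> g') \<noteq> 0"
    by blast
  have "\<exists>g\<in>X. \<phi> (u [^] n \<otimes> g) \<noteq> 0 \<and> \<psi> (u [^] n \<otimes> g) \<noteq> 0"
    using X(2)[unfolded irr_def, rule_format, OF regular_shift[OF reg(1), of "u [^] n"] regular_shift[OF reg(2), of "u [^] n"]]
      n g g' uc by blast
  then show "\<exists>g\<in>{u [^] n \<otimes> g | (n::nat) g. g \<in> X}. \<phi> g \<noteq> 0 \<and> \<psi> g \<noteq> 0" by blast
qed

lemma irr_extend_hyperbolic: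
  assumes u: "u \<in> hyperbolics" and X: "X \<subseteq> Wt" "irr X"
  shows "\<exists>Y. Y \<subseteq> Wt \<and> irr Y \<and> X \<subseteq> Y \<and> (\<forall>g\<in>X. u \<otimes> g \<in> Y)"
proof -
  let ?Y = "{u [^] n \<otimes> g | (n::nat) g. g \<in> X}"
  have uc: "u \<in> carrier W" "u \<in> Wt" using u hyperbolics_carrier generate.incl by auto
  have Xc: "X \<subseteq> carrier W" using X Wt_carrier by auto
  have "u [^] n \<in> Wt" for n :: nat by (induction n) (use uc Wt_one Wt_mult in auto)
  then have "?Y \<subseteq> Wt" using X Wt_mult by blast
  moreover have "g \<in> ?Y \<and> u \<otimes> g \<in> ?Y" if "g \<in> X" for g
  proof -
    have "g = u [^] (0::nat) \<otimes> g" "u \<otimes> g = u [^] (1::nat) \<otimes> g" using uc Xc that by auto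
    then show ?thesis using that by blast
  qed
  ultimately show ?thesis using irr_lines[OF Xc X(2) u] by blast
qed

text \<open>The set \<open>Y\<close> arises by multiplying \<open>X\<close> from the left by all
  powers of each hyperbolic letter of \<open>h\<close>. The exponents 0 and 1 account for the two
  inclusions.\<close>

lemma irr_extend:
  assumes "h \<in> Wt"
  shows "X \<subseteq> Wt \<Longrightarrow> irr X \<Longrightarrow> \<exists>Y. Y \<subseteq> Wt \<and> irr Y \<and> X \<subseteq> Y \<and> (\<forall>g\<in>X. h \<otimes> g \<in> Y)"
  using assms
proof (induction h arbitrary: X)
  case one
  then show ?case using Wt_carrier by (intro exI[of _ X]) auto
next
  case (incl u)
  then show ?case by (intro irr_extend_hyperbolic)
next
  case (inv u)
  then show ?case by (intro irr_extend_hyperbolic hyperbolics_inv)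
next
  case (eng h k)
  obtain Y where Y: "Y \<subseteq> Wt" "irr Y" "X \<subseteq> Y" "\<forall>g\<in>X. k \<otimes> g \<in> Y"
    using eng.IH(2)[OF eng.prems] by (elim exE conjE)
  obtain Z where Z: "Z \<subseteq> Wt" "irr Z" "Y \<subseteq> Z" "\<forall>g\<in>Y. h \<otimes> g \<in> Z"
    using eng.IH(1)[OF Y(1,2)] by (elim exE conjE)
  have "h \<otimes> k \<otimes> g \<in> Z" if "g \<in> X" for g
  proof -
    have "h \<otimes> k \<otimes> g = h \<otimes> (k \<otimes> g)"
      using that eng.hyps eng.prems Wt_carrier by (intro m_assoc) auto
    then show ?thesis using Y(4) Z(4) that by simp
  qed
  then show ?case using Y(3) Z by (intro exI[of _ Z]) auto
qed

text \<open>Any two elements lie in a common irreducible subset, found by extending the singleton of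
  the first by their quotient. \<open>Wt\<close> itself need not be a single finite product of such
  cyclic families.\<close>

lemma irr_Wt: "irr Wt"
  unfolding irr_def
proof (intro allI impI)
  fix \<phi> \<psi> assume reg: "regular \<phi>" "regular \<psi>" and ex: "\<exists>g\<in>Wt. \<phi> g \<noteq> 0" "\<exists>g\<in>Wt. \<psi> g \<noteq> 0"
  obtain g h where g: "g \<in> Wt" "\<phi> g \<noteq> 0" and h: "h \<in> Wt" "\<psi> h \<noteq> 0" using ex by blast
  have "irr {g}" by (auto simp: irr_def)
  then obtain Y where Y: "Y \<subseteq> Wt" "irr Y" "{g} \<subseteq> Y" "\<forall>x\<in>{g}. h \<otimes> inv g \<otimes> x \<in> Y"
    using irr_extend[of "h \<otimes> inv g" "{g}"] Wt_mult[OF h(1) Wt_inv[OF g(1)]] g by auto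
  have "h \<otimes> inv g \<otimes> g = h" using g h Wt_carrier by (simp add: m_assoc)
  then have "h \<in> Y" "g \<in> Y" using Y by auto
  then have "\<exists>g\<in>Y. \<phi> g \<noteq> 0 \<and> \<psi> g \<noteq> 0"
    using Y(2)[unfolded irr_def, rule_format, OF reg] g h by blast
  then show "\<exists>g\<in>Wt. \<phi> g \<noteq> 0 \<and> \<psi> g \<noteq> 0" using Y(1) by auto
qed

lemma regular_common_nonzero:
  assumes "finite F" "\<And>f. f \<in> F \<Longrightarrow> regular (\<phi> f)" "\<And>f. f \<in> F \<Longrightarrow> \<exists>g\<in>Wt. \<phi> f g \<noteq> 0"
  shows "\<exists>g\<in>Wt. \<forall>f\<in>F. \<phi> f g \<noteq> 0"
  using assms
proof (induction rule: finite_induct)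
  case (insert f F)
  then obtain g where "g \<in> Wt" "\<forall>f\<in>F. \<phi> f g \<noteq> 0" by blast
  then have "\<exists>g\<in>Wt. (\<Prod>f\<in>F. \<phi> f g) \<noteq> 0" using insert by (auto simp: prod_zero_iff)
  moreover have "regular (\<lambda>g. \<Prod>f\<in>F. \<phi> f g)" using insert by (intro regular_prod) auto
  moreover have "regular (\<phi> f)" "\<exists>g\<in>Wt. \<phi> f g \<noteq> 0" using insert by auto
  ultimately obtain g where "g \<in> Wt" "\<phi> f g \<noteq> 0" "(\<Prod>f\<in>F. \<phi> f g) \<noteq> 0"
    using irr_Wt[unfolded irr_def, rule_format, of "\<phi> f" "\<lambda>g. \<Prod>f\<in>F. \<phi> f g"] by blast
  then show ?case using insert by (auto simp: prod_zero_iff)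
qed (use Wt_one in auto)

text \<open>Orbits under powers of a hyperbolic element have the shape
  \<open>y0 + t *\<^sub>R y1 + (1 / t) *\<^sub>R y2\<close>, with a fixed, an expanding and a
  contracting part. The condition covers linear functionals as well as quadratic forms.\<close>

definition quadratic :: "('v \<Rightarrow> real) \<Rightarrow> bool"
  where "quadratic Q \<longleftrightarrow> (\<forall>y0 y1 y2. \<exists>c0 c1 c2 c3 c4. \<forall>t. t \<noteq> 0 \<longrightarrow>
    Q (y0 + t *\<^sub>R y1 + (1 / t) *\<^sub>R y2) = c0 + c1 * t + c2 * (1 / t) + c3 * t\<^sup>2 + c4 * (1 / t)\<^sup>2)"

lemma quadratic_linear:
  assumes "\<And>x y. l (x + y) = l x + l y" "\<And>c x. l (c *\<^sub>R x) = c * l x"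
  shows "quadratic l"
  unfolding quadratic_def
proof (intro allI)
  fix y0 y1 y2
  show "\<exists>c0 c1 c2 c3 c4. \<forall>t. t \<noteq> 0 \<longrightarrow>
    l (y0 + t *\<^sub>R y1 + (1 / t) *\<^sub>R y2) = c0 + c1 * t + c2 * (1 / t) + c3 * t\<^sup>2 + c4 * (1 / t)\<^sup>2"
    by (intro exI[of _ "l y0"] exI[of _ "l y1"] exI[of _ "l y2"] exI[of _ 0]) (simp add: assms)
qed

lemma B_act_expand:
  assumes "f \<in> carrier W"
  shows "B (a + t *\<^sub>R b + s *\<^sub>R c) (act f (a + t *\<^sub>R b + s *\<^sub>R c)) =
    B a (act f a) + (t * s) * (B b (act f c) + B c (act f b)) + (B a (act f b) + B b (act f a)) * t
    + (B a (act f c) + B c (act f a)) * s + B b (act f b) * t\<^sup>2 + B c (act f c) * s\<^sup>2"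
  by (simp only: B_add_left B_add_right B_scale_left B_scale_right act_add[OF assms] act_scale[OF assms]
      power2_eq_square ring_distribs mult_ac add_ac)

lemma quadratic_act:
  assumes "f \<in> carrier W"
  shows "quadratic (\<lambda>z. B z (act f z))"
  unfolding quadratic_def
proof (intro allI)
  fix y0 y1 y2
  have "B (y0 + t *\<^sub>R y1 + (1 / t) *\<^sub>R y2) (act f (y0 + t *\<^sub>R y1 + (1 / t) *\<^sub>R y2)) =
      (B y0 (act f y0) + (B y1 (act f y2) + B y2 (act f y1)))
      + (B y0 (act f y1) + B y1 (act f y0)) * t + (B y0 (act f y2) + B y2 (act f y0)) * (1 / t)
      + B y1 (act f y1) * t\<^sup>2 + B y2 (act f y2) * (1 / t)\<^sup>2" if "t \<noteq> 0" for t
    using that unfolding B_act_expand[OF assms] by simp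
  then show "\<exists>c0 c1 c2 c3 c4. \<forall>t. t \<noteq> 0 \<longrightarrow>
    B (y0 + t *\<^sub>R y1 + (1 / t) *\<^sub>R y2) (act f (y0 + t *\<^sub>R y1 + (1 / t) *\<^sub>R y2)) =
      c0 + c1 * t + c2 * (1 / t) + c3 * t\<^sup>2 + c4 * (1 / t)\<^sup>2"
    by blast
qed

lemma quadratic_regular:
  assumes Q: "quadratic Q"
  shows "regular (\<lambda>g. Q (act g x))"
  unfolding regular_def
proof (intro ballI)
  fix a b u assume *: "a \<in> carrier W" "b \<in> carrier W" "u \<in> hyperbolics"
  obtain p q where u: "u \<in> carrier W" "p \<in> roots" "q \<in> roots" "B p q < - 1"
    "act u = (\<lambda>z. reflect p (reflect q z))"
    using * by (auto simp: hyperbolics_def)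
  obtain \<tau> where "hyperbolic_pair W S B \<alpha> crd p q \<tau>" using hyperbolic_pairI u by metis
  then interpret P: hyperbolic_pair W S B \<alpha> crd p q \<tau> .
  let ?y = "act b x"
  have "act u = P.rot" using u(5) by (simp add: P.rot_def fun_eq_iff)
  then have line: "act (a \<otimes> u [^] n \<otimes> b) x = act a (P.part_fixed ?y)
      + (P.\<sigma> ^ n) *\<^sub>R (P.coef_plus ?y *\<^sub>R act a P.x_plus)
      + (1 / P.\<sigma> ^ n) *\<^sub>R (P.coef_minus ?y *\<^sub>R act a P.x_minus)" for n :: nat
    using * u(1) by (simp add: act_mult act_pow P.rot_funpow act_linear power_one_over)
  obtain c0 c1 c2 c3 c4 where c: "\<forall>t. t \<noteq> 0 \<longrightarrow>
    Q (act a (P.part_fixed ?y) + t *\<^sub>R (P.coef_plus ?y *\<^sub>R act a P.x_plus) + (1 / t) *\<^sub>R (P.coef_minus ?y *\<^sub>R act a P.x_minus))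
      = c0 + c1 * t + c2 * (1 / t) + c3 * t\<^sup>2 + c4 * (1 / t)\<^sup>2"
    using Q unfolding quadratic_def by meson
  have eq: "Q (act (a \<otimes> u [^] n \<otimes> b) x) = c0 + c1 * P.\<sigma> ^ n + c2 * (1 / P.\<sigma>) ^ n + c3 * (P.\<sigma> ^ n)\<^sup>2
      + c4 * ((1 / P.\<sigma>) ^ n)\<^sup>2" for n :: nat
    unfolding line using c P.\<sigma>_gt_1 by (simp add: power_one_over)
  show "(\<forall>n::nat. Q (act (a \<otimes> u [^] n \<otimes> b) x) = 0) \<or>
      (\<forall>\<^sub>F n in sequentially. Q (act (a \<otimes> u [^] n \<otimes> b) x) \<noteq> 0)"
    unfolding eq using laurent_zero_or_cofinite[OF P.\<sigma>_gt_1, of c0 c1 c2 c3 c4] by auto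
qed

lemma regular_linear:
  assumes "\<And>x y. l (x + y) = l x + l y" "\<And>c x. l (c *\<^sub>R x) = c * l x"
  shows "regular (\<lambda>g. l (act g x))"
  using assms by (intro quadratic_regular quadratic_linear)

lemma regular_B: "regular (\<lambda>g. B (act g x) y)"
  by (intro regular_linear) (simp_all add: B_linear)

end

section \<open>Limit directions of roots\<close>

context coxeter_chamber
begin

text \<open>Roots with \<open>B x y < - 1\<close> generate an infinite dihedral group; all its roots \<open>c x + d y\<close> with
  \<open>c, d \<ge> 0\<close> would be inversions of \<open>g\<close>.\<close>

lemma half_spaces_disjoint:
  assumes x: "x \<in> roots" "nonneg x" and y: "y \<in> roots" "nonneg y" and xy: "B x y < - 1"
    and g: "g \<in> carrier W" and neg: "nonneg (- act g x)" "nonneg (- act g y)"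
  shows False
proof -
  let ?R = "\<lambda>z. reflect x (reflect y z)"
  define k where "k = - B x y"
  note nx = root_norm[OF x(1)] and ny = root_norm[OF y(1)]
  have k: "k > 1" using xy by (simp add: k_def)
  have step: "?R (c *\<^sub>R x + d *\<^sub>R y) = ((4 * k\<^sup>2 - 1) * c - 2 * k * d) *\<^sub>R x + (2 * k * c - d) *\<^sub>R y" for c d
    by (simp add: k_def reflect_def B_linear nx ny B_commute[of y x] algebra_simps scaleR_double power2_eq_square)
  \<comment> \<open>The inequality \<open>c \<ge> d\<close> is the invariant that makes both new
    coefficients nonnegative, and it is preserved because \<open>k > 1\<close>.\<close>
  have comb: "\<exists>c d. c \<ge> d \<and> d \<ge> 0 \<and> c > 0 \<and> (?R ^^ n) x = c *\<^sub>R x + d *\<^sub>R y" for n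
  proof (induction n)
    case 0
    show ?case by (intro exI[of _ 1] exI[of _ 0]) simp
  next
    case (Suc n)
    then obtain c d where cd: "c \<ge> d" "d \<ge> 0" "c > 0" "(?R ^^ n) x = c *\<^sub>R x + d *\<^sub>R y" by blast
    let ?c = "(4 * k\<^sup>2 - 1) * c - 2 * k * d" and ?d = "2 * k * c - d"
    have "(?R ^^ Suc n) x = ?c *\<^sub>R x + ?d *\<^sub>R y"
      using cd(4) step[of c d] by simp
    moreover have d': "?d \<ge> c"
    proof -
      have "1 * c \<le> k * c" using k cd(3) by (intro mult_right_mono) auto
      then show ?thesis using cd(1) by linarith
    qed
    moreover have "?c \<ge> ?d"
    proof -
      have "?c - ?d = (4 * k\<^sup>2 - 4 * k) * c + (2 * k - 1) * (c - d)" by (simp add: algebra_simps power2_eq_square)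
      moreover have "k * 1 \<le> k * k" using k by (intro mult_left_mono) auto
      then have "4 * k\<^sup>2 - 4 * k \<ge> 0" by (simp add: power2_eq_square)
      ultimately have "?c - ?d \<ge> 0"
        using cd k by (simp only:) (intro add_nonneg_nonneg mult_nonneg_nonneg, auto)
      then show ?thesis by simp
    qed
    ultimately show ?case using cd(3) by (intro exI[of _ ?c] exI[of _ ?d]) linarith
  qed
  \<comment> \<open>Increasing height shows that the roots are pairwise distinct.\<close>
  have mono: "ht ((?R ^^ n) x) < ht ((?R ^^ Suc n) x)" for n
  proof -
    obtain c d where cd: "c \<ge> d" "d \<ge> 0" "c > 0" "(?R ^^ n) x = c *\<^sub>R x + d *\<^sub>R y" using comb by blast
    have eq: "(?R ^^ Suc n) x = ((4 * k\<^sup>2 - 1) * c - 2 * k * d) *\<^sub>R x + (2 * k * c - d) *\<^sub>R y"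
      using cd(4) step[of c d] by simp
    have "ht ((?R ^^ Suc n) x) - ht ((?R ^^ n) x) =
        ((4 * k\<^sup>2 - 2) * c - 2 * k * d) * ht x + (2 * (k * c - d)) * ht y"
      unfolding eq cd(4) ht_linear by (simp add: algebra_simps power2_eq_square)
    moreover have "k * c > 1 * c" using k cd(3) by (intro mult_strict_right_mono) auto
    then have "k * c - d > 0" using cd(1) by linarith
    then have "(2 * (k * c - d)) * ht y > 0"
      using root_nonneg_iff[OF y(1)] y(2) by simp
    moreover have "(4 * k\<^sup>2 - 2) * c - 2 * k * d \<ge> 0"
    proof -
      have "(4 * k\<^sup>2 - 2) * c - 2 * k * d = 2 * ((2 * k + 1) * (k - 1)) * c + 2 * k * (c - d)" by (simp add: algebra_simps power2_eq_square)
      moreover have "(2 * k + 1) * (k - 1) \<ge> 0" using k by (intro mult_nonneg_nonneg) auto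
      moreover have "2 * k * (c - d) \<ge> 0" using k cd(1) by (intro mult_nonneg_nonneg) auto
      ultimately show ?thesis using cd(3) by simp
    qed
    then have "((4 * k\<^sup>2 - 2) * c - 2 * k * d) * ht x \<ge> 0"
      using root_nonneg_iff[OF x(1)] x(2) by (intro mult_nonneg_nonneg) auto
    ultimately show ?thesis by linarith
  qed
  then have "strict_mono (\<lambda>n. ht ((?R ^^ n) x))" by (rule strict_mono_Suc_iff[THEN iffD2, rule_format])
  then have inj: "inj (\<lambda>n. (?R ^^ n) x)"
    by (intro injI) (metis (mono_tags, lifting) strict_mono_eq)
  have root: "(?R ^^ n) x \<in> roots" for n
  proof -
    obtain r where r: "r \<in> carrier W" "act r = reflect x" using root_reflection[OF x(1)] by blast
    obtain r' where r': "r' \<in> carrier W" "act r' = reflect y" using root_reflection[OF y(1)] by blast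
    have R: "?R z \<in> roots" if "z \<in> roots" for z
      using root_act[OF root_act[OF that r'(1)] r(1)] r(2) r'(2) by simp
    show ?thesis by (induction n) (simp_all add: x(1) R)
  qed
  have "(?R ^^ n) x \<in> {z \<in> roots. nonneg z \<and> nonneg (- act g z)}" for n
  proof -
    obtain c d where cd: "c \<ge> d" "d \<ge> 0" "c > 0" "(?R ^^ n) x = c *\<^sub>R x + d *\<^sub>R y" using comb by blast
    have "- act g (c *\<^sub>R x + d *\<^sub>R y) = c *\<^sub>R (- act g x) + d *\<^sub>R (- act g y)"
      using g by (simp add: act_linear)
    moreover have "nonneg (c *\<^sub>R (- act g x) + d *\<^sub>R (- act g y))" "nonneg (c *\<^sub>R x + d *\<^sub>R y)"
      using cd(2,3) x y neg by (intro nonneg_add nonneg_scale; simp)+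
    ultimately have "nonneg (c *\<^sub>R x + d *\<^sub>R y)" "nonneg (- act g (c *\<^sub>R x + d *\<^sub>R y))"
      by simp_all
    then show ?thesis using root[of n] cd(4) by simp
  qed
  then have "range (\<lambda>n. (?R ^^ n) x) \<subseteq> {z \<in> roots. nonneg z \<and> nonneg (- act g z)}" by blast
  then have "finite (range (\<lambda>n. (?R ^^ n) x))" using finite_inversions[OF g] by (rule finite_subset)
  then show False using finite_imageD inj by blast
qed

text \<open>Replacing both roots by their images under \<open>g\<close> makes them positive, and
  \<open>h \<otimes> inv g\<close> would send both to negative roots.\<close>

lemma half_spaces_dichotomy:
  assumes x: "x \<in> roots" and y: "y \<in> roots" and xy: "B x y < - 1"
    and g: "g \<in> carrier W" "nonneg (act g x)" "nonneg (act g y)"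
    and h: "h \<in> carrier W" "nonneg (- act h x)" "nonneg (- act h y)"
  shows False
proof (rule half_spaces_disjoint)
  show "act g x \<in> roots" "act g y \<in> roots" using x y g root_act by auto
  show "B (act g x) (act g y) < - 1" using xy g by (simp add: act_isometry)
  show "h \<otimes> inv g \<in> carrier W" using g h by simp
  show "nonneg (- act (h \<otimes> inv g) (act g x))" "nonneg (- act (h \<otimes> inv g) (act g y))"
    using g h by (simp_all add: act_mult)
qed (use g in auto)

lemma connected_induct:
  assumes "s0 \<in> S" "P s0" and "\<And>s t. s \<in> S \<Longrightarrow> t \<in> S \<Longrightarrow> P s \<Longrightarrow> B (\<alpha> s) (\<alpha> t) \<noteq> 0 \<Longrightarrow> P t"
    and "t \<in> S"
  shows "P t"
proof (rule ccontr)
  assume "\<not> P t"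
  let ?T = "{s \<in> S. P s}"
  have "?T \<subset> S" "?T \<noteq> {}" using assms(1,2,4) \<open>\<not> P t\<close> by auto
  then obtain s u where su: "s \<in> ?T" "u \<in> S - ?T" "coxeter_label W s u \<noteq> 2"
    using irreducible unfolding irreducible_coxeter_def by meson
  then have "s \<noteq> u" by auto
  then have "B (\<alpha> s) (\<alpha> u) \<noteq> 0"
    using coeff_neg[of s u] su by (simp add: B_simple)
  then show False using assms(3)[of s u] su by auto
qed

end

context hyperbolic_roots
begin

section \<open>Roots approaching the isotropic direction\<close>

abbreviation x where "x \<equiv> x_plus"

definition \<rho> :: "nat \<Rightarrow> 'v" where "\<rho> n = (rot ^^ n) \<delta>"

lemma rot_hyperbolic: obtains u where "u \<in> hyperbolics" "act u = rot"
proof -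
  obtain r where r: "r \<in> carrier W" "act r = reflect \<delta>" using root_reflection[OF pair_roots(1)] by blast
  obtain r' where r': "r' \<in> carrier W" "act r' = reflect \<eta>" using root_reflection[OF pair_roots(2)] by blast
  have "- (\<tau>\<^sup>2 + 1) / (2 * \<tau>) < - 1"
  proof -
    have "(\<tau> - 1)\<^sup>2 > 0" using \<tau> by simp
    then have "\<tau>\<^sup>2 + 1 > 2 * \<tau>" by (simp add: power2_eq_square algebra_simps)
    then show ?thesis using \<tau> by (simp add: field_simps)
  qed
  then have "B \<delta> \<eta> < - 1" using B_pair by simp
  moreover have "act (r \<otimes> r') = rot" using r r' by (simp add: fun_eq_iff act_mult rot_def)
  then have "act (r \<otimes> r') = (\<lambda>z. reflect \<delta> (reflect \<eta> z))" by (simp add: rot_def fun_eq_iff)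
  ultimately have "r \<otimes> r' \<in> hyperbolics"
    using pair_roots r r' by (intro hyperbolics_memI) auto
  then show ?thesis using that \<open>act (r \<otimes> r') = rot\<close> by blast
qed

lemma \<rho>_root: "\<rho> n \<in> roots"
proof -
  obtain u where u: "u \<in> hyperbolics" "act u = rot" using rot_hyperbolic by blast
  then show ?thesis
    using act_pow[of u n \<delta>] root_act[OF pair_roots(1), of "u [^] n"] hyperbolics_carrier by (simp add: \<rho>_def)
qed

lemma \<rho>_eq: "\<rho> n = (\<tau> / (\<sigma> - 1) * \<sigma> ^ n) *\<^sub>R x - (1 / (\<sigma> - 1) * (1 / \<sigma>) ^ n) *\<^sub>R x_minus"
proof -
  have lin: "rot (y - z) = rot y - rot z" for y z
    using rot_linear(1)[of "y - z" z] by simp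
  show ?thesis
  proof (induction n)
    case 0
    show ?case using pair_eq(1) by (simp add: \<rho>_def)
  next
    case (Suc n)
    have "\<rho> (Suc n) = rot (\<rho> n)" by (simp add: \<rho>_def)
    also have "\<dots> = (\<tau> / (\<sigma> - 1) * \<sigma> ^ n) *\<^sub>R (\<sigma> *\<^sub>R x) - (1 / (\<sigma> - 1) * (1 / \<sigma>) ^ n) *\<^sub>R ((1 / \<sigma>) *\<^sub>R x_minus)"
      unfolding Suc lin rot_linear(2) rot_x_plus rot_x_minus ..
    finally show ?case by (simp add: mult_ac)
  qed
qed

definition c1 :: real where "c1 = \<tau> / (\<sigma> - 1)"
definition c2 :: real where "c2 = 1 / (\<sigma> - 1)"

lemma c_pos: "c1 > 0" "c2 > 0"
  using \<tau> \<sigma>_gt_1 by (simp_all add: c1_def c2_def)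

lemma act_\<rho>: "g \<in> carrier W \<Longrightarrow> act g (\<rho> n) = (c1 * \<sigma> ^ n) *\<^sub>R act g x - (c2 * (1 / \<sigma>) ^ n) *\<^sub>R act g x_minus"
  by (simp add: \<rho>_eq act_diff act_scale c1_def c2_def)

lemma B_act_\<rho>:
  assumes "g \<in> carrier W"
  shows "B (act g (\<rho> n)) y = (c1 * B (act g x) y) * \<sigma> ^ n + 0 + (- c2 * B (act g x_minus) y) * (1 / \<sigma>) ^ n"
  using assms by (simp add: act_\<rho> B_linear)

lemma ht_act_\<rho>:
  assumes "g \<in> carrier W"
  shows "ht (act g (\<rho> n)) = (c1 * ht (act g x)) * \<sigma> ^ n + 0 + (- c2 * ht (act g x_minus)) * (1 / \<sigma>) ^ n"
  using assms by (simp add: act_\<rho> ht_linear)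

lemma eventually_ht_act_\<rho>:
  assumes "g \<in> carrier W" "ht (act g x) > 0"
  shows "\<forall>\<^sub>F n in sequentially. K < ht (act g (\<rho> n))"
  unfolding ht_act_\<rho>[OF assms(1)] using assms c_pos \<sigma>_gt_1 by (intro eventually_exp_combination) auto

text \<open>If the expanding term vanished, the heights of the roots \<open>act g (\<rho> n)\<close>
  would tend to 0, against the uniform bound \<open>\<epsilon>\<close>.\<close>

lemma ht_act_x_nonzero:
  assumes g: "g \<in> carrier W"
  shows "ht (act g x) \<noteq> 0"
proof
  assume 0: "ht (act g x) = 0"
  have "(\<lambda>n. (- c2 * ht (act g x_minus)) * (1 / \<sigma>) ^ n) \<longlonglongrightarrow> (- c2 * ht (act g x_minus)) * 0"
    using \<sigma>_gt_1 by (intro tendsto_intros LIMSEQ_power_zero) auto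
  then have "(\<lambda>n. \<bar>ht (act g (\<rho> n))\<bar>) \<longlonglongrightarrow> \<bar>0\<bar>"
    unfolding ht_act_\<rho>[OF g] 0 by (intro tendsto_rabs) simp
  moreover have "\<bar>ht (act g (\<rho> n))\<bar> \<ge> \<epsilon>" for n
    using ht_root_abs root_act[OF \<rho>_root g] by blast
  ultimately have "\<epsilon> \<le> \<bar>0\<bar>" by (intro LIMSEQ_le_const) auto
  then show False using \<epsilon>(1) by simp
qed

end

text \<open>A sign normalisation: the height of \<open>x\<close> is never 0, and replacing the pair
  by its negatives changes its sign.\<close>

locale coxeter_hyperbolic = hyperbolic_roots W S B \<alpha> crd v \<delta> \<eta> \<tau>
  for W :: "('a, 'm) monoid_scheme" (structure) and S
    and B :: "'v::real_vector \<Rightarrow> 'v \<Rightarrow> real" and \<alpha> :: "'a \<Rightarrow> 'v" and crd :: "'a \<Rightarrow> 'v \<Rightarrow> real"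
    and v \<delta> \<eta> \<tau> +
  assumes ht_x_plus_pos: "ht x > 0"
begin

text \<open>If a generator \<open>s\<close> made the height negative, it would for large
  \<open>n\<close> turn a positive root of arbitrarily large height into a negative one. The only
  positive root it can turn is \<open>\<alpha> s\<close>, whose height is fixed.\<close>

lemma ht_act_x_pos: "g \<in> carrier W \<Longrightarrow> ht (act g x) > 0"
proof (induction rule: act_induct)
  case one
  then show ?case using ht_x_plus_pos by simp
next
  case (step s g)
  note sg = step and s = step(1)
  have sgc: "s \<otimes> g \<in> carrier W" using step S_carrier by simp
  show ?case
  proof (rule ccontr)
    assume "\<not> ht (act (s \<otimes> g) x) > 0"
    then have "ht (act (s \<otimes> g) x) < 0" using ht_act_x_nonzero[OF sgc] by linarith
    then have "- c1 * ht (act (s \<otimes> g) x) > 0" using c_pos by (simp add: mult_less_0_iff)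
    then have "\<forall>\<^sub>F n in sequentially. 0 < (- c1 * ht (act (s \<otimes> g) x)) * \<sigma> ^ n + 0 + (c2 * ht (act (s \<otimes> g) x_minus)) * (1 / \<sigma>) ^ n"
      using \<sigma>_gt_1 by (rule eventually_exp_combination[rotated])
    moreover have "(- c1 * ht (act (s \<otimes> g) x)) * \<sigma> ^ n + 0 + (c2 * ht (act (s \<otimes> g) x_minus)) * (1 / \<sigma>) ^ n
        = - ht (act (s \<otimes> g) (\<rho> n))" for n
      unfolding ht_act_\<rho>[OF sgc] by simp
    ultimately have "\<forall>\<^sub>F n in sequentially. 0 < - ht (act (s \<otimes> g) (\<rho> n))" by (simp only:)
    then have "\<forall>\<^sub>F n in sequentially. 0 < - ht (act (s \<otimes> g) (\<rho> n)) \<and> max 0 (ht (\<alpha> s)) < ht (act g (\<rho> n))"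
      using eventually_ht_act_\<rho>[OF step(2,3)] by (rule eventually_conj)
    from eventually_happens'[OF sequentially_bot this] obtain n
      where n: "ht (act (s \<otimes> g) (\<rho> n)) < 0" "max 0 (ht (\<alpha> s)) < ht (act g (\<rho> n))" by auto
    have r: "act g (\<rho> n) \<in> roots" "act (s \<otimes> g) (\<rho> n) \<in> roots"
      using root_act[OF \<rho>_root] step(2) sgc by auto
    have "act g (\<rho> n) = \<alpha> s"
    proof (rule simple_inversion[OF s r(1)])
      show "nonneg (act g (\<rho> n))" using root_nonneg_iff[OF r(1)] n(2) by simp
      show "nonneg (- act s (act g (\<rho> n)))"
        using root_nonpos_iff[OF r(2)] n(1) act_mult[of s g] s S_carrier step(2) by simp
    qed
    then show False using n(2) by simp
  qed
qed

text \<open>Reflecting \<open>act h x\<close> in the root \<open>act g (\<rho> n)\<close> subtracts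
  twice the product of a pairing and a height. If the pairing grew to infinity, the result would be
  an orbit point of negative height.\<close>

lemma B_act_x_nonpos:
  assumes g: "g \<in> carrier W" and h: "h \<in> carrier W"
  shows "B (act g x) (act h x) \<le> 0"
proof (rule ccontr)
  assume "\<not> ?thesis"
  then have pos: "c1 * B (act g x) (act h x) > 0" using c_pos by simp
  define K where "K = ht (act h x)"
  have K: "K > 0" using ht_act_x_pos h by (simp add: K_def)
  have "\<forall>\<^sub>F n in sequentially. K < B (act g (\<rho> n)) (act h x)"
    unfolding B_act_\<rho>[OF g] using pos \<sigma>_gt_1 by (intro eventually_exp_combination)
  then have "\<forall>\<^sub>F n in sequentially. K < B (act g (\<rho> n)) (act h x) \<and> 1 < ht (act g (\<rho> n))"
    using eventually_ht_act_\<rho>[OF g ht_act_x_pos[OF g]] by (rule eventually_conj)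
  from eventually_happens'[OF sequentially_bot this] obtain n
    where n: "K < B (act g (\<rho> n)) (act h x)" "1 < ht (act g (\<rho> n))" by auto
  obtain r where r: "r \<in> carrier W" "act r = reflect (act g (\<rho> n))"
    using root_reflection[OF root_act[OF \<rho>_root g]] by blast
  have "0 < ht (act (inv r \<otimes> h) x)" using ht_act_x_pos[of "inv r \<otimes> h"] r h by simp
  also have "ht (act (inv r \<otimes> h) x) = - B (act r v) (act h x)"
    using r(1) h act_adjoint[of r v "act h x"] by (simp add: ht_def act_mult)
  also have "act r v = v + (2 * ht (act g (\<rho> n))) *\<^sub>R act g (\<rho> n)"
    by (simp add: r(2) reflect_def ht_def)
  also have "- B (v + (2 * ht (act g (\<rho> n))) *\<^sub>R act g (\<rho> n)) (act h x)
      = K - 2 * (ht (act g (\<rho> n)) * B (act g (\<rho> n)) (act h x))"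
    by (simp add: B_linear K_def ht_def)
  finally have "2 * (ht (act g (\<rho> n)) * B (act g (\<rho> n)) (act h x)) < K" by simp
  moreover have "1 * K \<le> ht (act g (\<rho> n)) * B (act g (\<rho> n)) (act h x)"
    using n K by (intro mult_mono) auto
  ultimately show False using K by simp
qed

text \<open>The leading term grows like the square of \<open>\<sigma> ^ n\<close>, with negative
  coefficient by \<open>B_act_x_nonpos\<close>.\<close>

lemma eventually_B_\<rho>:
  assumes g: "g \<in> carrier W" and h: "h \<in> carrier W" and ne: "B (act g x) (act h x) \<noteq> 0"
  shows "\<forall>\<^sub>F n in sequentially. B (act g (\<rho> n)) (act h (\<rho> n)) < - 1"
proof -
  let ?P = "- (c1\<^sup>2 * B (act g x) (act h x))"
  let ?R = "c1 * c2 * (B (act g x) (act h x_minus) + B (act g x_minus) (act h x))"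
  let ?Q = "- (c2\<^sup>2 * B (act g x_minus) (act h x_minus))"
  have "B (act g x) (act h x) < 0" using B_act_x_nonpos[OF g h] ne by linarith
  then have "?P > 0" using c_pos by (simp add: mult_pos_neg)
  moreover have "\<sigma>\<^sup>2 > 1" using \<sigma>_gt_1 by (simp add: one_less_power)
  ultimately have "\<forall>\<^sub>F n in sequentially. 1 < ?P * (\<sigma>\<^sup>2) ^ n + ?R + ?Q * (1 / \<sigma>\<^sup>2) ^ n"
    by (intro eventually_exp_combination)
  moreover have "?P * (\<sigma>\<^sup>2) ^ n + ?R + ?Q * (1 / \<sigma>\<^sup>2) ^ n = - B (act g (\<rho> n)) (act h (\<rho> n))" for n
  proof -
    define t where "t = \<sigma> ^ n"
    define s where "s = (1 / \<sigma>) ^ n"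
    have ts: "t * s = 1" using \<sigma>_gt_1 by (simp add: t_def s_def power_mult_distrib[symmetric])
    have "- B (act g (\<rho> n)) (act h (\<rho> n)) = ?P * (t * t) + (t * s) * ?R + ?Q * (s * s)"
      unfolding act_\<rho>[OF g] act_\<rho>[OF h] t_def[symmetric] s_def[symmetric] B_linear
      by (simp add: algebra_simps power2_eq_square)
    moreover have "(\<sigma>\<^sup>2) ^ n = t * t" "(1 / \<sigma>\<^sup>2) ^ n = s * s"
      by (simp_all add: t_def s_def power2_eq_square power_mult_distrib power_divide)
    ultimately show ?thesis using ts by simp
  qed
  ultimately show ?thesis by (auto elim: eventually_mono)
qed

section \<open>Products of two generators lie in \<open>Wt\<close>\<close>

lemma root_expand:
  assumes "y \<in> roots"
  shows "y = (\<Sum>s\<in>S. crd s y *\<^sub>R \<alpha> s)"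
  using root_sign[OF assms]
proof
  assume "nonneg (- y)"
  then have "- y = (\<Sum>s\<in>S. crd s (- y) *\<^sub>R \<alpha> s)" by (rule nonneg_expand)
  also have "\<dots> = - (\<Sum>s\<in>S. crd s y *\<^sub>R \<alpha> s)" by (simp add: crd_minus sum_negf)
  finally show ?thesis by simp
qed (rule nonneg_expand)

lemma x_expand: "x = (\<Sum>s\<in>S. crd s x *\<^sub>R \<alpha> s)"
proof -
  have "x = \<tau> *\<^sub>R (\<Sum>s\<in>S. crd s \<delta> *\<^sub>R \<alpha> s) + (\<Sum>s\<in>S. crd s \<eta> *\<^sub>R \<alpha> s)"
    using root_expand pair_roots by (simp add: x_plus_def)
  also have "\<dots> = (\<Sum>s\<in>S. crd s x *\<^sub>R \<alpha> s)"
    by (simp add: x_plus_def crd_add crd_scale scaleR_sum_right scaleR_add_left sum.distrib)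
  finally show ?thesis .
qed

lemma B_sum_right: "B y (\<Sum>s\<in>I. c s *\<^sub>R \<alpha> s) = (\<Sum>s\<in>I. c s * B y (\<alpha> s))"
  by (induction I rule: infinite_finite_induct) (auto simp: B_linear)

text \<open>Orthogonality of the whole orbit to one simple root spreads to its neighbours: compare
  \<open>act g x\<close> with its reflection. By connectedness \<open>x\<close> would be orthogonal
  to \<open>v\<close>, against its positive height.\<close>

lemma x_not_orthogonal:
  assumes s: "s \<in> S"
  shows "\<exists>g\<in>carrier W. B (act g x) (\<alpha> s) \<noteq> 0"
proof (rule ccontr)
  assume none: "\<not> ?thesis"
  let ?P = "\<lambda>s. \<forall>g\<in>carrier W. B (act g x) (\<alpha> s) = 0"
  have "B x (\<alpha> t) = 0" if t: "t \<in> S" for t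
  proof -
    have "?P t"
    proof (rule connected_induct[of s ?P, OF s _ _ t])
      show "?P s" using none by blast
      fix p t assume pt: "p \<in> S" "t \<in> S" "?P p" "B (\<alpha> p) (\<alpha> t) \<noteq> 0"
      show "?P t"
      proof
        fix g assume g: "g \<in> carrier W"
        have "B (act (t \<otimes> g) x) (\<alpha> p) = 0" "B (act g x) (\<alpha> p) = 0"
          using pt g S_carrier by auto
        moreover have "act (t \<otimes> g) x = act g x - (2 * B (act g x) (\<alpha> t)) *\<^sub>R \<alpha> t"
          using pt g S_carrier by (simp add: act_mult act_S reflect_def)
        ultimately have "B (act g x) (\<alpha> t) * B (\<alpha> t) (\<alpha> p) = 0"
          by (simp add: B_linear)
        then show "B (act g x) (\<alpha> t) = 0" using pt(4) B_commute[of "\<alpha> t" "\<alpha> p"] by simp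
      qed
    qed
    then have "B (act \<one> x) (\<alpha> t) = 0" using one_closed by blast
    then show ?thesis by simp
  qed
  then have "B x v = 0"
    using B_sum_right[of x "\<lambda>s. crd s v" S] v_span by simp
  then show False using ht_x_plus_pos B_commute[of x v] by (simp add: ht_def)
qed

text \<open>For adjacent generators a root far along the orbit pairs with both simple roots beyond 1
  in absolute value. With its reflection \<open>r\<close>, the product of the generators is
  \<open>(s \<otimes> r) \<otimes> (r \<otimes> t)\<close>, a product of two hyperbolic elements. A
  path in the Coxeter graph covers the remaining pairs.\<close>

lemma S_mult_Wt:
  assumes "s \<in> S" "t \<in> S"
  shows "s \<otimes> t \<in> Wt"
proof -
  have adjacent: "s \<otimes> t \<in> Wt" if st: "s \<in> S" "t \<in> S" "B (\<alpha> s) (\<alpha> t) \<noteq> 0" for s t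
  proof -
    obtain g where g: "g \<in> carrier W" "B (act g x) (\<alpha> s) \<noteq> 0" using x_not_orthogonal st by blast
    have "\<exists>h\<in>carrier W. B (act h x) (\<alpha> s) \<noteq> 0 \<and> B (act h x) (\<alpha> t) \<noteq> 0"
    proof (cases "B (act g x) (\<alpha> t) = 0")
      case True
      have "act (s \<otimes> g) x = act g x - (2 * B (act g x) (\<alpha> s)) *\<^sub>R \<alpha> s"
        using st g S_carrier by (simp add: act_mult act_S reflect_def)
      then have "B (act (s \<otimes> g) x) (\<alpha> s) \<noteq> 0" "B (act (s \<otimes> g) x) (\<alpha> t) \<noteq> 0"
        using g(2) st True by (simp_all add: B_linear B_simple_self)
      then show ?thesis using st g S_carrier by (intro bexI[of _ "s \<otimes> g"]) auto
    qed (use g in blast)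
    then obtain h where h: "h \<in> carrier W" "B (act h x) (\<alpha> s) \<noteq> 0" "B (act h x) (\<alpha> t) \<noteq> 0" by blast
    have ev: "\<forall>\<^sub>F n in sequentially. 1 < \<bar>B (act h (\<rho> n)) y\<bar>" if "B (act h x) y \<noteq> 0" for y
    proof (cases "B (act h x) y > 0")
      case True
      then have "\<forall>\<^sub>F n in sequentially. 1 < B (act h (\<rho> n)) y"
        unfolding B_act_\<rho>[OF h(1)] using c_pos \<sigma>_gt_1 by (intro eventually_exp_combination) auto
      then show ?thesis by (auto elim: eventually_mono)
    next
      case False
      then have "B (act h x) (- y) > 0" using that by (simp add: B_minus_right)
      then have "\<forall>\<^sub>F n in sequentially. 1 < B (act h (\<rho> n)) (- y)"
        unfolding B_act_\<rho>[OF h(1)] using c_pos \<sigma>_gt_1 by (intro eventually_exp_combination) auto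
      then show ?thesis by (auto simp: B_minus_right elim: eventually_mono)
    qed
    have "\<forall>\<^sub>F n in sequentially. 1 < \<bar>B (act h (\<rho> n)) (\<alpha> s)\<bar> \<and> 1 < \<bar>B (act h (\<rho> n)) (\<alpha> t)\<bar>"
      using ev[OF h(2)] ev[OF h(3)] by (rule eventually_conj)
    from eventually_happens'[OF sequentially_bot this] obtain n
      where n: "1 < \<bar>B (act h (\<rho> n)) (\<alpha> s)\<bar>" "1 < \<bar>B (act h (\<rho> n)) (\<alpha> t)\<bar>" by blast
    let ?d = "act h (\<rho> n)"
    have d: "?d \<in> roots" using root_act \<rho>_root h by simp
    obtain r where r: "r \<in> carrier W" "act r = reflect ?d" "r \<otimes> r = \<one>" using root_reflection[OF d] by blast
    have acts: "act s = reflect (\<alpha> s)" "act t = reflect (\<alpha> t)" using act_S st by auto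
    have "s \<otimes> r \<in> hyperbolics" "r \<otimes> t \<in> hyperbolics"
      using hyperbolicI[OF simple_root[OF st(1)] d _ _ acts(1) r(1,2)]
        hyperbolicI[OF d simple_root[OF st(2)] _ r(1,2) _ acts(2)] n st S_carrier
        B_commute[of ?d "\<alpha> s"] by auto
    then have "(s \<otimes> r) \<otimes> (r \<otimes> t) \<in> Wt" using Wt_mult generate.incl by metis
    moreover have "r \<otimes> (r \<otimes> t) = t" using r st S_carrier by (simp add: m_assoc[symmetric])
    then have "(s \<otimes> r) \<otimes> (r \<otimes> t) = s \<otimes> t"
      using r st S_carrier by (simp add: m_assoc)
    ultimately show ?thesis by simp
  qed
  show ?thesis
  proof (rule connected_induct[of s "\<lambda>t. s \<otimes> t \<in> Wt", OF assms(1) _ _ assms(2)])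
    show "s \<otimes> s \<in> Wt" using S_sq assms Wt_one by simp
    fix p t assume pt: "p \<in> S" "t \<in> S" "s \<otimes> p \<in> Wt" "B (\<alpha> p) (\<alpha> t) \<noteq> 0"
    have "(s \<otimes> p) \<otimes> (p \<otimes> t) \<in> Wt" using adjacent pt Wt_mult by blast
    moreover have "p \<otimes> (p \<otimes> t) = t" using S_sq pt S_carrier by (simp add: m_assoc[symmetric])
    then have "(s \<otimes> p) \<otimes> (p \<otimes> t) = s \<otimes> t" using assms pt S_carrier by (simp add: m_assoc)
    ultimately show "s \<otimes> t \<in> Wt" by simp
  qed
qed

lemma S_mult_reflection_Wt:
  assumes g: "g \<in> carrier W" and s: "s \<in> S" and t: "t \<in> S"
  shows "s \<otimes> (g \<otimes> t \<otimes> inv g) \<in> Wt"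
  using g s
proof (induction arbitrary: s rule: act_induct)
  case one
  then show ?case using S_mult_Wt t S_carrier by simp
next
  case (step p g)
  note [simp] = step(1,2,4) S_carrier t
  let ?r = "g \<otimes> t \<otimes> inv g"
  have sq: "a \<otimes> (a \<otimes> z) = z" if "a \<in> S" "z \<in> carrier W" for a z
    using S_sq that by (simp add: m_assoc[symmetric])
  have r: "?r \<in> carrier W" "?r \<otimes> ?r = \<one>"
  proof -
    have "inv g \<otimes> (g \<otimes> z) = z" if "z \<in> carrier W" for z
      using that by (simp add: m_assoc[symmetric])
    then show "?r \<otimes> ?r = \<one>" by (simp add: m_assoc sq)
  qed simp
  have inv_r: "inv ?r = ?r" using r inv_equality by blast
  have "?r \<otimes> s \<in> Wt"
    using Wt_inv[OF step(3)[of s]] r step(4) by (simp add: inv_mult_group S_inv inv_r[simplified] m_assoc)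
  then have "(s \<otimes> p) \<otimes> (?r \<otimes> s) \<otimes> (s \<otimes> p) \<in> Wt"
    using S_mult_Wt[of s p] Wt_mult by simp
  moreover have "(s \<otimes> p) \<otimes> (?r \<otimes> s) \<otimes> (s \<otimes> p) = s \<otimes> ((p \<otimes> g) \<otimes> t \<otimes> inv (p \<otimes> g))"
    by (simp add: m_assoc sq inv_mult_group S_inv)
  ultimately show ?case by simp
qed

end

section \<open>Displaced half-spaces\<close>

lemma span_scale_cancel: "c *\<^sub>R y \<in> span X \<Longrightarrow> c \<noteq> 0 \<Longrightarrow> y \<in> span X"
  for y :: "'b::real_vector"
  using span_scale[of "c *\<^sub>R y" X "1 / c"] by simp

context coxeter_hyperbolic
begin

text \<open>Testing only products of two generators suffices. Their vanishing leaves at most two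
  simple roots, and with two of them the form is that of the affine infinite dihedral group, which
  admits no \<open>v\<close>.\<close>

lemma x_self_not_orthogonal: "\<exists>w\<in>Wt. B (act w x) x \<noteq> 0"
proof (rule ccontr)
  assume none: "\<not> ?thesis"
  let ?d = "\<lambda>s. B x (\<alpha> s)"
  have quad: "(?d s)\<^sup>2 + (?d t)\<^sup>2 = 2 * ?d s * ?d t * B (\<alpha> s) (\<alpha> t)" if st: "s \<in> S" "t \<in> S" for s t
  proof -
    have "act (s \<otimes> t) x = reflect (\<alpha> s) (reflect (\<alpha> t) x)"
      using st S_carrier by (simp add: act_mult act_S)
    also have "B \<dots> x = 4 * ?d s * ?d t * B (\<alpha> s) (\<alpha> t) - 2 * (?d s)\<^sup>2 - 2 * (?d t)\<^sup>2"
      using isotropic B_commute[of "\<alpha> s" x] B_commute[of "\<alpha> t" x] B_commute[of "\<alpha> t" "\<alpha> s"]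
      by (simp add: reflect_def B_linear power2_eq_square algebra_simps)
    finally have "B (act (s \<otimes> t) x) x = 4 * ?d s * ?d t * B (\<alpha> s) (\<alpha> t) - 2 * (?d s)\<^sup>2 - 2 * (?d t)\<^sup>2" .
    then show ?thesis using none S_mult_Wt[OF st] by auto
  qed
  \<comment> \<open>The identity \<open>quad\<close> and the bounds on \<open>?b\<close> make the
    square of \<open>?d s + ?d t\<close> nonpositive.\<close>
  have opposite: "?d t = - ?d s \<and> (?d s \<noteq> 0 \<longrightarrow> B (\<alpha> s) (\<alpha> t) = - 1)" if st: "s \<in> S" "t \<in> S" "s \<noteq> t" for s t
  proof -
    let ?b = "B (\<alpha> s) (\<alpha> t)"
    have b: "- 1 \<le> ?b" "?b \<le> 0" using coeff_bounds[OF st] B_simple st by auto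
    have sq: "(?d s)\<^sup>2 + (?d t)\<^sup>2 = 2 * (?d s * ?d t * ?b)"
      using quad[OF st(1,2)] by simp
    then have "?d s * ?d t * ?b \<ge> 0"
      using zero_le_power2[of "?d s"] zero_le_power2[of "?d t"] by linarith
    then have dd: "?d s * ?d t \<le> 0 \<or> ?d s * ?d t * ?b = 0"
      using b(2) by (metis linorder_not_le mult_pos_neg less_eq_real_def mult_zero_right order_antisym)
    have id: "(?d s + ?d t)\<^sup>2 = 2 * ((?d s * ?d t) * (1 + ?b))"
      using sq by (simp add: power2_eq_square algebra_simps)
    have "(?d s + ?d t)\<^sup>2 \<le> 0"
    proof (cases "?d s * ?d t \<le> 0")
      case True
      then have "(?d s * ?d t) * (1 + ?b) \<le> 0" by (rule mult_nonpos_nonneg) (use b in simp)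
      then show ?thesis unfolding id by simp
    next
      case False
      then have "(?d s)\<^sup>2 + (?d t)\<^sup>2 = 0" using dd sq by simp
      then show ?thesis by (simp add: sum_power2_eq_zero_iff)
    qed
    then have sum: "?d s + ?d t = 0" by simp
    then have "(?d s * ?d t) * (1 + ?b) = 0" using id by simp
    then show ?thesis using sum by auto
  qed
  have "\<exists>s\<in>S. ?d s \<noteq> 0"
  proof (rule ccontr)
    assume "\<not> ?thesis"
    then have "B x v = 0"
      using B_sum_right[of x "\<lambda>s. crd s v" S] v_span by simp
    then show False using ht_x_plus_pos B_commute[of x v] by (simp add: ht_def)
  qed
  then obtain s where s: "s \<in> S" "?d s \<noteq> 0" by blast
  show False
  proof (cases "S = {s}")
    case True
    have "x = crd s x *\<^sub>R \<alpha> s" using x_expand True by simp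
    then have "0 = (crd s x)\<^sup>2" "?d s = crd s x"
      using isotropic(1) B_simple_self[OF s(1)] by (metis B_scale_left B_scale_right mult.right_neutral power2_eq_square)+
    then show False using s(2) by simp
  next
    case False
    then obtain t where t: "t \<in> S" "t \<noteq> s" using s(1) by blast
    have dt: "?d t = - ?d s" "B (\<alpha> s) (\<alpha> t) = - 1" using opposite[of s t] s t by auto
    have "r = s \<or> r = t" if r: "r \<in> S" for r
    proof (rule ccontr)
      assume "\<not> ?thesis"
      then have "?d r = - ?d s" "?d r = - ?d t" using opposite[of s r] opposite[of t r] s t r by auto
      then show False using dt s(2) by simp
    qed
    then have S: "S = {s, t}" using s t by auto
    have vv: "v = crd s v *\<^sub>R \<alpha> s + crd t v *\<^sub>R \<alpha> t" using v_span t(2) S by simp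
    \<comment> \<open>The two values are opposite, so they cannot both be negative.\<close>
    have "B v (\<alpha> s) = crd s v - crd t v" "B v (\<alpha> t) = crd t v - crd s v"
      using s t dt(2) B_commute[of "\<alpha> t" "\<alpha> s"] by (subst vv, simp add: B_linear B_simple_self)+
    then show False using v_neg[of s] v_neg[of t] s t by simp
  qed
qed

text \<open>An orbit point not orthogonal to \<open>x\<close> has a component along
  \<open>x_minus\<close>, which \<open>rot\<close> isolates; so the span contains
  \<open>\<delta>\<close>. This makes it invariant under all of \<open>W\<close>, and connectedness
  carries one simple root to all others.\<close>

lemma act_Wt_x_span:
  assumes s: "s \<in> S"
  shows "\<alpha> s \<in> span ((\<lambda>w. act w x) ` Wt)"
proof -
  let ?V = "span ((\<lambda>w. act w x) ` Wt)"
  have V_act: "act g y \<in> ?V" if "y \<in> ?V" "g \<in> Wt" for g y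
    using that(1)
  proof (induction rule: span_induct_alt)
    case (step c z y)
    then obtain w where w: "w \<in> Wt" "z = act w x" by blast
    then have "act g z = act (g \<otimes> w) x" using that Wt_carrier by (simp add: act_mult)
    then have "act g z \<in> ?V" using Wt_mult[OF that(2) w(1)] by (auto intro: span_base)
    then show ?case
      using step that Wt_carrier by (simp add: act_linear span_add span_scale)
  qed (use that Wt_carrier in \<open>simp add: span_zero\<close>)
  have x: "x \<in> ?V" using Wt_one by (intro span_base) (auto intro!: image_eqI[of _ _ \<one>])
  obtain w where w: "w \<in> Wt" "B (act w x) x \<noteq> 0" using x_self_not_orthogonal by blast
  let ?z = "act w x"
  have z: "?z \<in> ?V" using w by (auto intro: span_base)
  obtain u where u: "u \<in> hyperbolics" "act u = rot" using rot_hyperbolic by blast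
  have "rot ?z \<in> ?V" using V_act[OF z, of u] u generate.incl by metis
  moreover have "rot ?z - ?z = (coef_plus ?z * (\<sigma> - 1)) *\<^sub>R x + (coef_minus ?z * (1 / \<sigma> - 1)) *\<^sub>R x_minus"
    using rot_funpow[of 1 ?z] decompose[of ?z] by (simp add: algebra_simps)
  ultimately have "(coef_minus ?z * (1 / \<sigma> - 1)) *\<^sub>R x_minus \<in> ?V"
    using z x by (metis (no_types, lifting) add_diff_cancel_left' span_diff span_scale)
  moreover have "coef_minus ?z * (1 / \<sigma> - 1) \<noteq> 0"
    using w(2) bpm_neg \<sigma>_gt_1 by (simp add: coef_minus_def)
  ultimately have "x_minus \<in> ?V"
    by (rule span_scale_cancel)
  then have \<delta>: "\<delta> \<in> ?V" using x by (subst pair_eq(1)) (intro span_diff span_scale)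
  obtain g0 s0 where \<delta>_eq: "g0 \<in> carrier W" "s0 \<in> S" "\<delta> = act g0 (\<alpha> s0)"
    using pair_roots(1) by (auto simp: roots_def)
  let ?r = "g0 \<otimes> s0 \<otimes> inv g0"
  have r: "?r \<in> carrier W" "act ?r y = reflect \<delta> y" for y
    using \<delta>_eq S_carrier by (simp_all add: act_mult act_S reflect_act)
  have rr: "reflect \<delta> (reflect \<delta> y) = y" for y
    using root_norm[OF pair_roots(1)] by (rule reflect_refl)
  \<comment> \<open>A generator is an element of \<open>Wt\<close> times the reflection in
    \<open>\<delta>\<close>, and that reflection preserves the span because \<open>\<delta>\<close>
    lies in it.\<close>
  have V_S: "act s y \<in> ?V" if "s \<in> S" "y \<in> ?V" for s y
  proof -
    have "act s y = act (s \<otimes> ?r) (reflect \<delta> y)"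
      using act_mult[of s ?r "reflect \<delta> y"] r rr[of y] that S_carrier by simp
    moreover have "reflect \<delta> y \<in> ?V"
      unfolding reflect_def using that \<delta> by (intro span_diff span_scale)
    ultimately show ?thesis
      using V_act S_mult_reflection_Wt[OF \<delta>_eq(1) that(1) \<delta>_eq(2)] by simp
  qed
  have V_W: "act g y \<in> ?V" if "g \<in> carrier W" "y \<in> ?V" for g y
    using that(1) by (induction rule: act_induct) (auto simp: that(2) V_S act_mult S_carrier)
  have "\<alpha> s0 \<in> ?V"
    using V_W[of "inv g0" \<delta>] \<delta> \<delta>_eq by simp
  then show ?thesis
  proof (rule connected_induct[of s0 "\<lambda>s. \<alpha> s \<in> ?V", OF \<delta>_eq(2) _ _ s])
    fix p t assume pt: "p \<in> S" "t \<in> S" "\<alpha> p \<in> ?V" "B (\<alpha> p) (\<alpha> t) \<noteq> 0"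
    have "\<alpha> p - act t (\<alpha> p) \<in> ?V" using V_S pt by (intro span_diff) auto
    then have "(2 * B (\<alpha> p) (\<alpha> t)) *\<^sub>R \<alpha> t \<in> ?V" using pt by (simp add: act_S reflect_def)
    then show "\<alpha> t \<in> ?V" by (rule span_scale_cancel) (use pt(4) in simp)
  qed
qed

text \<open>The ambient type may be larger than the span of the simple roots, and the orbit of
  \<open>x\<close> controls linear functionals only on this span.\<close>

definition E :: "'v set" where "E = span (\<alpha> ` S)"

lemma E_subset: "E \<subseteq> span ((\<lambda>w. act w x) ` Wt)"
  unfolding E_def using act_Wt_x_span by (intro span_minimal) auto

lemma linear_zero_on_E:
  assumes lin: "\<And>y z. l (y + z) = l y + l z" "\<And>c y. l (c *\<^sub>R y) = c * (l y :: real)"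
    and zero: "\<And>w. w \<in> Wt \<Longrightarrow> l (act w x) = 0" and y: "y \<in> E"
  shows "l y = 0"
proof -
  have "y \<in> span ((\<lambda>w. act w x) ` Wt)" using y E_subset by auto
  then show ?thesis
  proof (induction rule: span_induct_alt)
    case base
    then show ?case using lin(2)[of 0 0] by simp
  qed (use lin zero in auto)
qed

lemma E_sum: "(\<Sum>s\<in>S. c s *\<^sub>R \<alpha> s) \<in> E"
  unfolding E_def by (intro span_sum span_scale span_base) auto

lemma roots_E: "y \<in> roots \<Longrightarrow> y \<in> E"
  using root_expand E_sum by metis

lemma x_E: "x \<in> E" and v_E: "v \<in> E"
  using x_expand v_span E_sum by metis+

lemma E_act:
  assumes "g \<in> carrier W" "y \<in> E"
  shows "act g y \<in> E"
  using assms(2) unfolding E_def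
proof (induction rule: span_induct_alt)
  case (step c z y)
  then have "act g z \<in> E" using roots_E root_act simple_root assms by auto
  then show ?case
    using step assms by (simp add: act_linear span_add span_scale E_def)
qed (use assms in \<open>simp add: span_zero\<close>)

section \<open>The symmetrised form of a group element\<close>

definition sym :: "'a \<Rightarrow> 'v \<Rightarrow> 'v \<Rightarrow> real"
  where "sym f y z = B y (act f z) + B (act f y) z"

lemma sym_linear:
  assumes "f \<in> carrier W"
  shows "sym f y (z + z') = sym f y z + sym f y z'" "sym f y (c *\<^sub>R z) = c * sym f y z"
    "sym f (z + z') y = sym f z y + sym f z' y" "sym f (c *\<^sub>R z) y = c * sym f z y"
  using assms by (simp_all add: sym_def act_linear B_linear algebra_simps)

lemma sym_commute: "sym f y z = sym f z y"
  by (simp add: sym_def B_commute[of y] B_commute[of "act f y"])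

text \<open>Comparing coefficients of \<open>\<sigma>\<^sup>n\<close> in the vanishing quadratic form along the orbit of \<open>rot\<close>.\<close>

lemma sym_x_Wt:
  assumes f: "f \<in> carrier W" and zero: "\<And>w. w \<in> Wt \<Longrightarrow> B (act w x) (act f (act w x)) = 0"
  shows "\<exists>K. \<forall>z\<in>E. sym f x z = K * B x z"
proof -
  define K where "K = sym f x x_minus / bpm"
  have one: "sym f x (act w x) - K * B x (act w x) = 0" if w: "w \<in> Wt" and ne: "B (act w x) x_minus \<noteq> 0" for w
  proof -
    let ?y = "act w x"
    obtain u where u: "u \<in> hyperbolics" "act u = rot" using rot_hyperbolic by blast
    have "u \<in> Wt" using u by (intro generate.incl)
    then have uW: "u [^] n \<in> Wt" for n :: nat
      by (induction n) (simp_all add: Wt_one Wt_mult)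
    let ?yf = "part_fixed ?y" and ?yp = "coef_plus ?y *\<^sub>R x" and ?ym = "coef_minus ?y *\<^sub>R x_minus"
    have zero_n: "B ((rot ^^ n) ?y) (act f ((rot ^^ n) ?y)) = 0" for n
    proof -
      have "(rot ^^ n) ?y = act (u [^] n \<otimes> w) x"
        using u w Wt_carrier hyperbolics_carrier by (simp add: act_mult act_pow)
      then show ?thesis using zero[of "u [^] n \<otimes> w"] Wt_mult[OF uW w] by simp
    qed
    have exp: "B ((rot ^^ n) ?y) (act f ((rot ^^ n) ?y)) =
      (B ?yf (act f ?yf) + sym f ?yp ?ym) + sym f ?yp ?yf * \<sigma> ^ n + sym f ?ym ?yf * (1 / \<sigma>) ^ n
      + B ?yp (act f ?yp) * (\<sigma> ^ n)\<^sup>2 + B ?ym (act f ?ym) * ((1 / \<sigma>) ^ n)\<^sup>2" for n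
    proof -
      define t where "t = \<sigma> ^ n"
      define s where "s = (1 / \<sigma>) ^ n"
      have ts: "t * s = 1" using \<sigma>_gt_1 by (simp add: t_def s_def power_mult_distrib[symmetric])
      have line: "(rot ^^ n) ?y = ?yf + t *\<^sub>R ?yp + s *\<^sub>R ?ym"
        unfolding rot_funpow by (simp add: t_def s_def)
      show ?thesis
        unfolding line B_act_expand[OF f] t_def[symmetric] s_def[symmetric] ts sym_def
        by (simp only: B_commute[of "act f _"] mult_1 ts) (simp only: add_ac mult_ac)
    qed
    have "sym f ?yp ?yf = 0"
      using laurent_zero_or_cofinite[OF \<sigma>_gt_1, of "B ?yf (act f ?yf) + sym f ?yp ?ym" "sym f ?yp ?yf"
          "sym f ?ym ?yf" "B ?yp (act f ?yp)" "B ?ym (act f ?ym)"]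
      unfolding exp[symmetric] zero_n by simp
    moreover have "coef_plus ?y \<noteq> 0" using ne bpm_neg by (simp add: coef_plus_def)
    ultimately have y0: "sym f x ?yf = 0" by (simp add: sym_linear[OF f])
    have xx: "sym f x x = 0" using zero[OF Wt_one] B_commute[of "act f x" x] by (simp add: sym_def)
    have "sym f x ?y = sym f x (?yf + ?yp + ?ym)" using decompose[of ?y] by simp
    also have "\<dots> = coef_minus ?y * sym f x x_minus"
      by (simp only: sym_linear[OF f] y0 xx mult_zero_right add_0_left add_0_right)
    also have "\<dots> = K * B x ?y" by (simp add: K_def coef_minus_def B_commute)
    finally show ?thesis by simp
  qed
  have lin: "sym f x (y + z) - K * B x (y + z) = (sym f x y - K * B x y) + (sym f x z - K * B x z)"
    "sym f x (c *\<^sub>R y) - K * B x (c *\<^sub>R y) = c * (sym f x y - K * B x y)" for y z c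
    by (simp_all add: sym_linear[OF f] B_linear algebra_simps)
  have all: "sym f x (act w x) - K * B x (act w x) = 0" if w: "w \<in> Wt" for w
  proof (rule ccontr)
    assume ne: "\<not> ?thesis"
    have "regular (\<lambda>g. sym f x (act g x) - K * B x (act g x))"
      by (rule regular_linear) (rule lin)+
    moreover have "regular (\<lambda>g. B (act g x) x_minus)" by (rule regular_B)
    moreover have "B (act \<one> x) x_minus \<noteq> 0" using bpm_neg by (simp add: bpm_def)
    ultimately obtain g where "g \<in> Wt" "sym f x (act g x) - K * B x (act g x) \<noteq> 0" "B (act g x) x_minus \<noteq> 0"
      using irr_Wt[unfolded irr_def, rule_format] w ne Wt_one by blast
    then show False using one by blast
  qed
  have "sym f x z - K * B x z = 0" if "z \<in> E" for z
    using lin all that by (rule linear_zero_on_E)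
  then show ?thesis by (intro exI[of _ K]) auto
qed

text \<open>Conjugation moves \<open>sym_x_Wt\<close> to each orbit point, with a scalar
  \<open>K w\<close> that may depend on it. Symmetry equates the scalars of two points that are not
  orthogonal, and irreducibility of \<open>Wt\<close> links each point to \<open>x\<close> through a
  third one.\<close>

lemma sym_scalar:
  assumes f: "f \<in> carrier W" and zero: "\<And>w. w \<in> Wt \<Longrightarrow> B (act w x) (act f (act w x)) = 0"
  shows "\<exists>K. \<forall>y\<in>E. \<forall>z\<in>E. sym f y z = K * B y z"
proof -
  have "\<exists>K. \<forall>z\<in>E. sym f (act w x) z = K * B (act w x) z" if w: "w \<in> Wt" for w
  proof -
    let ?f = "inv w \<otimes> f \<otimes> w"
    have wc: "w \<in> carrier W" using w Wt_carrier by simp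
    have conj: "B y (act ?f z) = B (act w y) (act f (act w z))" "B (act ?f y) z = B (act f (act w y)) (act w z)" for y z
      using wc f act_adjoint[of w y "act f (act w z)"] act_adjoint[of "inv w" "act f (act w y)" z] by (simp_all add: act_mult)
    have "B (act h x) (act ?f (act h x)) = 0" if h: "h \<in> Wt" for h
      using conj(1) zero[OF Wt_mult[OF w h]] wc Wt_carrier[OF h] by (simp add: act_mult)
    then obtain K where K: "\<forall>z\<in>E. sym ?f x z = K * B x z"
      using sym_x_Wt[of ?f] wc f by auto
    have "sym f (act w x) z = K * B (act w x) z" if z: "z \<in> E" for z
    proof -
      have "sym f (act w x) z = sym ?f x (act (inv w) z)"
        using wc by (simp add: sym_def conj)
      also have "\<dots> = K * B x (act (inv w) z)" using K E_act[of "inv w" z] wc z by simp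
      finally show ?thesis using act_adjoint[OF wc] by simp
    qed
    then show ?thesis by blast
  qed
  then obtain K where K: "\<And>w z. w \<in> Wt \<Longrightarrow> z \<in> E \<Longrightarrow> sym f (act w x) z = K w * B (act w x) z"
    by metis
  have xE: "act w x \<in> E" if "w \<in> Wt" for w using E_act x_E Wt_carrier that by simp
  have eq: "K g = K h" if gh: "g \<in> Wt" "h \<in> Wt" "B (act g x) (act h x) \<noteq> 0" for g h
  proof -
    have "K g * B (act g x) (act h x) = K h * B (act h x) (act g x)"
      using K[OF gh(1) xE[OF gh(2)]] K[OF gh(2) xE[OF gh(1)]] sym_commute by metis
    then show ?thesis using gh(3) B_commute[of "act g x"] by simp
  qed
  obtain w0 where w0: "w0 \<in> Wt" "B (act w0 x) x \<noteq> 0" using x_self_not_orthogonal by blast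
  have const: "K w = K \<one>" if w: "w \<in> Wt" for w
  proof -
    have "B (act (w \<otimes> w0) x) (act w x) \<noteq> 0"
      using w0 w Wt_carrier by (simp add: act_mult act_isometry)
    then obtain g where "g \<in> Wt" "B (act g x) x \<noteq> 0" "B (act g x) (act w x) \<noteq> 0"
      using irr_Wt[unfolded irr_def, rule_format, OF regular_B regular_B] w0 Wt_mult[OF w w0(1)] by blast
    then show ?thesis using eq[of g w] eq[of g \<one>] w Wt_one by simp
  qed
  have "sym f y z - K \<one> * B y z = 0" if y: "y \<in> E" and z: "z \<in> E" for y z
  proof (rule linear_zero_on_E[OF _ _ _ y])
    fix w assume "w \<in> Wt"
    then show "sym f (act w x) z - K \<one> * B (act w x) z = 0" using K[OF _ z] const by simp
  qed (simp_all add: sym_linear[OF f] B_linear algebra_simps)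
  then show ?thesis by (intro exI[of _ "K \<one>"]) auto
qed

lemma concave_bound:
  fixes a :: "nat \<Rightarrow> real"
  assumes "\<And>n. a (Suc (Suc n)) - a (Suc n) \<le> a (Suc n) - a n"
  shows "a n \<le> a 0 + real n * (a 1 - a 0)"
proof -
  have d: "a (Suc n) - a n \<le> a 1 - a 0" for n
  proof (induction n)
    case (Suc n)
    then show ?case using assms[of n] by linarith
  qed simp
  show ?thesis
  proof (induction n)
    case (Suc n)
    then show ?case using d[of n] by (simp add: algebra_simps)
  qed simp
qed

text \<open>For \<open>K \<le> 2\<close> the heights along powers of \<open>f\<close> or of its
  inverse form positive concave sequences, so neither element lowers a height on the orbit of
  \<open>x\<close>. The two heights add up to at most twice the original one, hence \<open>f\<close>
  preserves heights, which fails at \<open>v\<close>.\<close>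

lemma sym_scalar_gt_2:
  assumes f: "f \<in> carrier W" "f \<noteq> \<one>" and K: "\<And>y z. y \<in> E \<Longrightarrow> z \<in> E \<Longrightarrow> sym f y z = K * B y z"
  shows "K > 2"
proof (rule ccontr)
  assume "\<not> K > 2"
  then have K2: "K \<le> 2" by simp
  have rec: "ht (act f z) + ht (act (inv f) z) = K * ht z" if "z \<in> E" for z
    using K[OF v_E that] act_adjoint[OF f(1), of v z] by (simp add: sym_def ht_def)
  have ge: "ht (act f (act w x)) \<ge> ht (act w x) \<and> ht (act (inv f) (act w x)) \<ge> ht (act w x)" if w: "w \<in> Wt" for w
  proof -
    have wc: "w \<in> carrier W" using w Wt_carrier by simp
    have "ht (act g (act w x)) \<ge> ht (act w x)" if g: "g \<in> carrier W" "g = f \<or> g = inv f" for g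
    proof (rule ccontr)
      assume lt: "\<not> ?thesis"
      define a where "a n = ht (act (g [^] n \<otimes> w) x)" for n :: nat
      have pos: "a n > 0" for n using ht_act_x_pos g wc by (simp add: a_def)
      have recg: "ht (act g z) + ht (act (inv g) z) = K * ht z" if "z \<in> E" for z
        using rec[OF that] g f by auto
      have "a (Suc (Suc n)) + a n = K * a (Suc n)" for n
      proof -
        let ?z = "act (g [^] Suc n \<otimes> w) x"
        have suc: "g [^] Suc m \<otimes> w = g \<otimes> (g [^] m \<otimes> w)" for m
          unfolding nat_pow_Suc2[OF g(1)] using g(1) wc by (simp add: m_assoc)
        have "act g ?z = act (g [^] Suc (Suc n) \<otimes> w) x" "act (inv g) ?z = act (g [^] n \<otimes> w) x"
          unfolding suc using g(1) wc by (simp_all add: act_mult del: nat_pow_Suc)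
        then show ?thesis using recg[of ?z] E_act[OF _ x_E] g wc by (simp add: a_def)
      qed
      moreover have "K * a (Suc n) \<le> 2 * a (Suc n)" for n
        using K2 pos[of "Suc n"] by (intro mult_right_mono) auto
      ultimately have "a (Suc (Suc n)) + a n \<le> 2 * a (Suc n)" for n by metis
      then have "a (Suc (Suc n)) - a (Suc n) \<le> a (Suc n) - a n" for n
        by (simp add: algebra_simps)
      then have le: "a n \<le> a 0 + real n * (a 1 - a 0)" for n by (rule concave_bound)
      have neg: "a 1 - a 0 < 0" using lt g wc by (simp add: a_def act_mult)
      obtain n where "real n > a 0 / (a 0 - a 1)" using reals_Archimedean2 by blast
      then have "real n * (a 0 - a 1) > a 0" using neg by (simp add: field_simps)
      then show False using le[of n] pos[of n] by (simp add: algebra_simps)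
    qed
    then show ?thesis using f by auto
  qed
  have "ht (act f z) - ht z = 0" if "z \<in> E" for z
  proof (rule linear_zero_on_E[OF _ _ _ that])
    fix w assume w: "w \<in> Wt"
    have wE: "act w x \<in> E" using E_act x_E Wt_carrier w by simp
    have "ht (act w x) > 0" using ht_act_x_pos Wt_carrier w by simp
    then have "K * ht (act w x) \<le> 2 * ht (act w x)" using K2 by (intro mult_right_mono) auto
    then show "ht (act f (act w x)) - ht (act w x) = 0" using ge[OF w] rec[OF wE] by linarith
  qed (simp_all add: act_linear f ht_linear algebra_simps)
  then have "ht (act f v) = ht v" using v_E by force
  then show False using ht_act_v_gt[OF f] by simp
qed

text \<open>If \<open>act f + act (inv f)\<close> were a scalar \<open>K > 2\<close>, then every half-space would be mapped into itself
  by \<open>f\<close> or by its inverse. Of three disjoint half-spaces, two would behave in the same way, which is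
  impossible: only finitely many walls separate a point of one from a point of the other.\<close>

text \<open>The half-space of \<open>y\<close>, up to inversion of the group elements.\<close>

definition negative :: "'v \<Rightarrow> 'a set"
  where "negative y = {g \<in> carrier W. nonneg (- act g y)}"

text \<open>The roots \<open>act (f [^] n) y\<close> all separate a point of one half-space from a
  point of the other, so only finitely many of them are distinct. Their pairings with
  \<open>y\<close>, however, increase strictly by the recursion with \<open>K > 2\<close>.\<close>

lemma not_both_expand:
  assumes f: "f \<in> carrier W" and K: "\<And>y z. y \<in> E \<Longrightarrow> z \<in> E \<Longrightarrow> sym f y z = K * B y z" "K > 2"
    and y: "y \<in> roots" "y' \<in> roots" and disj: "negative y \<inter> negative y' = {}"
    and exp: "\<And>g. g \<in> negative y \<Longrightarrow> g \<otimes> f \<in> negative y" "\<And>g. g \<in> negative y' \<Longrightarrow> g \<otimes> f \<in> negative y'"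
  shows False
proof -
  have ne: "\<exists>g. g \<in> negative z" if z: "z \<in> roots" for z
  proof (cases "nonneg (- z)")
    case True
    then show ?thesis by (intro exI[of _ \<one>]) (simp add: negative_def)
  next
    case False
    obtain r where r: "r \<in> carrier W" "act r = reflect z" using root_reflection[OF z] by blast
    have "act r z = - z" using r(2) root_norm[OF z] by (simp add: reflect_def scaleR_2)
    then show ?thesis using False root_sign[OF z] r(1) by (intro exI[of _ r]) (simp add: negative_def)
  qed
  obtain g where g: "g \<in> negative y" using ne y by blast
  obtain h where h: "h \<in> negative y'" using ne y by blast
  have gh: "g \<in> carrier W" "h \<in> carrier W" using g h by (auto simp: negative_def)
  have iter: "a \<otimes> f [^] n \<in> negative z" if "a \<in> negative z" "\<And>g. g \<in> negative z \<Longrightarrow> g \<otimes> f \<in> negative z" for a z and n :: nat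
  proof (induction n)
    case 0
    then show ?case using that by (simp add: negative_def)
  next
    case (Suc n)
    have "a \<in> carrier W" using that by (simp add: negative_def)
    then have "a \<otimes> f [^] Suc n = a \<otimes> f [^] n \<otimes> f" using f by (simp add: m_assoc)
    then show ?case using that(2)[OF Suc] by simp
  qed
  define p where "p n = act (f [^] n) y" for n :: nat
  have pr: "p n \<in> roots" for n using root_act y f by (simp add: p_def)
  have "p n \<in> {z \<in> roots. nonneg (act h z) \<and> nonneg (- act g z)}" for n
  proof -
    have "g \<otimes> f [^] n \<in> negative y" "h \<otimes> f [^] n \<in> negative y'" using iter g h exp by auto
    then have "nonneg (- act g (p n))" "h \<otimes> f [^] n \<notin> negative y"
      using disj gh f by (simp add: negative_def p_def act_mult, blast)
    moreover from this(2) have "\<not> nonneg (- act h (p n))"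
      using gh f by (simp add: negative_def p_def act_mult)
    ultimately show ?thesis using root_sign[OF root_act[OF pr gh(2)]] pr by auto
  qed
  then have "range p \<subseteq> {z \<in> roots. nonneg (act h z) \<and> nonneg (- act g z)}" by blast
  then have fin: "finite (range p)" using finite_separating[OF gh(2,1)] by (rule finite_subset)
  define b where "b n = B y (p n)" for n
  have pE: "p n \<in> E" "y \<in> E" for n using pr y roots_E by auto
  have rec: "b (Suc (Suc n)) = K * b (Suc n) - b n" for n
  proof -
    have "p (Suc m) = act f (p m)" for m
      unfolding p_def nat_pow_Suc2[OF f] using f by (simp add: act_mult)
    then have "act f (p (Suc n)) = p (Suc (Suc n))" "p (Suc n) = act f (p n)"
      by simp_all
    moreover have "B (act f y) (act f (p n)) = B y (p n)" using f by (simp add: act_isometry)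
    ultimately show ?thesis using K(1)[OF pE(2) pE(1)[of "Suc n"]] by (simp add: sym_def b_def)
  qed
  have b0: "b 0 = 1" using root_norm y by (simp add: b_def p_def)
  have b1: "b 1 > 1"
  proof -
    have "sym f y y = K * 1" using K(1)[OF pE(2) pE(2)] root_norm y by simp
    moreover have "p 1 = act f y" using f by (simp add: p_def)
    ultimately show ?thesis using K(2) B_commute[of "act f y" y] by (simp add: sym_def b_def)
  qed
  have mono: "b n < b (Suc n) \<and> b (Suc n) > 0" for n
  proof (induction n)
    case 0
    show ?case using b0 b1 by simp
  next
    case (Suc n)
    have "2 * b (Suc n) < K * b (Suc n)" using K(2) Suc by simp
    then show ?case using Suc rec[of n] by linarith
  qed
  then have "strict_mono b" by (simp add: strict_mono_Suc_iff)
  then have "inj p" by (intro injI) (metis b_def strict_mono_eq)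
  then show False using fin finite_imageD by blast
qed

lemma exists_B_x_nonzero:
  assumes f: "f \<in> carrier W" "f \<noteq> \<one>"
  shows "\<exists>w\<in>Wt. B (act w x) (act f (act w x)) \<noteq> 0"
proof (rule ccontr)
  assume "\<not> ?thesis"
  then obtain K where K: "\<And>y z. y \<in> E \<Longrightarrow> z \<in> E \<Longrightarrow> sym f y z = K * B y z"
    using sym_scalar[OF f(1)] by blast
  have K2: "K > 2" using sym_scalar_gt_2[OF f] K by blast
  have fi: "inv f \<in> carrier W" using f by simp
  have sym_inv: "sym (inv f) y z = sym f y z" for y z
    using act_adjoint[OF f(1)] act_adjoint[OF fi] f(1) by (simp add: sym_def)
  then have Ki: "\<And>y z. y \<in> E \<Longrightarrow> z \<in> E \<Longrightarrow> sym (inv f) y z = K * B y z" using K by simp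
  \<comment> \<open>Here \<open>B y (act f y)\<close> equals \<open>K / 2\<close>, which exceeds 1,
    so the dichotomy applies to \<open>y\<close> and \<open>- act f y\<close>.\<close>
  have type: "(\<forall>g. g \<in> negative y \<longrightarrow> g \<otimes> f \<in> negative y) \<or> (\<forall>g. g \<in> negative y \<longrightarrow> g \<otimes> inv f \<in> negative y)"
    if y: "y \<in> roots" for y
  proof (rule ccontr)
    assume "\<not> ?thesis"
    then obtain g h where g: "g \<in> negative y" "g \<otimes> f \<notin> negative y" and h: "h \<in> negative y" "h \<otimes> inv f \<notin> negative y"
      by blast
    have gh: "g \<in> carrier W" "h \<in> carrier W" using g h by (auto simp: negative_def)
    have fy: "act f y \<in> roots" "- act f y \<in> roots" using root_act[OF y f(1)] root_minus by auto
    have "sym f y y = K" using K[of y y] roots_E[OF y] root_norm[OF y] by simp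
    then have "B y (- act f y) < - 1"
      using K2 B_commute[of "act f y" y] by (simp add: sym_def B_minus_right)
    moreover have "nonneg (act (h \<otimes> inv f) y)"
      using h gh f root_sign[OF root_act[OF y, of "h \<otimes> inv f"]] by (auto simp: negative_def)
    moreover have "nonneg (act (h \<otimes> inv f) (- act f y))"
      using h gh f by (simp add: negative_def act_mult act_minus)
    moreover have "nonneg (- act g y)" using g by (simp add: negative_def)
    moreover have "nonneg (- act g (- act f y))"
      using g gh f root_sign[OF root_act[OF fy(1) gh(1)]] by (auto simp: negative_def act_mult act_minus)
    ultimately show False
      using half_spaces_dichotomy[OF y fy(2), of "h \<otimes> inv f" g] gh fi by simp
  qed
  \<comment> \<open>Three orbit points with nonzero mutual pairings are needed; irreducibility
    provides the third one. The roots approximating them bound three disjoint half-spaces.\<close>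
  obtain w2 where w2: "w2 \<in> Wt" "B (act w2 x) x \<noteq> 0" using x_self_not_orthogonal by blast
  have "B (act (w2 \<otimes> w2) x) (act w2 x) \<noteq> 0"
    using w2 Wt_carrier by (simp add: act_mult act_isometry)
  then obtain w3 where w3: "w3 \<in> Wt" "B (act w3 x) x \<noteq> 0" "B (act w3 x) (act w2 x) \<noteq> 0"
    using irr_Wt[unfolded irr_def, rule_format, OF regular_B regular_B] w2 Wt_mult by blast
  have c: "w2 \<in> carrier W" "w3 \<in> carrier W" using w2 w3 Wt_carrier by auto
  have "\<forall>\<^sub>F n in sequentially. (B (act w2 (\<rho> n)) (act \<one> (\<rho> n)) < - 1 \<and> B (act w3 (\<rho> n)) (act \<one> (\<rho> n)) < - 1
      \<and> B (act w3 (\<rho> n)) (act w2 (\<rho> n)) < - 1)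
      \<and> (0 < ht (act \<one> (\<rho> n)) \<and> 0 < ht (act w2 (\<rho> n)) \<and> 0 < ht (act w3 (\<rho> n)))"
    using w2 w3 c by (intro eventually_conj eventually_B_\<rho> eventually_ht_act_\<rho> ht_act_x_pos) auto
  from eventually_happens'[OF sequentially_bot this] obtain n
    where n: "B (act w2 (\<rho> n)) (\<rho> n) < - 1" "B (act w3 (\<rho> n)) (\<rho> n) < - 1"
      "B (act w3 (\<rho> n)) (act w2 (\<rho> n)) < - 1" "0 < ht (\<rho> n)" "0 < ht (act w2 (\<rho> n))" "0 < ht (act w3 (\<rho> n))"
    by auto
  let ?y1 = "\<rho> n" and ?y2 = "act w2 (\<rho> n)" and ?y3 = "act w3 (\<rho> n)"
  have r: "?y1 \<in> roots" "?y2 \<in> roots" "?y3 \<in> roots" using \<rho>_root root_act c by auto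
  have disj: "negative y \<inter> negative z = {}" if "y \<in> roots" "z \<in> roots" "0 < ht y" "0 < ht z" "B y z < - 1" for y z
    using half_spaces_disjoint[of y z] that root_nonneg_iff by (auto simp: negative_def)
  have no: False if yz: "y \<in> roots" "z \<in> roots" "negative y \<inter> negative z = {}"
    and same: "(\<forall>g. g \<in> negative y \<longrightarrow> g \<otimes> f \<in> negative y) \<and> (\<forall>g. g \<in> negative z \<longrightarrow> g \<otimes> f \<in> negative z)
      \<or> (\<forall>g. g \<in> negative y \<longrightarrow> g \<otimes> inv f \<in> negative y) \<and> (\<forall>g. g \<in> negative z \<longrightarrow> g \<otimes> inv f \<in> negative z)" for y z
    using same
  proof
    assume "(\<forall>g. g \<in> negative y \<longrightarrow> g \<otimes> f \<in> negative y) \<and> (\<forall>g. g \<in> negative z \<longrightarrow> g \<otimes> f \<in> negative z)"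
    then show False using not_both_expand[OF f(1) K K2 yz] by blast
  next
    assume "(\<forall>g. g \<in> negative y \<longrightarrow> g \<otimes> inv f \<in> negative y) \<and> (\<forall>g. g \<in> negative z \<longrightarrow> g \<otimes> inv f \<in> negative z)"
    then show False using not_both_expand[OF fi Ki K2 yz] by blast
  qed
  show False
    using type[OF r(1)] type[OF r(2)] type[OF r(3)]
      no[OF r(2,1) disj[OF r(2,1) n(5,4,1)]] no[OF r(3,1) disj[OF r(3,1) n(6,4,2)]] no[OF r(3,2) disj[OF r(3,2) n(6,5,3)]]
    by blast
qed

theorem half_space_displaced:
  assumes F: "finite F" "F \<subseteq> carrier W - {\<one>}"
  shows "\<exists>C r. C \<subseteq> carrier W \<and> r \<in> carrier W \<and> (\<forall>f\<in>F. \<forall>c\<in>C. f \<otimes> c \<notin> C) \<and>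
    (\<forall>g\<in>carrier W. g \<in> C \<longleftrightarrow> r \<otimes> g \<notin> C)"
proof -
  have "\<exists>w\<in>Wt. \<forall>f\<in>F. B (act w x) (act f (act w x)) \<noteq> 0"
  proof (rule regular_common_nonzero[OF F(1)])
    fix f assume "f \<in> F"
    then have f: "f \<in> carrier W" "f \<noteq> \<one>" using F by auto
    show "regular (\<lambda>g. B (act g x) (act f (act g x)))"
      using quadratic_regular[OF quadratic_act[OF f(1)]] .
    show "\<exists>g\<in>Wt. B (act g x) (act f (act g x)) \<noteq> 0" using exists_B_x_nonzero[OF f] .
  qed
  then obtain w where w: "w \<in> carrier W" "\<And>f. f \<in> F \<Longrightarrow> B (act w x) (act f (act w x)) \<noteq> 0"
    using Wt_carrier by blast
  have "\<forall>\<^sub>F n in sequentially. B (act w (\<rho> n)) (act (f \<otimes> w) (\<rho> n)) < - 1 \<and> 0 < ht (act (f \<otimes> w) (\<rho> n))"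
    if "f \<in> F" for f
  proof -
    have f: "f \<in> carrier W" using that F by auto
    then have "B (act w x) (act (f \<otimes> w) x) \<noteq> 0" using w that by (simp add: act_mult)
    then show ?thesis
      using f w(1) by (intro eventually_conj eventually_B_\<rho> eventually_ht_act_\<rho> ht_act_x_pos) auto
  qed
  then have "\<forall>\<^sub>F n in sequentially. \<forall>f\<in>F. B (act w (\<rho> n)) (act (f \<otimes> w) (\<rho> n)) < - 1 \<and> 0 < ht (act (f \<otimes> w) (\<rho> n))"
    using F(1) by (simp add: eventually_ball_finite_distrib)
  then have "\<forall>\<^sub>F n in sequentially. (\<forall>f\<in>F. B (act w (\<rho> n)) (act (f \<otimes> w) (\<rho> n)) < - 1 \<and> 0 < ht (act (f \<otimes> w) (\<rho> n)))
      \<and> 0 < ht (act w (\<rho> n))"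
    using w(1) by (intro eventually_conj eventually_ht_act_\<rho> ht_act_x_pos)
  from eventually_happens'[OF sequentially_bot this] obtain n
    where n: "\<forall>f\<in>F. B (act w (\<rho> n)) (act (f \<otimes> w) (\<rho> n)) < - 1 \<and> 0 < ht (act (f \<otimes> w) (\<rho> n))"
      "0 < ht (act w (\<rho> n))" by blast
  let ?y = "act w (\<rho> n)"
  have y: "?y \<in> roots" "nonneg ?y" using root_act[OF \<rho>_root w(1)] n(2) root_nonneg_iff by auto
  obtain r where r: "r \<in> carrier W" "act r = reflect ?y" "r \<otimes> r = \<one>" using root_reflection[OF y(1)] by blast
  \<comment> \<open>The inverse makes left translation by \<open>f\<close> replace the root
    \<open>?y\<close> by \<open>act f ?y\<close>, and left translation by \<open>r\<close> replace
    it by \<open>- ?y\<close>.\<close>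
  define C where "C = {g \<in> carrier W. nonneg (- act (inv g) ?y)}"
  have displaced: "f \<otimes> c \<notin> C" if f: "f \<in> F" and c: "c \<in> C" for f c
  proof
    assume fc: "f \<otimes> c \<in> C"
    have fcW: "f \<in> carrier W" "c \<in> carrier W" using f F c by (auto simp: C_def)
    have fy: "act f ?y \<in> roots" using root_act y fcW by simp
    have fy': "act (f \<otimes> w) (\<rho> n) = act f ?y" using fcW w by (simp add: act_mult)
    have "nonneg (- act (inv (f \<otimes> c)) (act f ?y))"
      using c fcW by (simp add: C_def inv_mult_group act_mult)
    moreover have "nonneg (- act (inv (f \<otimes> c)) ?y)" using fc by (simp add: C_def)
    moreover have "nonneg (act f ?y)" "B ?y (act f ?y) < - 1"
      using n(1) f fy' root_nonneg_iff[OF fy] by auto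
    ultimately show False
      using half_spaces_disjoint[OF y fy, of "inv (f \<otimes> c)"] fcW by simp
  qed
  have swapped: "g \<in> C \<longleftrightarrow> r \<otimes> g \<notin> C" if g: "g \<in> carrier W" for g
  proof -
    have "inv r = r" using r inv_equality by blast
    then have "act (inv (r \<otimes> g)) ?y = act (inv g) (reflect ?y ?y)"
      using r g by (simp add: inv_mult_group act_mult)
    also have "\<dots> = - act (inv g) ?y"
      using root_norm[OF y(1)] g by (simp add: reflect_def scaleR_2 act_minus)
    finally have "r \<otimes> g \<in> C \<longleftrightarrow> nonneg (act (inv g) ?y)" using r g by (simp add: C_def)
    moreover have "act (inv g) ?y \<in> roots" using root_act y g by simp
    ultimately show ?thesis
      using root_sign nonneg_antisym root_nonzero g by (auto simp: C_def)
  qed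
  show ?thesis
  proof (intro exI conjI ballI)
    show "C \<subseteq> carrier W" by (auto simp: C_def)
  qed (fact r(1) displaced swapped)+
qed

end

context coxeter_chamber
begin

theorem exists_displaced_half_space:
  assumes F: "finite F" "F \<subseteq> carrier W - {\<one>}"
  shows "\<exists>C r. C \<subseteq> carrier W \<and> r \<in> carrier W \<and> (\<forall>f\<in>F. \<forall>c\<in>C. f \<otimes> c \<notin> C) \<and>
    (\<forall>g\<in>carrier W. g \<in> C \<longleftrightarrow> r \<otimes> g \<notin> C)"
proof -
  obtain y z where yz: "y \<in> roots" "z \<in> roots" "B y z < - 1" using exists_hyperbolic_pair by blast
  obtain \<tau> where \<tau>: "hyperbolic_pair W S B \<alpha> crd y z \<tau>" using hyperbolic_pairI[OF yz] by blast
  interpret P: hyperbolic_pair W S B \<alpha> crd y z \<tau> by (rule \<tau>)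
  have m: "- y \<in> roots" "- z \<in> roots" "B (- y) (- z) = B y z" using yz root_minus by (auto simp: B_linear)
  interpret M: hyperbolic_pair W S B \<alpha> crd "- y" "- z" \<tau>
    using P.unit P.\<tau> P.B_pair m by unfold_locales (auto simp: B_linear)
  have minus: "M.x_plus = - P.x_plus" by (simp add: M.x_plus_def P.x_plus_def)
  interpret R: hyperbolic_roots W S B \<alpha> crd v y z \<tau> using yz by unfold_locales
  have "ht P.x_plus \<noteq> 0" using R.ht_act_x_nonzero[of \<one>] by simp
  then consider "ht P.x_plus > 0" | "ht M.x_plus > 0" unfolding minus ht_linear by linarith
  then show ?thesis
  proof cases
    case 1
    then interpret coxeter_hyperbolic W S B \<alpha> crd v y z \<tau> using yz by unfold_locales
    show ?thesis by (rule half_space_displaced[OF F])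
  next
    case 2
    then interpret coxeter_hyperbolic W S B \<alpha> crd v "- y" "- z" \<tau> using m by unfold_locales
    show ?thesis by (rule half_space_displaced[OF F])
  qed
qed

end

section \<open>Gordan's alternative and the Tits form\<close>

instantiation "fun" :: (type, real_vector) real_vector
begin

definition scaleR_fun :: "real \<Rightarrow> ('a \<Rightarrow> 'b) \<Rightarrow> 'a \<Rightarrow> 'b"
  where "scaleR_fun c f = (\<lambda>x. c *\<^sub>R f x)"

instance
  by standard (simp_all add: scaleR_fun_def fun_eq_iff scaleR_add_right scaleR_add_left)

end

lemma scaleR_fun_apply [simp]: "(c *\<^sub>R f) x = c *\<^sub>R f x"
  by (simp add: scaleR_fun_def)

text \<open>If \<open>z\<close> is the point of least norm in the convex hull of the rows, then \<open>v = - z\<close> works unless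
  \<open>z = 0\<close>.\<close>

lemma gordan_symmetric:
  fixes A :: "'a \<Rightarrow> 'a \<Rightarrow> real"
  assumes fin: "finite S" and ne: "S \<noteq> {}" and sym: "\<And>s t. s \<in> S \<Longrightarrow> t \<in> S \<Longrightarrow> A s t = A t s"
  obtains (negative) v where "\<And>s. s \<in> S \<Longrightarrow> (\<Sum>t\<in>S. v t * A t s) < 0"
    | (kernel) y where "\<And>s. s \<in> S \<Longrightarrow> 0 \<le> y s" "(\<Sum>s\<in>S. y s) = 1" "\<And>s. s \<in> S \<Longrightarrow> (\<Sum>t\<in>S. y t * A t s) = 0"
proof -
  \<comment> \<open>Coordinates outside \<open>S\<close> are confined to the unit interval too, so
    that the product of intervals is compact.\<close>
  define \<Delta> where "\<Delta> = (\<Pi>\<^sub>E s\<in>UNIV. {0..1::real}) \<inter> {y :: 'a \<Rightarrow> real. (\<Sum>s\<in>S. y s) = 1}"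
  define z where "z y s = (\<Sum>t\<in>S. y t * A t s)" for y s
  define Q where "Q y = (\<Sum>s\<in>S. (z y s)\<^sup>2)" for y
  have coord: "continuous_on X (\<lambda>y. y s)" for s :: 'a and X :: "('a \<Rightarrow> real) set"
    by (rule continuous_on_subset[OF continuous_on_product_coordinates]) simp
  have "compactin (product_topology (\<lambda>_. euclideanreal) UNIV) (\<Pi>\<^sub>E s\<in>(UNIV :: 'a set). {0..1::real})"
    by (subst compactin_PiE) (simp add: compactin_euclidean_iff)
  then have "compact (\<Pi>\<^sub>E s\<in>(UNIV :: 'a set). {0..1::real})"
    by (simp add: euclidean_product_topology compactin_euclidean_iff)
  moreover have "closed {y :: 'a \<Rightarrow> real. (\<Sum>s\<in>S. y s) = 1}"
    by (intro closed_Collect_eq continuous_on_sum coord continuous_on_const)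
  ultimately have comp: "compact \<Delta>" unfolding \<Delta>_def by (rule compact_Int_closed)
  obtain s0 where s0: "s0 \<in> S" using ne by blast
  have "(\<lambda>s. if s = s0 then 1 else 0) \<in> \<Delta>"
    using s0 fin by (auto simp: \<Delta>_def)
  then have ne_\<Delta>: "\<Delta> \<noteq> {}" by blast
  have cont: "continuous_on \<Delta> Q"
    unfolding Q_def z_def by (intro continuous_intros coord)
  obtain y where y: "y \<in> \<Delta>" "\<And>x. x \<in> \<Delta> \<Longrightarrow> Q y \<le> Q x"
    using continuous_attains_inf[OF comp ne_\<Delta> cont] by blast
  have y01: "0 \<le> y s" "y s \<le> 1" for s using y(1) by (auto simp: \<Delta>_def PiE_iff)
  have y_sum: "(\<Sum>s\<in>S. y s) = 1" using y(1) by (simp add: \<Delta>_def)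
  show ?thesis
  proof (cases "\<forall>s\<in>S. z y s = 0")
    case True
    then show ?thesis using kernel[of y] y01 y_sum by (simp add: z_def)
  next
    case False
    have Q_pos: "Q y > 0"
      using False fin unfolding Q_def by (metis (no_types, lifting) less_eq_real_def sum_nonneg sum_nonneg_eq_0_iff zero_eq_power2 zero_le_power2)
    have "Q y \<le> (\<Sum>t\<in>S. z y t * A t s)" if s: "s \<in> S" for s
    proof -
      define G where "G = (\<Sum>t\<in>S. z y t * (A s t - z y t))"
      define D where "D = (\<Sum>t\<in>S. (A s t - z y t)\<^sup>2)"
      \<comment> \<open>Moving \<open>y\<close> towards the vertex at \<open>s\<close> by the
        fraction \<open>c\<close> changes \<open>Q\<close> by \<open>c * (2 * G + c * D)\<close>,
        which cannot be negative at a minimum.\<close>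
      have ge: "0 \<le> 2 * G + c * D" if c: "0 < c" "c \<le> 1" for c
      proof -
        define y' where "y' t = (1 - c) * y t + c * (if t = s then 1 else 0)" for t
        have "0 \<le> y' t" "y' t \<le> 1" for t
        proof -
          show "0 \<le> y' t" using c y01[of t] by (simp add: y'_def)
          have "(1 - c) * y t \<le> (1 - c) * 1" using c y01[of t] by (intro mult_left_mono) auto
          moreover have "c * (if t = s then 1 else 0) \<le> c * 1" using c by (intro mult_left_mono) auto
          ultimately have "y' t \<le> (1 - c) * 1 + c * 1" unfolding y'_def by (rule add_mono)
          then show "y' t \<le> 1" by simp
        qed
        moreover have "(\<Sum>t\<in>S. y' t) = 1"
          using fin s y_sum by (simp add: y'_def sum.distrib sum_distrib_left[symmetric])
        ultimately have "y' \<in> \<Delta>" by (auto simp: \<Delta>_def)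
        then have "Q y \<le> Q y'" by (rule y(2))
        moreover have zy': "z y' t = z y t + c * (A s t - z y t)" for t
        proof -
          have "z y' t = (1 - c) * z y t + c * (\<Sum>r\<in>S. (if r = s then 1 else 0) * A r t)"
            unfolding z_def y'_def by (simp add: sum_distrib_left sum.distrib distrib_right mult.assoc)
          also have "(\<Sum>r\<in>S. (if r = s then 1 else 0) * A r t) = A s t"
            using fin s by (simp add: if_distrib[of "\<lambda>x. x * _"] cong: if_cong)
          finally show ?thesis by (simp add: algebra_simps)
        qed
        have "Q y' = (\<Sum>t\<in>S. (z y t)\<^sup>2 + (2 * c) * (z y t * (A s t - z y t)) + c\<^sup>2 * (A s t - z y t)\<^sup>2)"
          unfolding Q_def zy' by (intro sum.cong) (simp_all add: power2_eq_square algebra_simps)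
        then have "Q y' = Q y + (2 * c) * G + c\<^sup>2 * D"
          by (simp only: Q_def G_def D_def sum.distrib sum_distrib_left)
        then have "Q y' = Q y + c * (2 * G + c * D)"
          by (simp add: algebra_simps power2_eq_square)
        ultimately have "0 \<le> c * (2 * G + c * D)" by simp
        then show ?thesis using c by (simp add: zero_le_mult_iff)
      qed
      have "G \<ge> 0"
      proof (rule ccontr)
        assume "\<not> G \<ge> 0"
        then have G: "G < 0" by simp
        then have D: "D > 0" using ge[of 1] by simp
        \<comment> \<open>Small enough that the quadratic term cannot compensate:
          \<open>2 * G + c * D\<close> is then at most \<open>G\<close>.\<close>
        define c where "c = min 1 (- G / D)"
        have "0 < c" "c \<le> 1" using divide_neg_pos[OF G D] by (auto simp: c_def)
        moreover have "c * D \<le> - G"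
        proof -
          have "c * D \<le> (- G / D) * D" using D by (intro mult_right_mono) (auto simp: c_def)
          then show ?thesis using D by simp
        qed
        ultimately show False using ge[of c] G by linarith
      qed
      moreover have "G = (\<Sum>t\<in>S. z y t * A t s) - Q y"
        unfolding G_def Q_def using sym s by (simp add: algebra_simps sum_subtractf power2_eq_square)
      ultimately show ?thesis by simp
    qed
    then have "(\<Sum>t\<in>S. (- z y t) * A t s) < 0" if "s \<in> S" for s
      using that Q_pos by (force simp: sum_negf)
    then show ?thesis using negative[of "\<lambda>t. - z y t"] by blast
  qed
qed

context coxeter_system
begin

text \<open>A Perron-Frobenius argument: off-diagonal coefficients are nonpositive and the graph is
  connected, so the kernel vector is strictly positive. Rescaling by it bounds the form below by an
  expression whose row and column sums vanish, and the vector itself lies in the radical.\<close>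

lemma positive_kernel_imp_affine:
  assumes fin: "finite S" and irr: "irreducible_coxeter W S"
    and y: "\<And>s. s \<in> S \<Longrightarrow> 0 \<le> y s" "(\<Sum>s\<in>S. y s) = 1"
    and ker: "\<And>s. s \<in> S \<Longrightarrow> (\<Sum>t\<in>S. y t * tits_coeff W t s) = 0"
  shows "affine_coxeter W S"
proof -
  \<comment> \<open>At a zero coordinate the kernel equation is a sum of nonpositive terms, so all
    of them vanish; an edge from the support of \<open>y\<close> to its complement contradicts
    this.\<close>
  have pos: "y s > 0" if s: "s \<in> S" for s
  proof (rule ccontr)
    assume "\<not> y s > 0"
    let ?T = "{s \<in> S. y s > 0}"
    have "?T \<subset> S" using s \<open>\<not> y s > 0\<close> by auto
    moreover have "?T \<noteq> {}"
    proof
      assume "?T = {}"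
      then have "y t = 0" if "t \<in> S" for t using y(1) that by fastforce
      then show False using y(2) by simp
    qed
    ultimately obtain p t where pt: "p \<in> ?T" "t \<in> S - ?T" "coxeter_label W p t \<noteq> 2"
      using irr unfolding irreducible_coxeter_def by meson
    have yt: "y t = 0" using pt y(1)[of t] by auto
    have "(\<Sum>r\<in>S. - (y r * tits_coeff W r t)) = 0" using ker[of t] pt by (simp add: sum_negf)
    moreover have "0 \<le> - (y r * tits_coeff W r t)" if "r \<in> S" for r
      using coeff_bounds(2)[of r t] y(1)[OF that] yt that pt by (cases "r = t") (auto simp: mult_nonneg_nonpos)
    ultimately have "- (y p * tits_coeff W p t) = 0"
      using pt fin by (subst (asm) sum_nonneg_eq_0_iff) auto
    moreover have "tits_coeff W p t < 0" using pt by (intro coeff_neg) auto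
    ultimately show False using pt by auto
  qed
  have psd: "tits_form W S v v \<ge> 0" for v
  proof -
    define a where "a s = v s / y s" for s
    let ?c = "tits_coeff W"
    have va: "v s = y s * a s" if "s \<in> S" for s using pos[OF that] by (simp add: a_def)
    have "(\<Sum>s\<in>S. \<Sum>t\<in>S. (y s * y t * ?c s t) * ((a s)\<^sup>2 / 2 + (a t)\<^sup>2 / 2)) \<le> tits_form W S v v"
      unfolding tits_form_def
    proof (intro sum_mono)
      fix s t assume st: "s \<in> S" "t \<in> S"
      show "(y s * y t * ?c s t) * ((a s)\<^sup>2 / 2 + (a t)\<^sup>2 / 2) \<le> v s * v t * ?c s t"
      proof (cases "s = t")
        case True
        then show ?thesis using va st by (simp add: power2_eq_square)
      next
        case False
        have "y s * y t * ?c s t \<le> 0"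
          using coeff_bounds(2)[OF st False] pos st by (intro mult_nonneg_nonpos mult_nonneg_nonneg) (auto intro: less_imp_le)
        moreover have "a s * a t \<le> (a s)\<^sup>2 / 2 + (a t)\<^sup>2 / 2"
          using zero_le_power2[of "a s - a t"] by (simp add: power2_diff)
        ultimately have "(y s * y t * ?c s t) * ((a s)\<^sup>2 / 2 + (a t)\<^sup>2 / 2) \<le> (y s * y t * ?c s t) * (a s * a t)"
          by (intro mult_left_mono_neg)
        then show ?thesis using va st by (simp add: mult_ac)
      qed
    qed
    moreover have "(\<Sum>s\<in>S. \<Sum>t\<in>S. (y s * y t * ?c s t) * ((a s)\<^sup>2 / 2 + (a t)\<^sup>2 / 2)) = 0"
    proof -
      have ker': "(\<Sum>t\<in>S. y t * ?c s t) = 0" if "s \<in> S" for s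
        using ker[OF that] coeff_commute that by (simp cong: sum.cong)
      have 1: "(\<Sum>s\<in>S. \<Sum>t\<in>S. (y s * y t * ?c s t) * ((a s)\<^sup>2 / 2)) = 0"
      proof (rule sum.neutral, rule ballI)
        fix s assume s: "s \<in> S"
        have "(\<Sum>t\<in>S. (y s * y t * ?c s t) * ((a s)\<^sup>2 / 2)) = (y s * (a s)\<^sup>2 / 2) * (\<Sum>t\<in>S. y t * ?c s t)"
          by (simp add: sum_distrib_left mult_ac)
        then show "(\<Sum>t\<in>S. (y s * y t * ?c s t) * ((a s)\<^sup>2 / 2)) = 0" using ker'[OF s] by simp
      qed
      have 2: "(\<Sum>t\<in>S. \<Sum>s\<in>S. (y s * y t * ?c s t) * ((a t)\<^sup>2 / 2)) = 0"
      proof (rule sum.neutral, rule ballI)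
        fix t assume t: "t \<in> S"
        have "(\<Sum>s\<in>S. (y s * y t * ?c s t) * ((a t)\<^sup>2 / 2)) = (y t * (a t)\<^sup>2 / 2) * (\<Sum>s\<in>S. y s * ?c s t)"
          by (simp add: sum_distrib_left mult_ac)
        then show "(\<Sum>s\<in>S. (y s * y t * ?c s t) * ((a t)\<^sup>2 / 2)) = 0" using ker[OF t] by simp
      qed
      have "(\<Sum>s\<in>S. \<Sum>t\<in>S. (y s * y t * ?c s t) * ((a t)\<^sup>2 / 2)) = 0"
        using 2 by (subst sum.swap)
      then show ?thesis using 1 by (simp add: distrib_left sum.distrib)
    qed
    ultimately show ?thesis by simp
  qed
  define y0 where "y0 s = (if s \<in> S then y s else 0)" for s
  have "tits_form W S y0 w = 0" for w
  proof -
    have "tits_form W S y0 w = (\<Sum>t\<in>S. \<Sum>s\<in>S. y s * w t * tits_coeff W s t)"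
      unfolding tits_form_def by (subst sum.swap) (simp add: y0_def)
    also have "\<dots> = (\<Sum>t\<in>S. w t * (\<Sum>s\<in>S. y s * tits_coeff W s t))"
      by (simp add: sum_distrib_left mult_ac)
    finally show ?thesis using ker by simp
  qed
  then have y0: "y0 \<in> tits_radical W S" by (simp add: tits_radical_def tits_space_def y0_def)
  obtain b where b: "b \<subseteq> tits_radical W S" "fun_space.independent b" "tits_radical W S \<subseteq> fun_space.span b"
    "card b = fun_space.dim (tits_radical W S)"
    using fun_space.basis_exists by blast
  have "b \<noteq> {}"
  proof
    assume "b = {}"
    then have "y0 = 0" using b(3) y0 by auto
    then have "y s = 0" if "s \<in> S" for s using that by (metis y0_def zero_fun_apply)
    then show False using y(2) by simp
  qed
  \<comment> \<open>The dimension is the cardinality of a basis, which is 0 for infinite sets, so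
    finiteness of \<open>b\<close> must be established.\<close>
  let ?e = "\<lambda>s t. if t = s then 1 else (0::real)"
  have "tits_space S \<subseteq> fun_space.span (?e ` S)"
  proof
    fix w assume w: "w \<in> tits_space S"
    have eq: "w = (\<Sum>s\<in>S. (\<lambda>t. w s * ?e s t))"
    proof
      fix t
      have "(\<Sum>s\<in>I. (\<lambda>t. w s * ?e s t)) t = (\<Sum>s\<in>I. w s * ?e s t)" for I
        by (induction I rule: infinite_finite_induct) auto
      then have "(\<Sum>s\<in>S. (\<lambda>t. w s * ?e s t)) t = (\<Sum>s\<in>S. w s * ?e s t)" .
      also have "\<dots> = w t"
        using w fin by (auto simp: tits_space_def if_distrib[of "\<lambda>x. _ * x"] cong: if_cong)
      finally show "w t = (\<Sum>s\<in>S. (\<lambda>t. w s * ?e s t)) t" ..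
    qed
    have "(\<Sum>s\<in>S. (\<lambda>t. w s * ?e s t)) \<in> fun_space.span (?e ` S)"
    proof (rule fun_space.span_sum)
      fix s assume "s \<in> S"
      then have "?e s \<in> ?e ` S" by blast
      from fun_space.span_scale[OF fun_space.span_base[OF this], of "w s"]
      show "(\<lambda>t. w s * ?e s t) \<in> fun_space.span (?e ` S)" .
    qed
    then show "w \<in> fun_space.span (?e ` S)" by (subst eq)
  qed
  then have "b \<subseteq> fun_space.span (?e ` S)" using b(1) by (auto simp: tits_radical_def)
  then have "finite b" using fun_space.independent_span_bound[of "?e ` S" b] fin b(2) by blast
  then have "card b \<ge> 1" using \<open>b \<noteq> {}\<close> by (simp add: Suc_leI card_gt_0_iff)
  then show ?thesis using psd b(4) by (simp add: affine_coxeter_def)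
qed

theorem displaced_half_space:
  assumes fin: "finite S" and irr: "irreducible_coxeter W S" and inf: "infinite (carrier W)"
    and na: "\<not> affine_coxeter W S" and F: "finite F" "F \<subseteq> carrier W - {\<one>}"
  shows "\<exists>C r. C \<subseteq> carrier W \<and> r \<in> carrier W \<and> (\<forall>f\<in>F. \<forall>c\<in>C. f \<otimes> c \<notin> C) \<and>
    (\<forall>g\<in>carrier W. g \<in> C \<longleftrightarrow> r \<otimes> g \<notin> C)"
proof -
  have "S \<noteq> {}" using irr by (simp add: irreducible_coxeter_def)
  obtain v0 where v0: "\<And>s. s \<in> S \<Longrightarrow> (\<Sum>t\<in>S. v0 t * tits_coeff W t s) < 0"
  proof (rule gordan_symmetric[OF fin \<open>S \<noteq> {}\<close> coeff_commute])
    fix y assume "\<And>s. s \<in> S \<Longrightarrow> 0 \<le> y s" "(\<Sum>s\<in>S. y s) = 1" "\<And>s. s \<in> S \<Longrightarrow> (\<Sum>t\<in>S. y t * tits_coeff W t s) = 0"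
    then have "affine_coxeter W S" by (rule positive_kernel_imp_affine[OF fin irr])
    then show thesis using na by contradiction
  qed (blast intro: that)+
  define \<alpha> where "\<alpha> s = (\<lambda>t. if t = s then 1 else (0::real))" for s :: 'a
  \<comment> \<open>Cut off outside \<open>S\<close>, so that \<open>v\<close> lies in the span of
    the simple roots.\<close>
  define v where "v s = (if s \<in> S then v0 s else 0)" for s
  have form_simple: "tits_form W S y (\<alpha> s) = (\<Sum>t\<in>S. y t * tits_coeff W t s)" if "s \<in> S" for y s
    using fin that by (simp add: tits_form_def \<alpha>_def if_distrib[of "\<lambda>x. _ * x"] if_distrib[of "\<lambda>x. x * _"] cong: if_cong)
  have form_commute: "tits_form W S y z = tits_form W S z y" for y z
    unfolding tits_form_def by (subst sum.swap) (intro sum.cong, auto simp: coeff_commute)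
  have "coxeter_geometry W S (tits_form W S) \<alpha> (\<lambda>s y. y s)"
  proof (unfold_locales)
    fix s t assume st: "s \<in> S" "t \<in> S"
    show "tits_form W S (\<alpha> s) (\<alpha> t) = tits_coeff W s t"
      unfolding form_simple[OF st(2)] using fin st
      by (simp add: \<alpha>_def if_distrib[of "\<lambda>x. x * _"] cong: if_cong)
    show "\<alpha> t s = (if s = t then 1 else 0)" by (simp add: \<alpha>_def)
  next
    fix y z w :: "'a \<Rightarrow> real" and c :: real
    show "tits_form W S (y + z) w = tits_form W S y w + tits_form W S z w"
      by (simp add: tits_form_def algebra_simps sum.distrib)
    show "tits_form W S (c *\<^sub>R y) z = c * tits_form W S y z"
      by (simp add: tits_form_def sum_distrib_left mult.assoc)
  qed (use fin form_commute in auto)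
  then interpret G: coxeter_geometry W S "tits_form W S" \<alpha> "\<lambda>s y. y s" .
  interpret coxeter_chamber W S "tits_form W S" \<alpha> "\<lambda>s y. y s" v
  proof unfold_locales
    fix s assume "s \<in> S"
    then show "tits_form W S v (\<alpha> s) < 0"
      using v0 by (simp add: form_simple v_def)
  next
    show "v = (\<Sum>s\<in>S. v s *\<^sub>R \<alpha> s)"
    proof
      fix t
      have "(\<Sum>s\<in>I. v s *\<^sub>R \<alpha> s) t = (\<Sum>s\<in>I. v s * \<alpha> s t)" for I
        by (induction I rule: infinite_finite_induct) auto
      then have "(\<Sum>s\<in>S. v s *\<^sub>R \<alpha> s) t = (\<Sum>s\<in>S. v s * \<alpha> s t)" .
      also have "\<dots> = v t"
        using fin by (auto simp: \<alpha>_def v_def if_distrib[of "\<lambda>x. _ * x"] cong: if_cong)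
      finally show "v t = (\<Sum>s\<in>S. v s *\<^sub>R \<alpha> s) t" ..
    qed
  qed (use inf irr in auto)
  show ?thesis by (rule exists_displaced_half_space[OF F])
qed

end

section \<open>Powers averaging\<close>

lemma infsum_Cauchy_Schwarz:
  fixes a b :: "'x \<Rightarrow> real"
  assumes a: "(\<lambda>x. (a x)\<^sup>2) summable_on A" and b: "(\<lambda>x. (b x)\<^sup>2) summable_on A"
    and nonneg: "\<And>x. x \<in> A \<Longrightarrow> 0 \<le> a x" "\<And>x. x \<in> A \<Longrightarrow> 0 \<le> b x"
  shows "(\<lambda>x. a x * b x) summable_on A"
    "(\<Sum>\<^sub>\<infinity>x\<in>A. a x * b x) \<le> sqrt (\<Sum>\<^sub>\<infinity>x\<in>A. (a x)\<^sup>2) * sqrt (\<Sum>\<^sub>\<infinity>x\<in>A. (b x)\<^sup>2)"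
proof -
  have fin: "(\<Sum>x\<in>F. a x * b x) \<le> sqrt (\<Sum>\<^sub>\<infinity>x\<in>A. (a x)\<^sup>2) * sqrt (\<Sum>\<^sub>\<infinity>x\<in>A. (b x)\<^sup>2)"
    if F: "finite F" "F \<subseteq> A" for F
  proof -
    have "(\<Sum>x\<in>F. a x * b x) \<le> (\<Sum>x\<in>F. \<bar>a x\<bar> * \<bar>b x\<bar>)"
      by (intro sum_mono) (metis abs_ge_self abs_mult)
    also have "\<dots> \<le> L2_set a F * L2_set b F" by (rule L2_set_mult_ineq)
    also have "\<dots> \<le> sqrt (\<Sum>\<^sub>\<infinity>x\<in>A. (a x)\<^sup>2) * sqrt (\<Sum>\<^sub>\<infinity>x\<in>A. (b x)\<^sup>2)"
      unfolding L2_set_def using F a b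
      by (intro mult_mono real_sqrt_le_mono finite_sum_le_infsum) (auto intro: sum_nonneg infsum_nonneg)
    finally show ?thesis .
  qed
  show summable: "(\<lambda>x. a x * b x) summable_on A"
    using fin nonneg by (intro nonneg_bdd_above_summable_on bdd_aboveI2) auto
  show "(\<Sum>\<^sub>\<infinity>x\<in>A. a x * b x) \<le> sqrt (\<Sum>\<^sub>\<infinity>x\<in>A. (a x)\<^sup>2) * sqrt (\<Sum>\<^sub>\<infinity>x\<in>A. (b x)\<^sup>2)"
    using summable fin by (rule infsum_le_finite_sums)
qed

lemma sum_sqrt_le:
  fixes f :: "'i \<Rightarrow> real"
  assumes "\<And>i. i \<in> I \<Longrightarrow> 0 \<le> f i"
  shows "(\<Sum>i\<in>I. sqrt (f i)) \<le> sqrt (real (card I)) * sqrt (\<Sum>i\<in>I. f i)"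
proof -
  have "(\<Sum>i\<in>I. \<bar>1\<bar> * \<bar>sqrt (f i)\<bar>) \<le> L2_set (\<lambda>_. 1) I * L2_set (\<lambda>i. sqrt (f i)) I"
    by (rule L2_set_mult_ineq)
  then show ?thesis using assms by (simp add: L2_set_def)
qed

context group
begin

section \<open>Correlations of square-summable functions\<close>

definition mass :: "('a \<Rightarrow> complex) \<Rightarrow> 'a set \<Rightarrow> real"
  where "mass \<eta> A = (\<Sum>\<^sub>\<infinity>x\<in>A. (cmod (\<eta> x))\<^sup>2)"

lemma ell2_summable:
  "\<eta> \<in> ell2_carrier G \<Longrightarrow> A \<subseteq> carrier G \<Longrightarrow> (\<lambda>x. (cmod (\<eta> x))\<^sup>2) summable_on A"
  unfolding ell2_carrier_def by (auto intro: summable_on_subset_banach)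

lemma mass_nonneg: "0 \<le> mass \<eta> A"
  by (simp add: mass_def infsum_nonneg)

lemma mass_mono: "\<eta> \<in> ell2_carrier G \<Longrightarrow> A \<subseteq> D \<Longrightarrow> D \<subseteq> carrier G \<Longrightarrow> mass \<eta> A \<le> mass \<eta> D"
  unfolding mass_def by (intro infsum_mono_neutral) (auto intro: ell2_summable)

lemma mass_disjoint:
  assumes \<eta>: "\<eta> \<in> ell2_carrier G" and fin: "finite I" and D: "\<And>i. i \<in> I \<Longrightarrow> D i \<subseteq> carrier G"
    and disj: "\<And>i j. i \<in> I \<Longrightarrow> j \<in> I \<Longrightarrow> i \<noteq> j \<Longrightarrow> D i \<inter> D j = {}"
  shows "(\<Sum>i\<in>I. mass \<eta> (D i)) = mass \<eta> (\<Union>i\<in>I. D i)"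
  using fin D disj
proof (induction rule: finite_induct)
  case (insert i I)
  have "mass \<eta> (D i \<union> (\<Union>i\<in>I. D i)) = mass \<eta> (D i) + mass \<eta> (\<Union>i\<in>I. D i)"
    unfolding mass_def using insert.prems insert.hyps
    by (intro infsum_Un_disjoint ell2_summable[OF \<eta>]) (blast | force)+
  then show ?case using insert by simp
qed (simp add: mass_def)

lemma inj_on_translate: "g \<in> carrier G \<Longrightarrow> A \<subseteq> carrier G \<Longrightarrow> inj_on (\<lambda>x. g \<otimes> x) A"
  by (rule inj_onI) (auto simp: subset_iff)

lemma correlation_bound:
  assumes \<eta>: "\<eta> \<in> ell2_carrier G" and g: "g \<in> carrier G" and A: "A \<subseteq> carrier G"
  shows "(\<lambda>x. cnj (\<eta> x) * \<eta> (inv g \<otimes> x)) summable_on A"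
    "cmod (\<Sum>\<^sub>\<infinity>x\<in>A. cnj (\<eta> x) * \<eta> (inv g \<otimes> x)) \<le> sqrt (mass \<eta> A) * sqrt (mass \<eta> ((\<lambda>x. inv g \<otimes> x) ` A))"
proof -
  let ?h = "\<lambda>x. inv g \<otimes> x"
  have inj: "inj_on ?h A" using g A by (intro inj_on_translate) auto
  have hA: "?h ` A \<subseteq> carrier G" using g A by auto
  have sum_h: "(\<lambda>x. (cmod (\<eta> (?h x)))\<^sup>2) summable_on A"
    using ell2_summable[OF \<eta> hA] summable_on_reindex[OF inj, of "\<lambda>x. (cmod (\<eta> x))\<^sup>2"] by (simp add: o_def)
  have mass_h: "(\<Sum>\<^sub>\<infinity>x\<in>A. (cmod (\<eta> (?h x)))\<^sup>2) = mass \<eta> (?h ` A)"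
    using infsum_reindex[OF inj, of "\<lambda>x. (cmod (\<eta> x))\<^sup>2"] by (simp add: mass_def o_def)
  note CS = infsum_Cauchy_Schwarz[OF ell2_summable[OF \<eta> A] sum_h]
  have abs: "(\<lambda>x. norm (cnj (\<eta> x) * \<eta> (?h x))) summable_on A"
    using CS(1) by (simp add: norm_mult)
  then show "(\<lambda>x. cnj (\<eta> x) * \<eta> (?h x)) summable_on A" by (rule abs_summable_summable)
  have "cmod (\<Sum>\<^sub>\<infinity>x\<in>A. cnj (\<eta> x) * \<eta> (?h x)) \<le> (\<Sum>\<^sub>\<infinity>x\<in>A. cmod (\<eta> x) * cmod (\<eta> (?h x)))"
    using norm_infsum_bound[OF abs] by (simp add: norm_mult)
  also have "\<dots> \<le> sqrt (mass \<eta> A) * sqrt (mass \<eta> (?h ` A))"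
    using CS(2) unfolding mass_h by (simp add: mass_def)
  finally show "cmod (\<Sum>\<^sub>\<infinity>x\<in>A. cnj (\<eta> x) * \<eta> (?h x)) \<le> sqrt (mass \<eta> A) * sqrt (mass \<eta> (?h ` A))" .
qed

lemma diag_coeff_regular:
  assumes "\<eta> \<in> ell2_carrier G"
  shows "diag_coeff (ell2 G) (left_regular G) \<eta> g = (\<Sum>\<^sub>\<infinity>x\<in>carrier G. cnj (\<eta> x) * \<eta> (inv g \<otimes> x))"
  using assms unfolding diag_coeff_def ell2_def left_regular_def by (auto intro!: infsum_cong)

lemma diag_coeff_regular_one:
  assumes "\<eta> \<in> ell2_carrier G"
  shows "diag_coeff (ell2 G) (left_regular G) \<eta> \<one> = of_real (mass \<eta> (carrier G))"
proof -
  have "diag_coeff (ell2 G) (left_regular G) \<eta> \<one> = (\<Sum>\<^sub>\<infinity>x\<in>carrier G. of_real ((cmod (\<eta> x))\<^sup>2))"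
    unfolding diag_coeff_regular[OF assms]
    by (intro infsum_cong) (simp only: inv_one l_one complex_norm_square mult.commute)
  also have "\<dots> = of_real (mass \<eta> (carrier G))"
    unfolding mass_def using has_sum_infsum[OF ell2_summable[OF assms, of "carrier G"]]
    by (intro infsumI) (simp only: has_sum_of_real_iff subset_refl)
  finally show ?thesis .
qed

text \<open>On \<open>A \<inter> D\<close> the first factor is supported in \<open>D\<close>, and on
  \<open>A - D\<close> the translated one is; Cauchy-Schwarz bounds each part by the mass of
  \<open>D\<close>.\<close>

lemma split_correlation_bound:
  assumes \<eta>: "\<eta> \<in> ell2_carrier G" and g: "g \<in> carrier G" and D: "D \<subseteq> carrier G" and A: "A \<subseteq> carrier G"
    and split: "\<And>x. x \<in> A \<Longrightarrow> x \<notin> D \<Longrightarrow> inv g \<otimes> x \<in> D"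
  shows "cmod (\<Sum>\<^sub>\<infinity>x\<in>A. cnj (\<eta> x) * \<eta> (inv g \<otimes> x)) \<le> 2 * (sqrt (mass \<eta> D) * sqrt (mass \<eta> (carrier G)))"
proof -
  let ?f = "\<lambda>x. cnj (\<eta> x) * \<eta> (inv g \<otimes> x)" and ?N = "mass \<eta> (carrier G)"
  have sub: "A \<inter> D \<subseteq> carrier G" "A - D \<subseteq> carrier G" "(\<lambda>x. inv g \<otimes> x) ` (A \<inter> D) \<subseteq> carrier G"
    "(\<lambda>x. inv g \<otimes> x) ` (A - D) \<subseteq> D"
    using A g split by auto
  have "(\<Sum>\<^sub>\<infinity>x\<in>(A \<inter> D) \<union> (A - D). ?f x) = (\<Sum>\<^sub>\<infinity>x\<in>A \<inter> D. ?f x) + (\<Sum>\<^sub>\<infinity>x\<in>A - D. ?f x)"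
    using correlation_bound(1)[OF \<eta> g] sub by (intro infsum_Un_disjoint) auto
  moreover have "(A \<inter> D) \<union> (A - D) = A" by blast
  ultimately have "cmod (\<Sum>\<^sub>\<infinity>x\<in>A. ?f x) \<le> cmod (\<Sum>\<^sub>\<infinity>x\<in>A \<inter> D. ?f x) + cmod (\<Sum>\<^sub>\<infinity>x\<in>A - D. ?f x)"
    by (simp add: norm_triangle_ineq)
  also have "cmod (\<Sum>\<^sub>\<infinity>x\<in>A \<inter> D. ?f x) \<le> sqrt (mass \<eta> D) * sqrt ?N"
    using sub D mass_nonneg
    by (intro order_trans[OF correlation_bound(2)[OF \<eta> g]] mult_mono real_sqrt_le_mono mass_mono[OF \<eta>]) auto
  also have "cmod (\<Sum>\<^sub>\<infinity>x\<in>A - D. ?f x) \<le> sqrt ?N * sqrt (mass \<eta> D)"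
    using sub D mass_nonneg
    by (intro order_trans[OF correlation_bound(2)[OF \<eta> g]] mult_mono real_sqrt_le_mono mass_mono[OF \<eta>]) auto
  finally show ?thesis by (simp add: mult.commute)
qed

text \<open>This is Powers' estimate: the average of the \<open>\<gamma> i\<close> has norm at most \<open>2 / sqrt n\<close> in the regular
  representation.\<close>

lemma powers_estimate:
  assumes \<eta>: "\<eta> \<in> ell2_carrier G" and fin: "finite I" and \<gamma>: "\<And>i. i \<in> I \<Longrightarrow> \<gamma> i \<in> carrier G"
    and D: "\<And>i. i \<in> I \<Longrightarrow> D i \<subseteq> carrier G"
    and disj: "\<And>i j. i \<in> I \<Longrightarrow> j \<in> I \<Longrightarrow> i \<noteq> j \<Longrightarrow> D i \<inter> D j = {}"
    and map: "\<And>i x. i \<in> I \<Longrightarrow> x \<in> carrier G \<Longrightarrow> x \<notin> D i \<Longrightarrow> inv (\<gamma> i) \<otimes> x \<in> D i"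
  shows "(\<Sum>i\<in>I. cmod (diag_coeff (ell2 G) (left_regular G) \<eta> (\<gamma> i))) \<le> 2 * sqrt (real (card I)) * mass \<eta> (carrier G)"
proof -
  let ?N = "mass \<eta> (carrier G)"
  have "(\<Sum>i\<in>I. cmod (diag_coeff (ell2 G) (left_regular G) \<eta> (\<gamma> i))) \<le> (\<Sum>i\<in>I. 2 * (sqrt (mass \<eta> (D i)) * sqrt ?N))"
    unfolding diag_coeff_regular[OF \<eta>]
    using \<gamma> D map by (intro sum_mono split_correlation_bound[OF \<eta>]) auto
  also have "\<dots> = 2 * sqrt ?N * (\<Sum>i\<in>I. sqrt (mass \<eta> (D i)))"
    by (simp add: sum_distrib_left mult_ac)
  \<comment> \<open>Cauchy-Schwarz over the indices gains the square root of their number, because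
    the masses on the disjoint sets add up to at most the total mass.\<close>
  also have "\<dots> \<le> 2 * sqrt ?N * (sqrt (real (card I)) * sqrt (\<Sum>i\<in>I. mass \<eta> (D i)))"
    using mass_nonneg by (intro mult_left_mono sum_sqrt_le) auto
  also have "\<dots> \<le> 2 * sqrt ?N * (sqrt (real (card I)) * sqrt ?N)"
  proof -
    have "(\<Sum>i\<in>I. mass \<eta> (D i)) = mass \<eta> (\<Union>i\<in>I. D i)" using \<eta> fin D disj by (rule mass_disjoint)
    also have "\<dots> \<le> ?N" using D by (intro mass_mono[OF \<eta>]) auto
    finally show ?thesis using mass_nonneg by (intro mult_left_mono real_sqrt_le_mono) auto
  qed
  also have "\<dots> = 2 * sqrt (real (card I)) * ?N"
    using mass_nonneg[of \<eta> "carrier G"] by simp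
  finally show ?thesis .
qed

end

context complex_hilbert_space
begin

section \<open>Finite sums and coefficients in a unitary representation\<close>

lemma smult_carrier: "x \<in> carrier H \<Longrightarrow> c \<odot>\<^bsub>H\<^esub> x \<in> carrier H"
  using smult_closed[of c x] by (simp add: complex_ring_def)

lemma hinner_zero_right: "x \<in> carrier H \<Longrightarrow> hinner H x \<zero>\<^bsub>H\<^esub> = 0"
  using hinner_add_right[of x "\<zero>\<^bsub>H\<^esub>" "\<zero>\<^bsub>H\<^esub>"] by simp

lemma hinner_smult_left:
  "x \<in> carrier H \<Longrightarrow> y \<in> carrier H \<Longrightarrow> hinner H (c \<odot>\<^bsub>H\<^esub> x) y = cnj c * hinner H x y"
  using hinner_commute[of y "c \<odot>\<^bsub>H\<^esub> x"] hinner_commute[of y x] hinner_smult_right[of y x c] smult_carrier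
  by simp

lemma hinner_finsum_right:
  assumes "finite A" "x \<in> carrier H" "f \<in> A \<rightarrow> carrier H"
  shows "hinner H x (finsum H f A) = (\<Sum>a\<in>A. hinner H x (f a))"
  using assms
proof (induction rule: finite_induct)
  case empty
  then show ?case using hinner_zero_right by simp
next
  case (insert a A)
  then have "f a \<in> carrier H" "f \<in> A \<rightarrow> carrier H" by auto
  then show ?case using insert by (simp add: M.finsum_insert hinner_add_right M.finsum_closed)
qed

lemma hinner_finsum_left:
  assumes "finite A" "x \<in> carrier H" "f \<in> A \<rightarrow> carrier H"
  shows "hinner H (finsum H f A) x = (\<Sum>a\<in>A. hinner H (f a) x)"
proof -
  have "hinner H (finsum H f A) x = cnj (hinner H x (finsum H f A))"
    using assms by (intro hinner_commute M.finsum_closed)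
  also have "\<dots> = (\<Sum>a\<in>A. cnj (hinner H x (f a)))"
    using assms by (simp add: hinner_finsum_right)
  also have "\<dots> = (\<Sum>a\<in>A. hinner H (f a) x)"
    using assms by (intro sum.cong) (auto intro!: hinner_commute[symmetric])
  finally show ?thesis .
qed

end

locale unitary_representation = group G for G :: "('g, 'm) monoid_scheme" (structure) +
  fixes H :: "('h, 'n) inner_space_scheme" and \<rho> :: "'g \<Rightarrow> 'h \<Rightarrow> 'h"
  assumes rep: "unitary_rep G H \<rho>"
begin

sublocale H: complex_hilbert_space H
  using rep by (simp add: unitary_rep_def)

lemma rep_unitary: "g \<in> carrier G \<Longrightarrow> \<rho> g \<in> unitary_operators H"
  using rep by (auto simp: unitary_rep_def hom_def unitary_group_def)

lemma rep_closed: "g \<in> carrier G \<Longrightarrow> \<xi> \<in> carrier H \<Longrightarrow> \<rho> g \<xi> \<in> carrier H"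
  using rep_unitary[of g] by (auto simp: unitary_operators_def Bij_def bij_betw_def)

lemma rep_inner: "g \<in> carrier G \<Longrightarrow> \<xi> \<in> carrier H \<Longrightarrow> \<zeta> \<in> carrier H \<Longrightarrow> hinner H (\<rho> g \<xi>) (\<rho> g \<zeta>) = hinner H \<xi> \<zeta>"
  using rep_unitary[of g] by (auto simp: unitary_operators_def)

lemma rep_smult: "g \<in> carrier G \<Longrightarrow> \<xi> \<in> carrier H \<Longrightarrow> \<rho> g (c \<odot>\<^bsub>H\<^esub> \<xi>) = c \<odot>\<^bsub>H\<^esub> \<rho> g \<xi>"
  using rep_unitary[of g] by (auto simp: unitary_operators_def)

lemma rep_add: "g \<in> carrier G \<Longrightarrow> \<xi> \<in> carrier H \<Longrightarrow> \<zeta> \<in> carrier H \<Longrightarrow> \<rho> g (\<xi> \<oplus>\<^bsub>H\<^esub> \<zeta>) = \<rho> g \<xi> \<oplus>\<^bsub>H\<^esub> \<rho> g \<zeta>"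
  using rep_unitary[of g] by (auto simp: unitary_operators_def)

lemma rep_mult:
  assumes "g \<in> carrier G" "h \<in> carrier G" "\<xi> \<in> carrier H"
  shows "\<rho> (g \<otimes> h) \<xi> = \<rho> g (\<rho> h \<xi>)"
proof -
  have "\<rho> (g \<otimes> h) = \<rho> g \<otimes>\<^bsub>unitary_group H\<^esub> \<rho> h"
    using rep assms by (auto simp: unitary_rep_def hom_def)
  moreover have "\<rho> g \<in> Bij (carrier H)" "\<rho> h \<in> Bij (carrier H)"
    using rep_unitary assms by (auto simp: unitary_operators_def)
  ultimately show ?thesis
    using assms by (simp add: unitary_group_def BijGroup_def compose_def)
qed

lemma rep_one:
  assumes "\<xi> \<in> carrier H"
  shows "\<rho> \<one> \<xi> = \<xi>"
proof -
  have "\<rho> \<one> (\<rho> \<one> \<xi>) = \<rho> \<one> \<xi>" using rep_mult[of \<one> \<one> \<xi>] assms by simp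
  moreover have "inj_on (\<rho> \<one>) (carrier H)"
    using rep_unitary[of \<one>] by (auto simp: unitary_operators_def Bij_def bij_betw_def)
  ultimately show ?thesis using assms rep_closed[of \<one> \<xi>] by (auto dest: inj_onD)
qed

lemma rep_zero: "g \<in> carrier G \<Longrightarrow> \<rho> g \<zero>\<^bsub>H\<^esub> = \<zero>\<^bsub>H\<^esub>"
  using rep_add[of g "\<zero>\<^bsub>H\<^esub>" "\<zero>\<^bsub>H\<^esub>"] rep_closed[of g "\<zero>\<^bsub>H\<^esub>"] by simp

lemma rep_finsum:
  assumes "finite A" "g \<in> carrier G" "f \<in> A \<rightarrow> carrier H"
  shows "\<rho> g (finsum H f A) = finsum H (\<lambda>a. \<rho> g (f a)) A"
  using assms
proof (induction rule: finite_induct)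
  case empty
  then show ?case using rep_zero by simp
next
  case (insert a A)
  then have "f a \<in> carrier H" "f \<in> A \<rightarrow> carrier H" "(\<lambda>a. \<rho> g (f a)) \<in> A \<rightarrow> carrier H" "\<rho> g (f a) \<in> carrier H"
    using rep_closed by auto
  then show ?case using insert by (simp add: H.M.finsum_insert rep_add H.M.finsum_closed)
qed

lemma rep_inner_shift:
  assumes "g \<in> carrier G" "h \<in> carrier G" "\<xi> \<in> carrier H"
  shows "hinner H (\<rho> g \<xi>) (\<rho> h \<xi>) = diag_coeff H \<rho> \<xi> (inv g \<otimes> h)"
proof -
  have "hinner H (\<rho> g \<xi>) (\<rho> (g \<otimes> (inv g \<otimes> h)) \<xi>) = hinner H \<xi> (\<rho> (inv g \<otimes> h) \<xi>)"
    using assms rep_closed by (simp add: rep_mult[of g "inv g \<otimes> h"] rep_inner)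
  moreover have "g \<otimes> (inv g \<otimes> h) = h" using assms by (simp add: m_assoc[symmetric])
  ultimately show ?thesis by (simp add: diag_coeff_def)
qed

lemma unit_vector:
  obtains \<xi> where "\<xi> \<in> carrier H" "hinner H \<xi> \<xi> = 1"
proof -
  have "carrier H \<noteq> {\<zero>\<^bsub>H\<^esub>}" using rep by (simp add: unitary_rep_def)
  then obtain \<xi> where \<xi>: "\<xi> \<in> carrier H" "\<xi> \<noteq> \<zero>\<^bsub>H\<^esub>" by blast
  define c where "c = Re (hinner H \<xi> \<xi>)"
  have c: "c > 0" using H.hinner_pos[OF \<xi>] by (simp add: c_def)
  have inner: "hinner H \<xi> \<xi> = of_real c"
    using H.hinner_commute[OF \<xi>(1) \<xi>(1)] by (simp add: c_def complex_eq_iff)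
  let ?a = "of_real (1 / sqrt c) :: complex"
  have "hinner H (?a \<odot>\<^bsub>H\<^esub> \<xi>) (?a \<odot>\<^bsub>H\<^esub> \<xi>) = ?a * ?a * of_real c"
    using \<xi>(1) H.smult_carrier by (simp add: H.hinner_smult_left H.hinner_smult_right inner)
  also have "\<dots> = of_real (1 / sqrt c * (1 / sqrt c) * c)" by (simp only: of_real_mult)
  also have "1 / sqrt c * (1 / sqrt c) * c = 1" using c by (simp add: field_simps)
  finally show ?thesis using that[of "?a \<odot>\<^bsub>H\<^esub> \<xi>"] \<xi> H.smult_carrier by simp
qed

end

text \<open>This isolates what the averaging needs from the geometry. The element \<open>r\<close>
  moves estimates from \<open>C\<close> to its complement: conjugated by \<open>r\<close>, the
  elements of \<open>F\<close> map the complement of \<open>C\<close> into \<open>C\<close>.\<close>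

definition (in group) has_displaced_sets :: bool
  where "has_displaced_sets \<longleftrightarrow> (\<forall>F. finite F \<longrightarrow> F \<subseteq> carrier G - {\<one>} \<longrightarrow>
    (\<exists>C r. C \<subseteq> carrier G \<and> r \<in> carrier G \<and> (\<forall>f\<in>F. \<forall>c\<in>C. f \<otimes> c \<notin> C) \<and>
      (\<forall>g\<in>carrier G. g \<in> C \<longleftrightarrow> r \<otimes> g \<notin> C)))"

context group
begin

text \<open>The sets \<open>D i\<close> are translates \<open>g i C\<close> of one displaced set,
  and conjugation by \<open>g i \<otimes> r\<close> carries the displacement by \<open>F\<close>
  over to each of them.\<close>

lemma powers_conjugators:
  assumes disp: "has_displaced_sets" and inf: "infinite (carrier G)"
    and F: "finite F" "F \<subseteq> carrier G - {\<one>}"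
  obtains h D where "\<And>i. i < n \<Longrightarrow> h i \<in> carrier G" "\<And>i. i < n \<Longrightarrow> D i \<subseteq> carrier G"
    "\<And>i j. i < n \<Longrightarrow> j < n \<Longrightarrow> i \<noteq> j \<Longrightarrow> D i \<inter> D j = {}"
    "\<And>i f x. i < (n::nat) \<Longrightarrow> f \<in> F \<Longrightarrow> x \<in> carrier G \<Longrightarrow> x \<notin> D i \<Longrightarrow> inv (h i \<otimes> f \<otimes> inv (h i)) \<otimes> x \<in> D i"
proof -
  obtain g :: "nat \<Rightarrow> 'a" where g: "inj g" "range g \<subseteq> carrier G"
    using infinite_countable_subset[OF inf] by blast
  have gc: "g i \<in> carrier G" for i using g by auto
  \<comment> \<open>The quotients of the chosen elements are included so that the translates of
    \<open>C\<close> become disjoint.\<close>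
  let ?F' = "F \<union> (\<lambda>(i, j). inv (g i) \<otimes> g j) ` ({(i, j). i < n \<and> j < n \<and> i \<noteq> j})"
  have "finite {(i, j). i < n \<and> j < n \<and> i \<noteq> j}"
    by (rule finite_subset[of _ "{..<n} \<times> {..<n}"]) auto
  then have fin: "finite ?F'" using F by simp
  have "inv (g i) \<otimes> g j \<noteq> \<one>" if "i \<noteq> j" for i j
  proof
    assume "inv (g i) \<otimes> g j = \<one>"
    then have "g i \<otimes> (inv (g i) \<otimes> g j) = g i" using gc by simp
    moreover have "g i \<otimes> (inv (g i) \<otimes> g j) = g j" using gc by (simp add: m_assoc[symmetric])
    ultimately show False using g(1) that by (auto dest: injD)
  qed
  then have "?F' \<subseteq> carrier G - {\<one>}" using F gc by auto
  then obtain C r where C: "C \<subseteq> carrier G" "r \<in> carrier G" "\<And>f c. f \<in> ?F' \<Longrightarrow> c \<in> C \<Longrightarrow> f \<otimes> c \<notin> C"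
    "\<And>x. x \<in> carrier G \<Longrightarrow> x \<in> C \<longleftrightarrow> r \<otimes> x \<notin> C"
    using disp fin unfolding has_displaced_sets_def by meson
  define D where "D i = {x \<in> carrier G. inv (g i) \<otimes> x \<in> C}" for i
  have cancel: "a \<otimes> (inv a \<otimes> z) = z" "inv a \<otimes> (a \<otimes> z) = z" if "a \<in> carrier G" "z \<in> carrier G" for a z
    using that by (simp_all add: m_assoc[symmetric])
  show thesis
  proof (rule that[of "\<lambda>i. g i \<otimes> r" D])
    fix i show "g i \<otimes> r \<in> carrier G" "D i \<subseteq> carrier G" using gc C by (auto simp: D_def)
  next
    fix i j assume ij: "i < n" "j < n" "i \<noteq> j"
    show "D i \<inter> D j = {}"
    proof (rule ccontr)
      assume "D i \<inter> D j \<noteq> {}"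
      then obtain x where x: "x \<in> carrier G" "inv (g i) \<otimes> x \<in> C" "inv (g j) \<otimes> x \<in> C" by (auto simp: D_def)
      have eq: "(inv (g i) \<otimes> g j) \<otimes> (inv (g j) \<otimes> x) = inv (g i) \<otimes> x"
        using gc x by (simp add: m_assoc cancel)
      have "inv (g i) \<otimes> g j \<in> ?F'" using ij by auto
      from C(3)[OF this x(3)] show False unfolding eq using x(2) by contradiction
    qed
  next
    fix i f x assume i: "i < n" and f: "f \<in> F" and x: "x \<in> carrier G" "x \<notin> D i"
    have fc: "f \<in> carrier G" using f F by auto
    define c where "c = inv r \<otimes> (inv (g i) \<otimes> x)"
    have cc: "c \<in> carrier G" using gc x C by (simp add: c_def)
    have "r \<otimes> c = inv (g i) \<otimes> x" unfolding c_def using gc x C by (intro cancel) auto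
    then have "c \<in> C" using x C(4)[OF cc] by (simp add: D_def)
    have "inv f \<otimes> c \<notin> C"
    proof
      assume "inv f \<otimes> c \<in> C"
      then have "f \<otimes> (inv f \<otimes> c) \<notin> C" using C(3) f by simp
      then show False using cancel(1)[OF fc cc] \<open>c \<in> C\<close> by simp
    qed
    then have "r \<otimes> (inv f \<otimes> c) \<in> C" using C(4)[of "inv f \<otimes> c"] fc cc by simp
    moreover have "inv (g i) \<otimes> (inv (g i \<otimes> r \<otimes> f \<otimes> inv (g i \<otimes> r)) \<otimes> x) = r \<otimes> (inv f \<otimes> c)"
      using gc x C fc by (simp add: c_def inv_mult_group m_assoc cancel)
    ultimately show "inv (g i \<otimes> r \<otimes> f \<otimes> inv (g i \<otimes> r)) \<otimes> x \<in> D i"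
      using gc x C fc by (simp add: D_def)
  qed
qed

end

context unitary_representation
begin

text \<open>Averaging a normalised coefficient over the conjugates of its argument keeps the value 1
  at the identity. Elsewhere the averaged coefficient is compared with sums of regular coefficients,
  which Powers' estimate makes small.\<close>

lemma approximate_delta:
  assumes disp: "has_displaced_sets" and inf: "infinite (carrier G)"
    and weak: "weakly_contained G H \<rho> (ell2 G) (left_regular G)"
    and F: "finite F" "F \<subseteq> carrier G" and e: "e > 0"
  shows "\<exists>\<xi>s. set \<xi>s \<subseteq> carrier H \<and>
    (\<forall>g\<in>F. cmod ((\<Sum>\<xi>\<leftarrow>\<xi>s. diag_coeff H \<rho> \<xi> g) - (if g = \<one> then 1 else 0)) < e)"
proof -
  obtain \<xi> where \<xi>: "\<xi> \<in> carrier H" "hinner H \<xi> \<xi> = 1" by (rule unit_vector)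
  \<comment> \<open>The bound 1 keeps the total mass of the approximating vectors below 2, and
    \<open>e / 2\<close> is the share of the approximation error.\<close>
  define d where "d = min 1 (e / 2)"
  have d: "0 < d" "d \<le> 1" "d \<le> e / 2" using e by (auto simp: d_def)
  \<comment> \<open>Powers' bound with mass below 2, divided by \<open>n\<close>, is at most 4
    divided by the square root of \<open>n\<close>, hence below \<open>e / 2\<close>.\<close>
  obtain n :: nat where n: "real n > (8 / e)\<^sup>2" using reals_Archimedean2 by blast
  have n_pos: "real n > 0" using n by (meson le_less_trans zero_le_power2)
  have sqrt_n: "sqrt (real n) > 8 / e"
    using n e by (simp add: real_less_rsqrt)
  obtain h D where hD: "\<And>i. i < n \<Longrightarrow> h i \<in> carrier G" "\<And>i. i < n \<Longrightarrow> D i \<subseteq> carrier G"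
    "\<And>i j. i < n \<Longrightarrow> j < n \<Longrightarrow> i \<noteq> j \<Longrightarrow> D i \<inter> D j = {}"
    "\<And>i f x. i < n \<Longrightarrow> f \<in> F - {\<one>} \<Longrightarrow> x \<in> carrier G \<Longrightarrow> x \<notin> D i \<Longrightarrow> inv (h i \<otimes> f \<otimes> inv (h i)) \<otimes> x \<in> D i"
    using powers_conjugators[OF disp inf, of "F - {\<one>}" n] F by auto
  let ?\<gamma> = "\<lambda>f i. h i \<otimes> f \<otimes> inv (h i)"
  let ?X = "insert \<one> ((\<lambda>(f, i). ?\<gamma> f i) ` (F \<times> {..<n}))"
  have "finite ?X" "?X \<subseteq> carrier G" using F hD by auto
  then obtain \<eta>s where \<eta>s: "set \<eta>s \<subseteq> carrier (ell2 G)"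
    "\<And>g. g \<in> ?X \<Longrightarrow> cmod (diag_coeff H \<rho> \<xi> g - (\<Sum>\<eta>\<leftarrow>\<eta>s. diag_coeff (ell2 G) (left_regular G) \<eta> g)) < d"
    using weak \<xi>(1) d(1) unfolding weakly_contained_def by meson
  let ?\<psi> = "\<lambda>g. \<Sum>\<eta>\<leftarrow>\<eta>s. diag_coeff (ell2 G) (left_regular G) \<eta> g"
  let ?M = "\<Sum>\<eta>\<leftarrow>\<eta>s. mass \<eta> (carrier G)"
  have \<eta>c: "\<eta> \<in> ell2_carrier G" if "\<eta> \<in> set \<eta>s" for \<eta> using \<eta>s(1) that by (auto simp: ell2_def)
  have one: "diag_coeff H \<rho> \<xi> \<one> = 1" using \<xi> by (simp add: diag_coeff_def rep_one)
  have "?\<psi> \<one> = of_real ?M"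
    using \<eta>c by (induction \<eta>s) (simp_all add: diag_coeff_regular_one)
  then have "cmod (1 - of_real ?M) < d" using \<eta>s(2)[of \<one>] one by simp
  then have "\<bar>1 - ?M\<bar> < d" by (metis norm_of_real of_real_1 of_real_diff)
  then have M: "?M < 2" using d by linarith
  \<comment> \<open>The sum of the coefficients of these vectors at \<open>g\<close> is the mean of
    the coefficient of \<open>\<xi>\<close> at the conjugates of \<open>g\<close>.\<close>
  define \<xi>s where "\<xi>s = map (\<lambda>i. of_real (1 / sqrt (real n)) \<odot>\<^bsub>H\<^esub> \<rho> (inv (h i)) \<xi>) [0..<n]"
  have "set \<xi>s \<subseteq> carrier H"
    using hD(1) \<xi> by (auto simp: \<xi>s_def intro!: H.smult_carrier rep_closed)
  have coeff: "diag_coeff H \<rho> (of_real (1 / sqrt (real n)) \<odot>\<^bsub>H\<^esub> \<rho> (inv (h i)) \<xi>) g = diag_coeff H \<rho> \<xi> (?\<gamma> g i) / of_nat n"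
    if i: "i < n" and g: "g \<in> carrier G" for i g
  proof -
    let ?a = "of_real (1 / sqrt (real n)) :: complex" and ?\<zeta> = "\<rho> (inv (h i)) \<xi>"
    have hc: "h i \<in> carrier G" using hD i by simp
    have \<zeta>: "?\<zeta> \<in> carrier H" using hc \<xi> rep_closed by simp
    have "diag_coeff H \<rho> (?a \<odot>\<^bsub>H\<^esub> ?\<zeta>) g = cnj ?a * (?a * hinner H ?\<zeta> (\<rho> g ?\<zeta>))"
      using \<zeta> g rep_closed H.smult_carrier
      by (simp add: diag_coeff_def rep_smult H.hinner_smult_left H.hinner_smult_right del: of_real_divide)
    also have "\<rho> g ?\<zeta> = \<rho> (g \<otimes> inv (h i)) \<xi>" using g hc \<xi> by (simp add: rep_mult)
    also have "hinner H ?\<zeta> (\<rho> (g \<otimes> inv (h i)) \<xi>) = diag_coeff H \<rho> \<xi> (?\<gamma> g i)"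
      using rep_inner_shift[of "inv (h i)" "g \<otimes> inv (h i)" \<xi>] g hc \<xi> by (simp add: m_assoc)
    also have "cnj ?a * (?a * diag_coeff H \<rho> \<xi> (?\<gamma> g i)) = of_real (1 / sqrt (real n) * (1 / sqrt (real n))) * diag_coeff H \<rho> \<xi> (?\<gamma> g i)"
      by (simp only: complex_cnj_complex_of_real of_real_mult mult.assoc)
    also have "1 / sqrt (real n) * (1 / sqrt (real n)) = 1 / real n" using n_pos by simp
    finally show ?thesis by simp
  qed
  have sum_eq: "(\<Sum>\<xi>\<leftarrow>\<xi>s. diag_coeff H \<rho> \<xi> g) = (\<Sum>i<n. diag_coeff H \<rho> \<xi> (?\<gamma> g i)) / of_nat n"
    if g: "g \<in> carrier G" for g
  proof -
    have "(\<Sum>\<xi>\<leftarrow>\<xi>s. diag_coeff H \<rho> \<xi> g) =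
        (\<Sum>i\<leftarrow>[0..<n]. diag_coeff H \<rho> (of_real (1 / sqrt (real n)) \<odot>\<^bsub>H\<^esub> \<rho> (inv (h i)) \<xi>) g)"
      by (simp add: \<xi>s_def comp_def)
    also have "\<dots> = (\<Sum>i<n. diag_coeff H \<rho> (of_real (1 / sqrt (real n)) \<odot>\<^bsub>H\<^esub> \<rho> (inv (h i)) \<xi>) g)"
      by (simp add: sum_list_distinct_conv_sum_set atLeast0LessThan del: of_real_divide)
    also have "\<dots> = (\<Sum>i<n. diag_coeff H \<rho> \<xi> (?\<gamma> g i) / of_nat n)"
      using coeff g by (intro sum.cong) auto
    finally show ?thesis by (simp add: sum_divide_distrib)
  qed
  have "cmod ((\<Sum>\<xi>\<leftarrow>\<xi>s. diag_coeff H \<rho> \<xi> g) - (if g = \<one> then 1 else 0)) < e" if g: "g \<in> F" for g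
  proof (cases "g = \<one>")
    case True
    have "?\<gamma> \<one> i = \<one>" if "i < n" for i using hD(1)[OF that] by simp
    then have "(\<Sum>i<n. diag_coeff H \<rho> \<xi> (?\<gamma> \<one> i)) = of_nat n" using one by simp
    then show ?thesis using sum_eq[of \<one>] n_pos e True by simp
  next
    case False
    have gc: "g \<in> carrier G" using g F by auto
    have "cmod (\<Sum>i<n. diag_coeff H \<rho> \<xi> (?\<gamma> g i)) \<le> (\<Sum>i<n. cmod (diag_coeff H \<rho> \<xi> (?\<gamma> g i)))"
      by (rule norm_sum)
    also have "\<dots> \<le> (\<Sum>i<n. (\<Sum>\<eta>\<leftarrow>\<eta>s. cmod (diag_coeff (ell2 G) (left_regular G) \<eta> (?\<gamma> g i))) + d)"
    proof (rule sum_mono)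
      fix i assume "i \<in> {..<n}"
      then have "?\<gamma> g i \<in> ?X" using g by auto
      then have "cmod (diag_coeff H \<rho> \<xi> (?\<gamma> g i)) \<le> cmod (?\<psi> (?\<gamma> g i)) + d"
        using \<eta>s(2)[of "?\<gamma> g i"] norm_triangle_sub[of "diag_coeff H \<rho> \<xi> (?\<gamma> g i)" "?\<psi> (?\<gamma> g i)"] by linarith
      also have "cmod (?\<psi> (?\<gamma> g i)) \<le> (\<Sum>\<eta>\<leftarrow>\<eta>s. cmod (diag_coeff (ell2 G) (left_regular G) \<eta> (?\<gamma> g i)))"
        by (induction \<eta>s) (auto intro: norm_triangle_mono)
      finally show "cmod (diag_coeff H \<rho> \<xi> (?\<gamma> g i)) \<le>
        (\<Sum>\<eta>\<leftarrow>\<eta>s. cmod (diag_coeff (ell2 G) (left_regular G) \<eta> (?\<gamma> g i))) + d" by simp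
    qed
    also have "\<dots> = (\<Sum>\<eta>\<leftarrow>\<eta>s. \<Sum>i<n. cmod (diag_coeff (ell2 G) (left_regular G) \<eta> (?\<gamma> g i))) + real n * d"
    proof -
      have "(\<Sum>i<n. \<Sum>\<eta>\<leftarrow>\<eta>s. c \<eta> i) = (\<Sum>\<eta>\<leftarrow>\<eta>s. \<Sum>i<n. c \<eta> i)" for c :: "_ \<Rightarrow> _ \<Rightarrow> real"
        by (induction \<eta>s) (simp_all add: sum.distrib)
      then show ?thesis by (simp add: sum.distrib)
    qed
    also have "(\<Sum>\<eta>\<leftarrow>\<eta>s. \<Sum>i<n. cmod (diag_coeff (ell2 G) (left_regular G) \<eta> (?\<gamma> g i)))
        \<le> (\<Sum>\<eta>\<leftarrow>\<eta>s. 2 * sqrt (real n) * mass \<eta> (carrier G))"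
    proof (rule sum_list_mono)
      fix \<eta> assume "\<eta> \<in> set \<eta>s"
      then show "(\<Sum>i<n. cmod (diag_coeff (ell2 G) (left_regular G) \<eta> (?\<gamma> g i))) \<le> 2 * sqrt (real n) * mass \<eta> (carrier G)"
        using powers_estimate[of \<eta> "{..<n}" "?\<gamma> g" D] \<eta>c hD g gc False by auto
    qed
    also have "\<dots> = 2 * sqrt (real n) * ?M" by (simp add: sum_list_const_mult)
    also have "\<dots> \<le> 2 * sqrt (real n) * 2" using M by (intro mult_left_mono) auto
    finally have "cmod (\<Sum>i<n. diag_coeff H \<rho> \<xi> (?\<gamma> g i)) \<le> 4 * sqrt (real n) + real n * d" by simp
    then have "cmod (\<Sum>i<n. diag_coeff H \<rho> \<xi> (?\<gamma> g i)) / real n \<le> (4 * sqrt (real n) + real n * d) / real n"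
      using n_pos by (intro divide_right_mono) auto
    also have "\<dots> = 4 / sqrt (real n) + d"
    proof -
      define q where "q = sqrt (real n)"
      have q: "q > 0" "real n = q * q" using n_pos by (simp_all add: q_def)
      have "(4 * q + (q * q) * d) / (q * q) = 4 / q + d" using q(1) by (simp add: field_simps)
      then show ?thesis unfolding q_def[symmetric] unfolding q(2) .
    qed
    also have "\<dots> < e"
    proof -
      have "4 / sqrt (real n) < 4 / (8 / e)" using sqrt_n e n_pos by (intro divide_strict_left_mono) auto
      then show ?thesis using d by simp
    qed
    finally show ?thesis using sum_eq[OF gc] False by (simp add: norm_divide)
  qed
  then show ?thesis using \<open>set \<xi>s \<subseteq> carrier H\<close> by blast
qed

lemma diag_coeff_finsum:
  assumes A: "finite A" "A \<subseteq> carrier G" and \<xi>: "\<xi> \<in> carrier H" and g: "g \<in> carrier G"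
  shows "diag_coeff H \<rho> (finsum H (\<lambda>x. c x \<odot>\<^bsub>H\<^esub> \<rho> x \<xi>) A) g =
    (\<Sum>y\<in>A. \<Sum>x\<in>A. cnj (c y) * c x * diag_coeff H \<rho> \<xi> (inv y \<otimes> (g \<otimes> x)))"
proof -
  let ?f = "\<lambda>x. c x \<odot>\<^bsub>H\<^esub> \<rho> x \<xi>"
  have f: "?f \<in> A \<rightarrow> carrier H" using A \<xi> by (auto intro!: H.smult_carrier rep_closed)
  have gf: "(\<lambda>x. \<rho> g (?f x)) \<in> A \<rightarrow> carrier H" using f g rep_closed by auto
  have "diag_coeff H \<rho> (finsum H ?f A) g = (\<Sum>y\<in>A. hinner H (?f y) (finsum H (\<lambda>x. \<rho> g (?f x)) A))"
    unfolding diag_coeff_def using A f gf g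
    by (simp add: rep_finsum H.hinner_finsum_left H.M.finsum_closed)
  also have "\<dots> = (\<Sum>y\<in>A. \<Sum>x\<in>A. hinner H (?f y) (\<rho> g (?f x)))"
    using A f gf by (intro sum.cong H.hinner_finsum_right) auto
  also have "\<dots> = (\<Sum>y\<in>A. \<Sum>x\<in>A. cnj (c y) * c x * diag_coeff H \<rho> \<xi> (inv y \<otimes> (g \<otimes> x)))"
  proof (intro sum.cong HOL.refl)
    fix y x assume "y \<in> A" "x \<in> A"
    then have xy: "x \<in> carrier G" "y \<in> carrier G" using A by auto
    have "hinner H (?f y) (\<rho> g (?f x)) = cnj (c y) * (c x * hinner H (\<rho> y \<xi>) (\<rho> g (\<rho> x \<xi>)))"
      using xy g \<xi> rep_closed H.smult_carrier by (simp add: rep_smult H.hinner_smult_left H.hinner_smult_right)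
    also have "\<rho> g (\<rho> x \<xi>) = \<rho> (g \<otimes> x) \<xi>" using xy g \<xi> by (simp add: rep_mult)
    also have "hinner H (\<rho> y \<xi>) (\<rho> (g \<otimes> x) \<xi>) = diag_coeff H \<rho> \<xi> (inv y \<otimes> (g \<otimes> x))"
      using xy g \<xi> by (intro rep_inner_shift) auto
    finally show "hinner H (?f y) (\<rho> g (?f x)) = cnj (c y) * c x * diag_coeff H \<rho> \<xi> (inv y \<otimes> (g \<otimes> x))"
      by (simp add: mult.assoc)
  qed
  finally show ?thesis .
qed

end

text \<open>The double sum is the correlation over those points of \<open>A\<close> whose translate
  also lies in \<open>A\<close>. At any other point one of the two factors is evaluated outside
  \<open>A\<close>, so \<open>split_correlation_bound\<close> applies to the complement of
  \<open>A\<close>.\<close>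

lemma (in group) truncated_correlation:
  assumes \<eta>: "\<eta> \<in> ell2_carrier G" and A: "finite A" "A \<subseteq> carrier G" and g: "g \<in> carrier G"
  shows "cmod (diag_coeff (ell2 G) (left_regular G) \<eta> g
      - (\<Sum>y\<in>A. \<Sum>x\<in>A. cnj (\<eta> y) * \<eta> x * (if inv y \<otimes> (g \<otimes> x) = \<one> then 1 else 0)))
    \<le> 2 * (sqrt (mass \<eta> (carrier G - A)) * sqrt (mass \<eta> (carrier G)))"
proof -
  let ?f = "\<lambda>x. cnj (\<eta> x) * \<eta> (inv g \<otimes> x)"
  let ?A = "{y \<in> A. inv g \<otimes> y \<in> A}"
  have iff: "inv y \<otimes> (g \<otimes> x) = \<one> \<longleftrightarrow> x = inv g \<otimes> y" if "y \<in> carrier G" "x \<in> carrier G" for x y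
    using that g by (metis inv_closed inv_equality inv_inv inv_solve_left m_closed r_inv r_one)
  have inner: "(\<Sum>x\<in>A. cnj (\<eta> y) * \<eta> x * (if inv y \<otimes> (g \<otimes> x) = \<one> then 1 else 0)) = (if inv g \<otimes> y \<in> A then ?f y else 0)"
    if y: "y \<in> A" for y
  proof -
    have "(\<Sum>x\<in>A. cnj (\<eta> y) * \<eta> x * (if inv y \<otimes> (g \<otimes> x) = \<one> then 1 else 0)) =
        (\<Sum>x\<in>A. if x = inv g \<otimes> y then ?f y else 0)"
      using y A iff by (intro sum.cong) (auto simp: subset_iff)
    then show ?thesis using A by simp
  qed
  have "(\<Sum>y\<in>A. \<Sum>x\<in>A. cnj (\<eta> y) * \<eta> x * (if inv y \<otimes> (g \<otimes> x) = \<one> then 1 else 0)) = (\<Sum>y\<in>A. if inv g \<otimes> y \<in> A then ?f y else 0)"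
    using inner by (rule sum.cong[OF HOL.refl])
  also have "\<dots> = (\<Sum>y\<in>?A. ?f y)" using A by (simp add: sum.If_cases Int_def)
  also have "\<dots> = infsum ?f ?A" using A by simp
  finally have fin: "(\<Sum>y\<in>A. \<Sum>x\<in>A. cnj (\<eta> y) * \<eta> x * (if inv y \<otimes> (g \<otimes> x) = \<one> then 1 else 0)) = infsum ?f ?A" .
  have sub: "?A \<subseteq> carrier G" using A by auto
  have "carrier G = ?A \<union> (carrier G - ?A)" using A by auto
  then have "infsum ?f (carrier G) = infsum ?f ?A + infsum ?f (carrier G - ?A)"
    using correlation_bound(1)[OF \<eta> g] sub by (metis (no_types, lifting) Diff_disjoint Diff_subset infsum_Un_disjoint)
  then have "diag_coeff (ell2 G) (left_regular G) \<eta> g - infsum ?f ?A = infsum ?f (carrier G - ?A)"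
    using diag_coeff_regular[OF \<eta>] by simp
  moreover have "cmod (infsum ?f (carrier G - ?A)) \<le> 2 * (sqrt (mass \<eta> (carrier G - A)) * sqrt (mass \<eta> (carrier G)))"
    using g by (intro split_correlation_bound[OF \<eta> g]) auto
  ultimately show ?thesis unfolding fin by simp
qed

lemma (in group) small_tail:
  assumes \<eta>: "\<eta> \<in> ell2_carrier G" and e: "e > 0"
  obtains A where "finite A" "A \<subseteq> carrier G" "mass \<eta> (carrier G - A) < e"
proof -
  have s: "(\<lambda>x. (cmod (\<eta> x))\<^sup>2) summable_on carrier G" using ell2_summable[OF \<eta>] by simp
  obtain A where A: "finite A" "A \<subseteq> carrier G" "norm ((\<Sum>x\<in>A. (cmod (\<eta> x))\<^sup>2) - mass \<eta> (carrier G)) \<le> e / 2"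
    using infsum_finite_approximation[OF s, of "e / 2"] e by (auto simp: mass_def dist_norm)
  have "mass \<eta> (A \<union> (carrier G - A)) = mass \<eta> A + mass \<eta> (carrier G - A)"
    unfolding mass_def using A by (intro infsum_Un_disjoint ell2_summable[OF \<eta>]) auto
  moreover have "A \<union> (carrier G - A) = carrier G" using A by auto
  moreover have "mass \<eta> A = (\<Sum>x\<in>A. (cmod (\<eta> x))\<^sup>2)" using A by (simp add: mass_def)
  ultimately have "mass \<eta> (carrier G - A) \<le> e / 2" using A(3) by (simp add: abs_le_iff)
  then show ?thesis using that A e by simp
qed

text \<open>Vectors whose coefficients approximate the delta function at the identity behave like
  the cyclic vector of the regular representation. Applying a finite truncation of
  \<open>\<eta>\<close> to them, as an element of the group algebra, nearly reproduces the
  coefficient of \<open>\<eta>\<close>.\<close>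

lemma (in unitary_representation) regular_weakly_contained:
  assumes disp: "has_displaced_sets" and inf: "infinite (carrier G)"
    and weak: "weakly_contained G H \<rho> (ell2 G) (left_regular G)"
  shows "weakly_contained G (ell2 G) (left_regular G) H \<rho>"
  unfolding weakly_contained_def
proof (intro ballI allI impI)
  fix \<eta> F and e :: real assume \<eta>: "\<eta> \<in> carrier (ell2 G)" and F: "finite F \<and> F \<subseteq> carrier G" and e: "e > 0"
  have \<eta>: "\<eta> \<in> ell2_carrier G" using \<eta> by (simp add: ell2_def)
  define N where "N = mass \<eta> (carrier G)"
  have N: "N \<ge> 0" by (simp add: N_def mass_nonneg)
  \<comment> \<open>Chosen so that the truncation error is at most \<open>e / 2\<close>; the summand
    1 avoids a zero denominator when \<open>\<eta> = 0\<close>.\<close>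
  define d where "d = (e / (4 * (sqrt N + 1)))\<^sup>2"
  have quarter: "t * (e / (4 * t)) = e / 4" if "t > 0" for t using that by simp
  have sN: "sqrt N + 1 > 0" using N by (intro add_nonneg_pos) auto
  then have "d > 0" using e by (simp add: d_def)
  then obtain A where A: "finite A" "A \<subseteq> carrier G" "mass \<eta> (carrier G - A) < d" using small_tail[OF \<eta>] by blast
  have tail: "2 * (sqrt (mass \<eta> (carrier G - A)) * sqrt N) \<le> e / 2"
  proof -
    have "sqrt (mass \<eta> (carrier G - A)) \<le> sqrt d" using A(3) by simp
    also have "\<dots> = e / (4 * (sqrt N + 1))" using e sN by (simp add: d_def)
    finally have "sqrt (mass \<eta> (carrier G - A)) * sqrt N \<le> e / (4 * (sqrt N + 1)) * (sqrt N + 1)"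
      using N e by (intro mult_mono) auto
    also have "\<dots> = e / 4" using quarter[OF sN] by (simp only: mult.commute)
    finally show ?thesis by simp
  qed
  \<comment> \<open>The total weight of the double sum: it multiplies the error of the approximate
    delta function, hence the tolerance \<open>e / (4 * (K + 1))\<close>.\<close>
  define K where "K = (\<Sum>y\<in>A. \<Sum>x\<in>A. cmod (\<eta> y) * cmod (\<eta> x))"
  have K: "K \<ge> 0" by (simp add: K_def sum_nonneg)
  let ?X = "(\<lambda>(g, y, x). inv y \<otimes> (g \<otimes> x)) ` (F \<times> A \<times> A)"
  have X: "finite ?X" "?X \<subseteq> carrier G" using F A by auto
  have "e / (4 * (K + 1)) > 0" using e K by simp
  then obtain \<xi>s where \<xi>s: "set \<xi>s \<subseteq> carrier H"
    "\<And>g. g \<in> ?X \<Longrightarrow> cmod ((\<Sum>\<xi>\<leftarrow>\<xi>s. diag_coeff H \<rho> \<xi> g) - (if g = \<one> then 1 else 0)) < e / (4 * (K + 1))"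
    using approximate_delta[OF disp inf weak X] by blast
  let ?\<Phi> = "\<lambda>g. \<Sum>\<xi>\<leftarrow>\<xi>s. diag_coeff H \<rho> \<xi> g" and ?\<delta> = "\<lambda>g. if g = \<one> then 1 else (0::complex)"
  define \<zeta> where "\<zeta> \<xi> = finsum H (\<lambda>x. \<eta> x \<odot>\<^bsub>H\<^esub> \<rho> x \<xi>) A" for \<xi>
  have \<zeta>_closed: "\<zeta> \<xi> \<in> carrier H" if "\<xi> \<in> set \<xi>s" for \<xi>
    unfolding \<zeta>_def using that \<xi>s(1) A by (intro H.M.finsum_closed) (auto intro!: H.smult_carrier rep_closed)
  have "cmod (diag_coeff (ell2 G) (left_regular G) \<eta> g - (\<Sum>\<zeta>\<leftarrow>map \<zeta> \<xi>s. diag_coeff H \<rho> \<zeta> g)) < e" if g: "g \<in> F" for g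
  proof -
    have gc: "g \<in> carrier G" using g F by auto
    let ?S = "\<lambda>\<theta>. \<Sum>y\<in>A. \<Sum>x\<in>A. cnj (\<eta> y) * \<eta> x * \<theta> (inv y \<otimes> (g \<otimes> x))"
    have "(\<Sum>\<zeta>\<leftarrow>map \<zeta> \<xi>s. diag_coeff H \<rho> \<zeta> g) = (\<Sum>\<xi>\<leftarrow>\<xi>s. ?S (diag_coeff H \<rho> \<xi>))"
      unfolding map_map comp_def \<zeta>_def using \<xi>s(1) A gc
      by (intro arg_cong[of _ _ sum_list] map_cong) (auto intro!: diag_coeff_finsum)
    also have "\<dots> = ?S ?\<Phi>"
      by (induction \<xi>s) (simp_all add: sum.distrib distrib_left)
    finally have eq: "(\<Sum>\<zeta>\<leftarrow>map \<zeta> \<xi>s. diag_coeff H \<rho> \<zeta> g) = ?S ?\<Phi>" .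
    have "?S ?\<delta> - ?S ?\<Phi> = (\<Sum>y\<in>A. \<Sum>x\<in>A. cnj (\<eta> y) * \<eta> x * (?\<delta> (inv y \<otimes> (g \<otimes> x)) - ?\<Phi> (inv y \<otimes> (g \<otimes> x))))"
      by (simp only: sum_subtractf[symmetric] right_diff_distrib[symmetric])
    also have "cmod \<dots> \<le> (\<Sum>y\<in>A. \<Sum>x\<in>A. (cmod (\<eta> y) * cmod (\<eta> x)) * (e / (4 * (K + 1))))"
    proof (intro order_trans[OF norm_sum] sum_mono)
      fix y x assume xy: "y \<in> A" "x \<in> A"
      let ?g = "inv y \<otimes> (g \<otimes> x)"
      have "?g \<in> ?X" using xy g by force
      then have "cmod (?\<delta> ?g - ?\<Phi> ?g) \<le> e / (4 * (K + 1))"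
        using \<xi>s(2)[of ?g] by (simp add: norm_minus_commute)
      then show "cmod (cnj (\<eta> y) * \<eta> x * (?\<delta> ?g - ?\<Phi> ?g)) \<le> (cmod (\<eta> y) * cmod (\<eta> x)) * (e / (4 * (K + 1)))"
        unfolding norm_mult complex_mod_cnj by (intro mult_left_mono) auto
    qed
    also have "\<dots> = K * (e / (4 * (K + 1)))"
      unfolding K_def by (simp only: sum_distrib_right)
    also have "\<dots> < e / 2"
    proof -
      have "K * (e / (4 * (K + 1))) \<le> (K + 1) * (e / (4 * (K + 1)))" using K e by (intro mult_right_mono) auto
      also have "\<dots> = e / 4" using K by (intro quarter) simp
      finally show ?thesis using e by linarith
    qed
    finally have "cmod (?S ?\<delta> - ?S ?\<Phi>) < e / 2" .
    moreover have "cmod (diag_coeff (ell2 G) (left_regular G) \<eta> g - ?S ?\<delta>) \<le> e / 2"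
      using truncated_correlation[OF \<eta> A(1,2) gc] tail by (simp add: N_def)
    ultimately have "cmod ((diag_coeff (ell2 G) (left_regular G) \<eta> g - ?S ?\<delta>) + (?S ?\<delta> - ?S ?\<Phi>)) < e"
      by (intro le_less_trans[OF norm_triangle_ineq]) linarith
    then show ?thesis unfolding eq by simp
  qed
  then show "\<exists>\<zeta>s. set \<zeta>s \<subseteq> carrier H \<and>
      (\<forall>g\<in>F. cmod (diag_coeff (ell2 G) (left_regular G) \<eta> g - (\<Sum>\<zeta>\<leftarrow>\<zeta>s. diag_coeff H \<rho> \<zeta> g)) < e)"
    using \<zeta>_closed by (intro exI[of _ "map \<zeta> \<xi>s"]) auto
qed

text \<open>Weak equivalence contains weak containment in the regular representation, so only the
  reverse containment has to be supplied.\<close>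

theorem (in group) cstar_simple_if_displaced_sets:
  assumes "has_displaced_sets" "infinite (carrier G)"
  shows "cstar_simple TYPE('h) G"
  unfolding cstar_simple_def weakly_equivalent_def
proof (intro allI impI)
  fix H :: "'h inner_space" and \<rho> assume "unitary_rep G H \<rho>"
  then interpret unitary_representation G H \<rho> by unfold_locales
  show "weakly_contained G H \<rho> (ell2 G) (left_regular G) \<longleftrightarrow>
    weakly_contained G H \<rho> (ell2 G) (left_regular G) \<and> weakly_contained G (ell2 G) (left_regular G) H \<rho>"
    using regular_weakly_contained[OF assms] by blast
qed

theorem corollary18:
  fixes W :: "('a, 'm) monoid_scheme" and S :: "'a set"
  assumes "coxeter_system W S"
    and "finite S"
    and "irreducible_coxeter W S"
    and "infinite (carrier W)"
    and "\<not> affine_coxeter W S"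
  shows "cstar_simple TYPE('h) W"
proof -
  interpret coxeter_system W S by (rule assms(1))
  have "has_displaced_sets"
    unfolding has_displaced_sets_def using displaced_half_space[OF assms(2-5)] by blast
  then show ?thesis using assms(4) by (rule cstar_simple_if_displaced_sets)
qed

end
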